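(* Fix $N\ge 1$, $\Lambda\ge 1$, $\beta\in(0,1]$ and $\alpha=1-\beta$. There exist constants $\varepsilon_0>0$, $C>0$ and $\gamma>0$, depending only on $N,\Lambda,\alpha,\beta$ (in particular independent of $\varepsilon$, $R$, $u$ and $f$), such that the following holds. Let $R>0$ and $0<\varepsilon<\varepsilon_0R$, let $f$ be a bounded Borel measurable real function on $B_{2R}$, and let $u:\mathbb{R}^N\to\mathbb{R}$ be a bounded Borel measurable function such that for every $x\in B_{2R}$ $$u(x)\le\alpha\sup_{z\in B_\Lambda}\frac{u(x+\varepsilon z)+u(x-\varepsilon z)}{2}+\frac{\beta}{|B_\varepsilon|}\int_{B_\varepsilon(x)}u(y)\,dy+\varepsilon^2|f(x)|$$ and $$u(x)\ge\alpha\inf_{z\in B_\Lambda}\frac{u(x+\varepsilon z)+u(x-\varepsilon z)}{2}+\frac{\beta}{|B_\varepsilon|}\int_{B_\varepsilon(x)}u(y)\,dy-\varepsilon^2|f(x)|.$$ Then for every $x,z\in B_R$, $$|u(x)-u(z)|\le\frac{C}{R^\gamma}\Big(\sup_{B_{2R}}|u|+R^2\|f\|_\infty\Big)\big(|x-z|^\gamma+\varepsilon^\gamma\big).$$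
   Context: $B_r(x)=\{y\in\mathbb{R}^N:|x-y|<r\}$, $B_r=B_r(0)$, $|E|$ is Lebesgue measure, and $\|f\|_\infty$ is the supremum of $|f|$. *)

theory Defs
  imports "HOL-Analysis.Analysis"
begin

end

theory Submission
  imports Defs
begin

text \<open>
  Both inequalities say that \<open>u\<close> and \<open>- u\<close> are supersolutions of the same extremal operator,
  so it suffices to run a discrete Krylov-Safonov argument for nonnegative supersolutions.
  A Gaussian barrier moves a small value of \<open>u\<close> from a point into the ball of radius 1/4.
  Then, instead of a convex envelope, paraboloids with vertices \<open>y\<close> are slid from below until they
  (almost) touch \<open>u\<close>. At a contact point the averaging term forces \<open>u\<close> to lie
  \<open>O(\<epsilon>\<^sup>2)\<close> above the paraboloid on most of the \<open>\<epsilon>\<close>-ball; hence contact points at distance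
  \<open>\<epsilon>/8\<close> have vertices at distance \<open>O(\<epsilon>)\<close>, and since the vertices fill a ball, \<open>u\<close> is bounded on a set of
  measure bounded below. A dyadic decomposition stopped at scale \<open>\<epsilon>\<close>, below which the averaging term
  gives pointwise bounds directly, turns this into growth from half measure, hence
  oscillation decay.
\<close>

subsection \<open>Averages over the unit ball\<close>

text \<open>The bracket of symmetrized values is controlled only through its extremes, so all
  quantitative information comes from the averaging term of weight \<beta>. Moreover
  \<open>u\<close> is merely bounded and measurable: it may jump at scale \<epsilon>, infima need
  not be attained, and contact points carry no gradients. Contact is therefore taken up to a slack
  \<open>\<epsilon>\<^sup>2\<close>, the order of the source term and of the second difference of a
  paraboloid. Near contact points are chosen arbitrarily and enter only through the finitely many
  grid cells they occupy; counting these cells takes the place of the area formula for the contact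
  map. Stopping the decomposition at scale \<epsilon> costs an additive error in the recursion
  \<open>a (M * t) \<le> (1 - \<mu>) * a t + \<mu> / 4\<close> for the measures \<open>a\<close> of
  superlevel sets. Its fixed point is 1/4, so a measure of at least 1/2 still grows geometrically as
  the level drops; before it can exceed the volume 1 of the unit cell, the pointwise alternative
  must occur. Measure 1/2 is available because \<open>u\<close> and its reflection, suitably
  normalized, cannot both be small at the same point.\<close>

definition loc_bdd_measurable :: "(real ^ 'n \<Rightarrow> real) \<Rightarrow> bool" where
  "loc_bdd_measurable g \<longleftrightarrow>
     g \<in> borel_measurable borel \<and> (\<forall>r. \<exists>B. \<forall>x. norm x \<le> r \<longrightarrow> \<bar>g x\<bar> \<le> B)"

lemma loc_bdd_measurableD: "loc_bdd_measurable g \<Longrightarrow> g \<in> borel_measurable borel"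
  by (simp add: loc_bdd_measurable_def)

text \<open>This admits the test functions. Paraboloids are unbounded on the whole space, which is
  why the class asks for bounds on balls only; compactness supplies them.\<close>

lemma loc_bdd_measurable_continuous:
  fixes g :: "real ^ 'n \<Rightarrow> real"
  assumes "continuous_on UNIV g"
  shows "loc_bdd_measurable g"
proof -
  have "\<exists>B. \<forall>x. norm x \<le> r \<longrightarrow> \<bar>g x\<bar> \<le> B" for r
  proof -
    have "compact (g ` cball 0 r)"
      by (rule compact_continuous_image[OF continuous_on_subset[OF assms]]) auto
    then obtain B where "\<forall>y\<in>g ` cball 0 r. norm y \<le> B"
      using compact_imp_bounded bounded_iff by metis
    then show ?thesis by (auto intro!: exI[of _ B])
  qed
  then show ?thesis
    using assms by (auto simp: loc_bdd_measurable_def borel_measurable_continuous_onI)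
qed

lemma loc_bdd_measurable_const: "loc_bdd_measurable (\<lambda>_. a)"
  by (intro loc_bdd_measurable_continuous continuous_on_const)

lemma loc_bdd_measurable_bounded:
  assumes "g \<in> borel_measurable borel" "bounded (range g)"
  shows "loc_bdd_measurable g"
  using assms by (auto simp: loc_bdd_measurable_def bounded_iff)

lemma loc_bdd_measurable_add:
  assumes "loc_bdd_measurable f" "loc_bdd_measurable g"
  shows "loc_bdd_measurable (\<lambda>x. f x + g x)"
proof -
  have "\<exists>B. \<forall>x. norm x \<le> r \<longrightarrow> \<bar>f x + g x\<bar> \<le> B" for r
  proof -
    obtain A B where "\<And>x. norm x \<le> r \<Longrightarrow> \<bar>f x\<bar> \<le> A" "\<And>x. norm x \<le> r \<Longrightarrow> \<bar>g x\<bar> \<le> B"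
      using assms unfolding loc_bdd_measurable_def by metis
    then have "\<forall>x. norm x \<le> r \<longrightarrow> \<bar>f x + g x\<bar> \<le> A + B"
      by (metis abs_triangle_ineq add_mono order_trans)
    then show ?thesis ..
  qed
  then show ?thesis
    using assms by (auto simp: loc_bdd_measurable_def)
qed

lemma loc_bdd_measurable_cmult:
  assumes "loc_bdd_measurable g"
  shows "loc_bdd_measurable (\<lambda>x. a * g x)"
proof -
  have "\<exists>B. \<forall>x. norm x \<le> r \<longrightarrow> \<bar>a * g x\<bar> \<le> B" for r
  proof -
    obtain B where "\<And>x. norm x \<le> r \<Longrightarrow> \<bar>g x\<bar> \<le> B"
      using assms unfolding loc_bdd_measurable_def by metis
    then have "\<forall>x. norm x \<le> r \<longrightarrow> \<bar>a * g x\<bar> \<le> \<bar>a\<bar> * B"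
      by (simp add: abs_mult mult_left_mono)
    then show ?thesis ..
  qed
  then show ?thesis
    using assms by (auto simp: loc_bdd_measurable_def)
qed

lemma loc_bdd_measurable_diff:
  assumes "loc_bdd_measurable f" "loc_bdd_measurable g"
  shows "loc_bdd_measurable (\<lambda>x. f x - g x)"
  using loc_bdd_measurable_add[OF assms(1) loc_bdd_measurable_cmult[OF assms(2), of "-1"]] by simp

lemma loc_bdd_measurable_affine:
  fixes g :: "real ^ 'n \<Rightarrow> real"
  assumes "loc_bdd_measurable g"
  shows "loc_bdd_measurable (\<lambda>h. g (x + c *\<^sub>R h))"
proof -
  have "\<exists>B. \<forall>h. norm h \<le> r \<longrightarrow> \<bar>g (x + c *\<^sub>R h)\<bar> \<le> B" for r
  proof -
    obtain B where B: "\<And>z. norm z \<le> norm x + \<bar>c\<bar> * r \<Longrightarrow> \<bar>g z\<bar> \<le> B"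
      using assms unfolding loc_bdd_measurable_def by metis
    have "norm (x + c *\<^sub>R h) \<le> norm x + \<bar>c\<bar> * r" if "norm h \<le> r" for h
      using norm_triangle_ineq[of x "c *\<^sub>R h"] mult_left_mono[OF that, of "\<bar>c\<bar>"] by simp
    then show ?thesis using B by blast
  qed
  moreover have "(\<lambda>h. g (x + c *\<^sub>R h)) \<in> borel_measurable borel"
    using loc_bdd_measurableD[OF assms] by measurable
  ultimately show ?thesis
    by (auto simp: loc_bdd_measurable_def)
qed

lemma set_integrable_ball:
  fixes g :: "real ^ 'n \<Rightarrow> real"
  assumes "loc_bdd_measurable g"
  shows "set_integrable lborel (ball x r) g"
proof -
  obtain B where B: "\<And>z. norm z \<le> norm x + r \<Longrightarrow> \<bar>g z\<bar> \<le> B"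
    using assms unfolding loc_bdd_measurable_def by metis
  have "norm z \<le> norm x + r" if "z \<in> ball x r" for z
    using that norm_triangle_ineq[of x "z - x"] by (simp add: dist_norm norm_minus_commute)
  then show ?thesis
    unfolding set_integrable_def
    using loc_bdd_measurableD[OF assms] B emeasure_lborel_ball_finite[of x r]
    by (intro integrableI_bounded_set_indicator[where B = B]) auto
qed

text \<open>The radius is moved into the argument of the function, so that averages over balls of
  all centres and radii share one domain and are compared pointwise in \<open>h\<close>.\<close>

definition avg :: "(real ^ 'n \<Rightarrow> real) \<Rightarrow> real" where
  "avg g = (LINT h:ball 0 1|lborel. g h) / measure lborel (ball (0 :: real ^ 'n) 1)"

lemma unit_ball_measure_pos: "measure lborel (ball (0 :: real ^ 'n) 1) > 0"
  by (rule content_ball_pos) simp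

lemma measure_ball_scale:
  "r \<ge> 0 \<Longrightarrow> measure lborel (ball (c :: real ^ 'n) r) = r ^ CARD('n) * measure lborel (ball (0 :: real ^ 'n) 1)"
  using content_ball_conv_unit_ball[of r c] by simp

lemma integral_lborel_affine:
  fixes g :: "real ^ 'n \<Rightarrow> real"
  assumes [measurable]: "g \<in> borel_measurable borel" and "c > 0"
  shows "(LINT y|lborel. g y) = c ^ CARD('n) * (LINT h|lborel. g (x + c *\<^sub>R h))"
proof -
  have "(LINT y|lborel. g y)
      = (LINT y|density (distr lborel borel (\<lambda>h. x + c *\<^sub>R h)) (\<lambda>_. \<bar>c\<bar> ^ CARD('n)). g y)"
    using lborel_affine[of c x] \<open>c > 0\<close> by simp
  also have "\<dots> = (LINT y|distr lborel borel (\<lambda>h. x + c *\<^sub>R h). \<bar>c\<bar> ^ CARD('n) * g y)"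
    by (subst integral_density) auto
  also have "\<dots> = (LINT h|lborel. \<bar>c\<bar> ^ CARD('n) * g (x + c *\<^sub>R h))"
    by (subst integral_distr) auto
  finally show ?thesis
    using \<open>c > 0\<close> by simp
qed

lemma avg_ball:
  fixes g :: "real ^ 'n \<Rightarrow> real"
  assumes [measurable]: "g \<in> borel_measurable borel" and "c > 0"
  shows "avg (\<lambda>h. g (x + c *\<^sub>R h))
       = (LINT y:ball x c|lborel. g y) / (c ^ CARD('n) * measure lborel (ball (0 :: real ^ 'n) 1))"
proof -
  have eq: "indicator (ball x c) (x + c *\<^sub>R h) = (indicator (ball 0 1) h :: real)" for h
    using \<open>c > 0\<close> by (auto simp: indicator_def dist_norm)
  have "(LINT y:ball x c|lborel. g y)
      = c ^ CARD('n) * (LINT h:ball 0 1|lborel. g (x + c *\<^sub>R h))"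
    unfolding set_lebesgue_integral_def
    by (subst integral_lborel_affine[OF _ \<open>c > 0\<close>, of _ x])
       (auto simp: eq intro!: borel_measurable_times borel_measurable_indicator)
  then show ?thesis
    using \<open>c > 0\<close> by (simp add: avg_def)
qed

lemma avg_const: "avg (\<lambda>h :: real ^ 'n. b) = b"
  using unit_ball_measure_pos[where 'n = 'n] emeasure_lborel_ball_finite[of "0 :: real ^ 'n" 1]
  by (simp add: avg_def set_lebesgue_integral_def)

lemma avg_add:
  assumes "loc_bdd_measurable f" "loc_bdd_measurable g"
  shows "avg (\<lambda>h. f h + g h) = avg f + avg g"
  unfolding avg_def
  by (subst set_integral_add(2)) (auto intro: set_integrable_ball assms simp: add_divide_distrib)

lemma avg_cmult: "avg (\<lambda>h. a * g h) = a * avg g"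
  by (simp add: avg_def)

lemma avg_mono:
  fixes f g :: "real ^ 'n \<Rightarrow> real"
  assumes "loc_bdd_measurable f" "loc_bdd_measurable g" "\<And>h. norm h < 1 \<Longrightarrow> f h \<le> g h"
  shows "avg f \<le> avg g"
  unfolding avg_def
  by (intro divide_right_mono set_integral_mono set_integrable_ball assms) auto

lemma avg_reflect:
  fixes g :: "real ^ 'n \<Rightarrow> real"
  assumes [measurable]: "g \<in> borel_measurable borel"
  shows "avg (\<lambda>h. g (- h)) = avg g"
proof -
  have "(LINT h|lborel. indicator (ball 0 1) h *\<^sub>R g h)
      = (LINT h|distr lborel borel uminus. indicator (ball 0 1) h *\<^sub>R g h)"
    using lborel_affine[of "-1" "0 :: real ^ 'n"] by (simp add: density_1 fun_Compl_def)
  also have "\<dots> = (LINT h|lborel. indicator (ball 0 1) (- h) *\<^sub>R g (- h))"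
    by (subst integral_distr) (auto intro!: borel_measurable_times borel_measurable_indicator)
  also have "\<dots> = (LINT h|lborel. indicator (ball 0 1) h *\<^sub>R g (- h))"
    by (rule Bochner_Integration.integral_cong) (auto simp: indicator_def)
  finally show ?thesis
    by (simp add: avg_def set_lebesgue_integral_def)
qed

text \<open>The ball is invariant under reflection, so odd parts cancel. A pointwise bound on second
  differences thereby becomes a bound on averages.\<close>

lemma avg_symmetrize:
  fixes g :: "real ^ 'n \<Rightarrow> real"
  assumes "loc_bdd_measurable g"
  shows "avg (\<lambda>h. (g (x + c *\<^sub>R h) + g (x - c *\<^sub>R h)) / 2) = avg (\<lambda>h. g (x + c *\<^sub>R h))"
proof -
  have m: "loc_bdd_measurable (\<lambda>h. g (x + c *\<^sub>R h))" "loc_bdd_measurable (\<lambda>h. g (x - c *\<^sub>R h))"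
    using loc_bdd_measurable_affine[OF assms, of x c] loc_bdd_measurable_affine[OF assms, of x "-c"]
    by auto
  have "avg (\<lambda>h. (g (x + c *\<^sub>R h) + g (x - c *\<^sub>R h)) / 2)
      = 1/2 * avg (\<lambda>h. g (x + c *\<^sub>R h) + g (x - c *\<^sub>R h))"
    by (subst avg_cmult[symmetric]) simp
  also have "\<dots> = 1/2 * (avg (\<lambda>h. g (x + c *\<^sub>R h)) + avg (\<lambda>h. g (x - c *\<^sub>R h)))"
    by (subst avg_add[OF m]) simp
  also have "avg (\<lambda>h. g (x - c *\<^sub>R h)) = avg (\<lambda>h. g (x + c *\<^sub>R h))"
    using avg_reflect[OF loc_bdd_measurableD[OF m(1)]] by simp
  finally show ?thesis by simp
qed

text \<open>Chebyshev's inequality. It serves in both directions: positive mass in a subset pushes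
  the average up, and a small average limits the measure of the set of large values.\<close>

lemma avg_lower_bound:
  fixes g :: "real ^ 'n \<Rightarrow> real"
  assumes g: "loc_bdd_measurable g" and c: "c > 0"
    and D [measurable]: "D \<in> sets borel" and sub: "D \<subseteq> ball x c"
    and nonneg: "\<And>y. y \<in> ball x c \<Longrightarrow> 0 \<le> g y" and ge: "\<And>y. y \<in> D \<Longrightarrow> b \<le> g y"
  shows "b * measure lborel D / (c ^ CARD('n) * measure lborel (ball (0 :: real ^ 'n) 1))
       \<le> avg (\<lambda>h. g (x + c *\<^sub>R h))"
proof -
  have fin: "emeasure lborel D < \<infinity>"
    using emeasure_mono[OF sub, of lborel] emeasure_lborel_ball_finite[of x c] by auto
  have "b * measure lborel D = (LINT y|lborel. b * indicator D y)"
    using fin by simp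
  also have "\<dots> \<le> (LINT y:ball x c|lborel. g y)"
    unfolding set_lebesgue_integral_def
  proof (rule integral_mono)
    show "integrable lborel (\<lambda>y. b * indicator D y)"
      using fin by (auto simp: integrable_indicator_iff)
    show "integrable lborel (\<lambda>y. indicator (ball x c) y *\<^sub>R g y)"
      using set_integrable_ball[OF g] unfolding set_integrable_def .
    show "b * indicator D y \<le> indicator (ball x c) y *\<^sub>R g y" for y
      using sub nonneg ge by (auto simp: indicator_def)
  qed
  finally show ?thesis
    unfolding avg_ball[OF loc_bdd_measurableD[OF g] c]
    using c unit_ball_measure_pos[where 'n = 'n] by (intro divide_right_mono) auto
qed

lemma measure_affine:
  fixes S :: "(real ^ 'n) set"
  assumes [measurable]: "S \<in> sets borel" and "r > 0"
  shows "measure lborel S = r ^ CARD('n) * measure lborel {x. c + r *\<^sub>R x \<in> S}"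
proof -
  have "(LINT y|lborel. indicator S y :: real)
      = r ^ CARD('n) * (LINT h|lborel. indicator S (c + r *\<^sub>R h))"
    by (rule integral_lborel_affine) (use \<open>r > 0\<close> in auto)
  also have "(\<lambda>h. indicator S (c + r *\<^sub>R h) :: real) = indicator {x. c + r *\<^sub>R x \<in> S}"
    by (auto simp: indicator_def)
  finally show ?thesis by simp
qed

text \<open>A concentric scale of one quarter is enough room for every later construction; the
  volume fraction \<open>1 / 4 ^ CARD('n)\<close> is the origin of this power in the constants
  below.\<close>

lemma avg_lower_ball:
  fixes g :: "real ^ 'n \<Rightarrow> real"
  assumes "loc_bdd_measurable g" "c > 0" "ball z (c / 4) \<subseteq> ball x c"
    and "\<And>y. y \<in> ball x c \<Longrightarrow> 0 \<le> g y" "\<And>y. y \<in> ball z (c / 4) \<Longrightarrow> b \<le> g y"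
  shows "b / 4 ^ CARD('n) \<le> avg (\<lambda>h. g (x + c *\<^sub>R h))"
proof -
  have "measure lborel (ball z (c / 4)) / (c ^ CARD('n) * measure lborel (ball (0 :: real ^ 'n) 1))
      = 1 / 4 ^ CARD('n)"
    using assms(2) unit_ball_measure_pos[where 'n = 'n]
    by (subst measure_ball_scale) (auto simp: power_divide)
  then have "b * measure lborel (ball z (c / 4)) / (c ^ CARD('n) * measure lborel (ball (0 :: real ^ 'n) 1))
      = b / 4 ^ CARD('n)"
    by (metis times_divide_eq_right mult.right_neutral)
  then show ?thesis
    using avg_lower_bound[OF assms(1,2) _ assms(3,4,5)] by simp
qed

subsection \<open>Gaussian averages\<close>

text \<open>\<open>2 * cosh t - 2\<close> is the square of
  \<open>exp (t / 2) - exp (- (t / 2))\<close>, which is at least \<open>t / 2\<close> for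
  nonnegative \<open>t\<close>. Any positive quadratic coefficient would serve, so the sharp one is
  not pursued.\<close>

lemma cosh_lower: "1 + t\<^sup>2 / 8 \<le> cosh (t :: real)"
proof -
  have *: "1 + t\<^sup>2 / 8 \<le> cosh t" if "t \<ge> 0" for t :: real
  proof -
    have "exp (- (t / 2)) \<le> 1" "1 + t / 2 \<le> exp (t / 2)"
      using that exp_ge_add_one_self[of "t / 2"] by auto
    then have "t / 2 \<le> exp (t / 2) - exp (- (t / 2))" by linarith
    then have "(t / 2)\<^sup>2 \<le> (exp (t / 2) - exp (- (t / 2)))\<^sup>2"
      using that by (intro power_mono) auto
    also have "\<dots> = exp t + exp (- t) - 2"
    proof -
      have "(exp (t / 2))\<^sup>2 = exp t" "(exp (- (t / 2)))\<^sup>2 = exp (- t)"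
        "exp (t / 2) * exp (- (t / 2)) = 1"
        by (simp_all add: power2_eq_square flip: exp_add)
      then show ?thesis by (simp add: power2_diff)
    qed
    finally show ?thesis
      by (simp add: cosh_def power_divide)
  qed
  show ?thesis
    using *[of t] *[of "-t"] by (cases "t \<ge> 0") auto
qed

text \<open>The mixed terms of the two exponents have opposite signs, so symmetrizing factors
  exactly: a damping that depends only on the length of \<open>k\<close>, and a gain
  \<open>cosh\<close> that depends only on its component along \<open>x\<close>.\<close>

lemma gaussian_symmetrized:
  fixes x k :: "real ^ 'n"
  shows "(exp (- p * ((x + k) \<bullet> (x + k))) + exp (- p * ((x - k) \<bullet> (x - k)))) / 2
       = exp (- p * (x \<bullet> x)) * (exp (- p * (k \<bullet> k)) * cosh (2 * p * (x \<bullet> k)))"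
  by (simp add: cosh_def algebra_simps inner_commute[of k x] flip: exp_add)

text \<open>On the quarter ball centred halfway to the sphere in direction \<open>x\<close>, every
  point has component at least 1/4 along \<open>x\<close>. This gives the factor 1/16, and the
  volume fraction gives the power of 4.\<close>

lemma avg_inner_squared_lower:
  fixes x :: "real ^ 'n"
  shows "(x \<bullet> x) / (16 * 4 ^ CARD('n)) \<le> avg (\<lambda>h. (x \<bullet> h)\<^sup>2)"
proof (cases "x = 0")
  case True
  then show ?thesis by (simp add: avg_const)
next
  case False
  define z where "z = (1 / (2 * norm x)) *\<^sub>R x"
  have nz: "norm z = 1 / 2" and xz: "x \<bullet> z = norm x / 2"
    using False by (auto simp: z_def dot_square_norm power2_eq_square)
  have sub: "ball z (1 / 4) \<subseteq> ball 0 1"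
  proof
    fix y assume "y \<in> ball z (1 / 4)"
    then have "norm (z - y) < 1 / 4" by (simp add: dist_norm)
    then show "y \<in> ball 0 1"
      using norm_triangle_ineq4[of z "z - y"] nz by simp
  qed
  have ge: "(x \<bullet> x) / 16 \<le> (x \<bullet> y)\<^sup>2" if "y \<in> ball z (1 / 4)" for y
  proof -
    have "norm (z - y) \<le> 1 / 4" using that by (simp add: dist_norm)
    then have "norm x * norm (z - y) \<le> norm x * (1 / 4)"
      by (intro mult_left_mono) auto
    then have "x \<bullet> (z - y) \<le> norm x / 4"
      using norm_cauchy_schwarz[of x "z - y"] by linarith
    then have "norm x / 4 \<le> x \<bullet> y"
      using xz by (simp add: inner_diff_right)
    then have "(norm x / 4)\<^sup>2 \<le> (x \<bullet> y)\<^sup>2"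
      by (intro power_mono) auto
    then show ?thesis
      by (simp add: power_divide dot_square_norm)
  qed
  have "loc_bdd_measurable (\<lambda>y. (x \<bullet> y)\<^sup>2)"
    by (intro loc_bdd_measurable_continuous continuous_intros)
  from avg_lower_ball[OF this, where c = 1 and x = 0, OF _ _ _ ge] sub show ?thesis
    by simp
qed

lemma gaussian_symmetrized_lower:
  fixes x h :: "real ^ 'n"
  assumes "p \<ge> 0" "norm h \<le> L"
  shows "exp (- p * (x \<bullet> x)) * (1 - p * c\<^sup>2 * L\<^sup>2)
       \<le> (exp (- p * ((x + c *\<^sub>R h) \<bullet> (x + c *\<^sub>R h))) + exp (- p * ((x - c *\<^sub>R h) \<bullet> (x - c *\<^sub>R h)))) / 2"
proof -
  let ?k = "c *\<^sub>R h"
  have "?k \<bullet> ?k = c\<^sup>2 * (norm h)\<^sup>2"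
    by (simp add: dot_square_norm power_mult_distrib)
  also have "\<dots> \<le> c\<^sup>2 * L\<^sup>2"
    using assms by (intro mult_left_mono power_mono) auto
  finally have "p * (?k \<bullet> ?k) \<le> p * c\<^sup>2 * L\<^sup>2"
    using mult_left_mono[of "?k \<bullet> ?k" _ p] \<open>p \<ge> 0\<close> by (simp add: mult.assoc)
  then have "1 - p * c\<^sup>2 * L\<^sup>2 \<le> exp (- p * (?k \<bullet> ?k))"
    using exp_ge_add_one_self[of "- p * (?k \<bullet> ?k)"] by simp
  also have "\<dots> \<le> exp (- p * (?k \<bullet> ?k)) * cosh (2 * p * (x \<bullet> ?k))"
    using cosh_real_ge_1[of "2 * p * (x \<bullet> ?k)"] by (intro mult_right_le_imp_le[of 1] mult_le_cancel_left1[THEN iffD2]) auto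
  finally show ?thesis
    unfolding gaussian_symmetrized by (intro mult_left_mono) auto
qed

text \<open>The loss is linear in \<open>p\<close> and the gain is quadratic, so for large
  \<open>p\<close> and \<open>x\<close> away from the origin the Gaussian is a strict subsolution of
  averaging. The bound \<open>p * c\<^sup>2 \<le> 1 / 2\<close> keeps the damping factor above 1/2,
  so that half of the quadratic gain survives.\<close>

lemma gaussian_avg_lower:
  fixes x :: "real ^ 'n"
  assumes "p \<ge> 0" "p * c\<^sup>2 \<le> 1 / 2"
  shows "exp (- p * (x \<bullet> x)) * (1 - p * c\<^sup>2 + p\<^sup>2 * c\<^sup>2 * (x \<bullet> x) / (64 * 4 ^ CARD('n)))
       \<le> avg (\<lambda>h. exp (- p * ((x + c *\<^sub>R h) \<bullet> (x + c *\<^sub>R h))))"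
proof -
  let ?\<phi> = "\<lambda>y :: real ^ 'n. exp (- p * (y \<bullet> y))"
  have \<phi>: "loc_bdd_measurable ?\<phi>"
    by (intro loc_bdd_measurable_continuous continuous_intros)
  have pointwise: "?\<phi> x * (1 - p * c\<^sup>2) + ?\<phi> x * (p\<^sup>2 * c\<^sup>2 / 4) * (x \<bullet> h)\<^sup>2
      \<le> (?\<phi> (x + c *\<^sub>R h) + ?\<phi> (x - c *\<^sub>R h)) / 2" if "norm h < 1" for h
  proof -
    let ?k = "c *\<^sub>R h"
    have "?k \<bullet> ?k = c\<^sup>2 * (norm h)\<^sup>2"
      by (simp add: dot_square_norm power_mult_distrib)
    also have "\<dots> \<le> c\<^sup>2 * 1"
      using that by (intro mult_left_mono) (auto simp: power_le_one)
    finally have "p * (?k \<bullet> ?k) \<le> p * c\<^sup>2"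
      using \<open>p \<ge> 0\<close> by (simp add: mult_left_mono)
    then have e: "1 - p * c\<^sup>2 \<le> exp (- p * (?k \<bullet> ?k))"
      using exp_ge_add_one_self[of "- p * (?k \<bullet> ?k)"] by simp
    have "(1 - p * c\<^sup>2) + p\<^sup>2 * c\<^sup>2 / 4 * (x \<bullet> h)\<^sup>2
        \<le> (1 - p * c\<^sup>2) + (1 - p * c\<^sup>2) * ((2 * p * (x \<bullet> ?k))\<^sup>2 / 8)"
    proof -
      have "1 / 2 * ((2 * p * (x \<bullet> ?k))\<^sup>2 / 8) \<le> (1 - p * c\<^sup>2) * ((2 * p * (x \<bullet> ?k))\<^sup>2 / 8)"
        using assms by (intro mult_right_mono) auto
      then show ?thesis by (simp add: power_mult_distrib mult_ac)
    qed
    also have "\<dots> = (1 - p * c\<^sup>2) * (1 + (2 * p * (x \<bullet> ?k))\<^sup>2 / 8)"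
      by (simp add: algebra_simps)
    also have "\<dots> \<le> exp (- p * (?k \<bullet> ?k)) * cosh (2 * p * (x \<bullet> ?k))"
      using e assms cosh_lower by (intro mult_mono) auto
    finally have "?\<phi> x * ((1 - p * c\<^sup>2) + p\<^sup>2 * c\<^sup>2 / 4 * (x \<bullet> h)\<^sup>2)
      \<le> ?\<phi> x * (exp (- p * (?k \<bullet> ?k)) * cosh (2 * p * (x \<bullet> ?k)))"
      by (intro mult_left_mono) auto
    then show ?thesis
      unfolding gaussian_symmetrized by (simp add: algebra_simps)
  qed
  have "?\<phi> x * (1 - p * c\<^sup>2 + p\<^sup>2 * c\<^sup>2 * (x \<bullet> x) / (64 * 4 ^ CARD('n)))
      = ?\<phi> x * (1 - p * c\<^sup>2) + ?\<phi> x * (p\<^sup>2 * c\<^sup>2 / 4) * ((x \<bullet> x) / (16 * 4 ^ CARD('n)))"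
    by (simp add: algebra_simps)
  also have "\<dots> \<le> ?\<phi> x * (1 - p * c\<^sup>2) + ?\<phi> x * (p\<^sup>2 * c\<^sup>2 / 4) * avg (\<lambda>h. (x \<bullet> h)\<^sup>2)"
    by (intro add_left_mono mult_left_mono avg_inner_squared_lower) auto
  also have "\<dots> = avg (\<lambda>h. ?\<phi> x * (1 - p * c\<^sup>2) + ?\<phi> x * (p\<^sup>2 * c\<^sup>2 / 4) * (x \<bullet> h)\<^sup>2)"
  proof -
    have "avg (\<lambda>h. a + b * (x \<bullet> h)\<^sup>2) = a + b * avg (\<lambda>h. (x \<bullet> h)\<^sup>2)" for a b
      by (subst avg_add)
         (auto simp: avg_const avg_cmult intro!: loc_bdd_measurable_continuous continuous_intros)
    from this[symmetric] show ?thesis .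
  qed
  also have "\<dots> \<le> avg (\<lambda>h. (?\<phi> (x + c *\<^sub>R h) + ?\<phi> (x - c *\<^sub>R h)) / 2)"
    using pointwise
    by (intro avg_mono loc_bdd_measurable_continuous continuous_intros) auto
  also have "\<dots> = avg (\<lambda>h. ?\<phi> (x + c *\<^sub>R h))"
    by (rule avg_symmetrize[OF \<phi>])
  finally show ?thesis .
qed

subsection \<open>Supersolutions of the dynamic programming principle\<close>

locale dpp =
  fixes \<Lambda> \<beta> :: real
  assumes Lambda: "1 \<le> \<Lambda>" and beta: "0 < \<beta>" "\<beta> \<le> 1"
begin

text \<open>Quantifying over the lower bounds \<open>m\<close> encodes the infimum: the latter is
  the largest such \<open>m\<close>, and \<open>1 - \<beta>\<close> is nonnegative. Rescaling and
  testing then never manipulate an infimum. The inequality is imposed on \<open>S\<close> only,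
  while \<open>u\<close> lives on the whole space because the bracket and the average reach beyond
  \<open>S\<close>.\<close>

definition supersol :: "real \<Rightarrow> real \<Rightarrow> (real ^ 'n) set \<Rightarrow> (real ^ 'n \<Rightarrow> real) \<Rightarrow> bool" where
  "supersol \<epsilon> F S u \<longleftrightarrow> u \<in> borel_measurable borel \<and> bounded (range u) \<and>
     (\<forall>x\<in>S. \<forall>m. (\<forall>z\<in>ball 0 \<Lambda>. m \<le> (u (x + \<epsilon> *\<^sub>R z) + u (x - \<epsilon> *\<^sub>R z)) / 2) \<longrightarrow>
        (1 - \<beta>) * m + \<beta> * avg (\<lambda>h. u (x + \<epsilon> *\<^sub>R h)) - \<epsilon>\<^sup>2 * F \<le> u x)"

lemma supersol_loc_bdd: "supersol \<epsilon> F S u \<Longrightarrow> loc_bdd_measurable u"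
  by (simp add: supersol_def loc_bdd_measurable_bounded)

lemma supersolD:
  assumes "supersol \<epsilon> F S u" "x \<in> S"
    and "\<And>z. norm z < \<Lambda> \<Longrightarrow> m \<le> (u (x + \<epsilon> *\<^sub>R z) + u (x - \<epsilon> *\<^sub>R z)) / 2"
  shows "(1 - \<beta>) * m + \<beta> * avg (\<lambda>h. u (x + \<epsilon> *\<^sub>R h)) - \<epsilon>\<^sup>2 * F \<le> u x"
  using assms by (auto simp: supersol_def)

lemma supersol_mono:
  assumes "supersol \<epsilon> F S u" "F \<le> F'" "S' \<subseteq> S"
  shows "supersol \<epsilon> F' S' u"
proof -
  have F: "\<epsilon>\<^sup>2 * F \<le> \<epsilon>\<^sup>2 * F'" using assms(2) by (intro mult_left_mono) auto
  have "(1 - \<beta>) * m + \<beta> * avg (\<lambda>h. u (x + \<epsilon> *\<^sub>R h)) - \<epsilon>\<^sup>2 * F' \<le> u x"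
    if "x \<in> S'" "\<forall>z\<in>ball 0 \<Lambda>. m \<le> (u (x + \<epsilon> *\<^sub>R z) + u (x - \<epsilon> *\<^sub>R z)) / 2" for x m
  proof -
    have "(1 - \<beta>) * m + \<beta> * avg (\<lambda>h. u (x + \<epsilon> *\<^sub>R h)) - \<epsilon>\<^sup>2 * F \<le> u x"
      using assms(1,3) that unfolding supersol_def by blast
    then show ?thesis using F by linarith
  qed
  then show ?thesis
    using assms(1) unfolding supersol_def by blast
qed

text \<open>The weights \<open>1 - \<beta>\<close> and \<beta> add up to 1, so the operator commutes
  with affine changes of the values; the source carries the square of a length, hence the factor
  \<open>\<rho>\<^sup>2 / t\<close>.\<close>

lemma supersol_rescale:
  fixes u :: "real ^ 'n \<Rightarrow> real"
  assumes u: "supersol \<epsilon> F S u" and "\<rho> > 0" "t > 0"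
    and sub: "\<And>x. x \<in> S' \<Longrightarrow> c + \<rho> *\<^sub>R x \<in> S"
  shows "supersol (\<epsilon> / \<rho>) (F * \<rho>\<^sup>2 / t) S' (\<lambda>x. (u (c + \<rho> *\<^sub>R x) + b) / t)"
proof -
  have [measurable]: "u \<in> borel_measurable borel" using u by (simp add: supersol_def)
  have "(\<lambda>x. (u (c + \<rho> *\<^sub>R x) + b) / t) \<in> borel_measurable borel" by measurable
  moreover have "bounded (range (\<lambda>x. (u (c + \<rho> *\<^sub>R x) + b) / t))"
  proof -
    obtain B where B: "\<And>x. \<bar>u x\<bar> \<le> B"
      using u by (auto simp: supersol_def bounded_iff)
    have "\<bar>(u (c + \<rho> *\<^sub>R x) + b) / t\<bar> \<le> (B + \<bar>b\<bar>) / t" for x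
      using B[of "c + \<rho> *\<^sub>R x"] \<open>t > 0\<close> by (auto simp: abs_divide intro!: divide_right_mono)
    then show ?thesis by (auto simp: bounded_iff)
  qed
  moreover have "(1 - \<beta>) * m + \<beta> * avg (\<lambda>h. (u (c + \<rho> *\<^sub>R (x + (\<epsilon> / \<rho>) *\<^sub>R h)) + b) / t)
      - (\<epsilon> / \<rho>)\<^sup>2 * (F * \<rho>\<^sup>2 / t) \<le> (u (c + \<rho> *\<^sub>R x) + b) / t"
    if x: "x \<in> S'" and m: "\<forall>z\<in>ball 0 \<Lambda>. m \<le> ((u (c + \<rho> *\<^sub>R (x + (\<epsilon> / \<rho>) *\<^sub>R z)) + b) / t
        + (u (c + \<rho> *\<^sub>R (x - (\<epsilon> / \<rho>) *\<^sub>R z)) + b) / t) / 2" for x m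
  proof -
    define x' where "x' = c + \<rho> *\<^sub>R x"
    have shift: "c + \<rho> *\<^sub>R (x + (\<epsilon> / \<rho>) *\<^sub>R h) = x' + \<epsilon> *\<^sub>R h"
      "c + \<rho> *\<^sub>R (x - (\<epsilon> / \<rho>) *\<^sub>R h) = x' - \<epsilon> *\<^sub>R h" for h
      using \<open>\<rho> > 0\<close> by (auto simp: x'_def algebra_simps)
    have "t * m - b \<le> (u (x' + \<epsilon> *\<^sub>R z) + u (x' - \<epsilon> *\<^sub>R z)) / 2" if "norm z < \<Lambda>" for z
    proof -
      have "m \<le> ((u (x' + \<epsilon> *\<^sub>R z) + b) / t + (u (x' - \<epsilon> *\<^sub>R z) + b) / t) / 2"
        using m that by (auto simp: shift)
      also have "\<dots> = (u (x' + \<epsilon> *\<^sub>R z) + u (x' - \<epsilon> *\<^sub>R z) + 2 * b) / (2 * t)"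
        using \<open>t > 0\<close> by (simp add: field_simps)
      finally show ?thesis using \<open>t > 0\<close> by (simp add: pos_le_divide_eq) (simp add: algebra_simps)
    qed
    then have "(1 - \<beta>) * (t * m - b) + \<beta> * avg (\<lambda>h. u (x' + \<epsilon> *\<^sub>R h)) - \<epsilon>\<^sup>2 * F \<le> u x'"
      using supersolD[OF u] sub[OF x] x'_def by blast
    moreover have "avg (\<lambda>h. (u (x' + \<epsilon> *\<^sub>R h) + b) / t) = (avg (\<lambda>h. u (x' + \<epsilon> *\<^sub>R h)) + b) / t"
    proof -
      have "avg (\<lambda>h. (u (x' + \<epsilon> *\<^sub>R h) + b) / t) = avg (\<lambda>h. (1 / t) * (u (x' + \<epsilon> *\<^sub>R h) + b))"
        by simp
      also have "\<dots> = (1 / t) * avg (\<lambda>h. u (x' + \<epsilon> *\<^sub>R h) + b)"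
        by (rule avg_cmult)
      also have "avg (\<lambda>h. u (x' + \<epsilon> *\<^sub>R h) + b) = avg (\<lambda>h. u (x' + \<epsilon> *\<^sub>R h)) + b"
        using loc_bdd_measurable_affine[OF supersol_loc_bdd[OF u]]
        by (subst avg_add) (auto simp: avg_const intro!: loc_bdd_measurable_bounded)
      finally show ?thesis by simp
    qed
    moreover have "(1 - \<beta>) * m + \<beta> * ((a + b) / t) - (\<epsilon> / \<rho>)\<^sup>2 * (F * \<rho>\<^sup>2 / t)
        = ((1 - \<beta>) * (t * m - b) + \<beta> * a - \<epsilon>\<^sup>2 * F + b) / t" for a
      using \<open>\<rho> > 0\<close> \<open>t > 0\<close> by (simp add: field_simps power2_eq_square)
    ultimately show ?thesis
      unfolding shift x'_def[symmetric] using \<open>t > 0\<close> by (simp add: divide_right_mono)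
  qed
  ultimately show ?thesis
    unfolding supersol_def by blast
qed

text \<open>Here \<open>m\<close> stands for a contact level that need not be attained, and \<kappa>
  for the largest drop of \<psi> under symmetrization. The average of \<open>u - \<psi>\<close> is
  left in the inequality: the barrier bounds it below by \<open>m\<close>, whereas the contact
  estimate extracts an upper bound for it.\<close>

lemma supersol_test:
  fixes u :: "real ^ 'n \<Rightarrow> real"
  assumes u: "supersol \<epsilon> F S u" and x: "x \<in> S" and \<psi>: "loc_bdd_measurable \<psi>"
    and m: "\<And>h. norm h < \<Lambda> \<Longrightarrow> m \<le> u (x + \<epsilon> *\<^sub>R h) - \<psi> (x + \<epsilon> *\<^sub>R h)"
    and \<kappa>: "\<And>h. norm h < \<Lambda> \<Longrightarrow> \<psi> x - \<kappa> \<le> (\<psi> (x + \<epsilon> *\<^sub>R h) + \<psi> (x - \<epsilon> *\<^sub>R h)) / 2"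
  shows "(1 - \<beta>) * (m + \<psi> x - \<kappa>)
      + \<beta> * (avg (\<lambda>h. u (x + \<epsilon> *\<^sub>R h) - \<psi> (x + \<epsilon> *\<^sub>R h)) + avg (\<lambda>h. \<psi> (x + \<epsilon> *\<^sub>R h))) - \<epsilon>\<^sup>2 * F \<le> u x"
proof -
  have "m + \<psi> x - \<kappa> \<le> (u (x + \<epsilon> *\<^sub>R z) + u (x - \<epsilon> *\<^sub>R z)) / 2" if "norm z < \<Lambda>" for z
    using m[of z] m[of "-z"] \<kappa>[of z] that by simp
  then have "(1 - \<beta>) * (m + \<psi> x - \<kappa>) + \<beta> * avg (\<lambda>h. u (x + \<epsilon> *\<^sub>R h)) - \<epsilon>\<^sup>2 * F \<le> u x"
    by (rule supersolD[OF u x])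
  moreover have "avg (\<lambda>h. u (x + \<epsilon> *\<^sub>R h) - \<psi> (x + \<epsilon> *\<^sub>R h)) + avg (\<lambda>h. \<psi> (x + \<epsilon> *\<^sub>R h))
      = avg (\<lambda>h. u (x + \<epsilon> *\<^sub>R h))"
    by (subst avg_add[symmetric])
       (auto intro!: loc_bdd_measurable_diff loc_bdd_measurable_affine \<psi> supersol_loc_bdd[OF u])
  ultimately show ?thesis by simp
qed

lemma supersol_nonneg_avg:
  fixes u :: "real ^ 'n \<Rightarrow> real"
  assumes u: "supersol \<epsilon> F S u" and x: "x \<in> S" and "\<epsilon> > 0"
    and "\<And>y. y \<in> ball x (\<Lambda> * \<epsilon>) \<Longrightarrow> 0 \<le> u y"
  shows "\<beta> * avg (\<lambda>h. u (x + \<epsilon> *\<^sub>R h)) - \<epsilon>\<^sup>2 * F \<le> u x"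
proof -
  have "0 \<le> (u (x + \<epsilon> *\<^sub>R z) + u (x - \<epsilon> *\<^sub>R z)) / 2" if "norm z < \<Lambda>" for z
    using assms(4)[of "x + \<epsilon> *\<^sub>R z"] assms(4)[of "x - \<epsilon> *\<^sub>R z"] that \<open>\<epsilon> > 0\<close>
    by (auto simp: dist_norm)
  from supersolD[OF u x this] show ?thesis by simp
qed

subsection \<open>The barrier\<close>

text \<open>If \<open>u\<close> were large on the small ball, then \<open>u\<close> minus a shifted
  Gaussian would have a negative infimum, nearly attained in the annulus between the radii 1/4 and
  \<open>K + 1\<close>. There the Gaussian is a strict subsolution even against the worst choice in
  the bracket, a contradiction.\<close>

lemma supersol_barrier:
  fixes K :: real
  assumes "K > 0"
  shows "\<exists>M>0. \<exists>\<epsilon>\<^sub>1>0. \<forall>\<epsilon> (u :: real ^ 'n \<Rightarrow> real) x\<^sub>0. 0 < \<epsilon> \<longrightarrow> \<epsilon> < \<epsilon>\<^sub>1 \<longrightarrow>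
    supersol \<epsilon> 1 (ball 0 (K + 2)) u \<longrightarrow> (\<forall>y\<in>ball 0 (K + 3). 0 \<le> u y) \<longrightarrow>
    norm x\<^sub>0 \<le> K \<longrightarrow> u x\<^sub>0 \<le> 1 \<longrightarrow> (\<exists>x\<^sub>1\<in>ball 0 (1 / 4). u x\<^sub>1 \<le> M)"
proof -
  \<comment> \<open>\<open>c\<close> is the gain coefficient of \<open>gaussian_avg_lower\<close> at
    the inner radius, where \<open>x \<bullet> x = 1 / 16\<close>. The choice of \<open>p\<close>
    makes the gain \<open>\<beta> * p\<^sup>2 * c\<close> exceed both losses,
    \<open>\<beta> * p\<close> from the average and
    \<open>(1 - \<beta>) * p * \<Lambda>\<^sup>2\<close> from the bracket.\<close>
  define c :: real where "c = 1 / (16 * (64 * 4 ^ CARD('n)))"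
  define p where "p = (\<Lambda>\<^sup>2 + 2) / (\<beta> * c)"
  define \<phi> where "\<phi> y = exp (- p * (y \<bullet> y))" for y :: "real ^ 'n"
  define e0 e1 where "e0 = exp (- p * K\<^sup>2)" and "e1 = exp (- p * (K + 1)\<^sup>2)"
  \<comment> \<open>The first summand makes \<psi> at least 2 on the ball of radius
    \<open>K\<close>; the second makes \<open>A * \<phi>\<close> at least 2 up to radius
    \<open>K + 1\<close>, which yields \<open>2 * \<epsilon>\<^sup>2 \<le> G\<close> below.\<close>
  define A where "A = 2 / (e0 - e1) + 2 / e1"
  define \<psi> where "\<psi> y = A * \<phi> y - A * e1" for y
  \<comment> \<open>The first bound gives the smallness required by
    \<open>gaussian_avg_lower\<close>; the second keeps all points reached from radius
    \<open>K + 1\<close> inside radius \<open>K + 3\<close>, where \<open>u\<close> is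
    nonnegative.\<close>
  define \<epsilon>\<^sub>1 where "\<epsilon>\<^sub>1 = min (1 / (2 * p)) (2 / \<Lambda>)"
  have "(1 :: real) \<le> 4 ^ CARD('n)" by simp
  then have "1 \<le> 1024 * (4 :: real) ^ CARD('n)" by linarith
  then have c: "0 < c" "c \<le> 1" by (auto simp: c_def divide_le_eq)
  have bc: "0 < \<beta> * c" "\<beta> * c \<le> 1" using c beta by (auto simp: mult_le_one)
  have pbc: "\<beta> * p * c = \<Lambda>\<^sup>2 + 2"
    using c beta by (simp add: p_def)
  have p2: "p \<ge> 2"
    unfolding p_def using bc by (subst pos_le_divide_eq) (auto intro: add_increasing)
  have e: "0 < e1" "e1 < e0"
    using p2 \<open>K > 0\<close> by (auto simp: e0_def e1_def intro!: power_strict_mono)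
  have A: "A > 0" "2 \<le> A * (e0 - e1)" "2 \<le> A * e1"
  proof -
    show "A > 0" using e by (auto simp: A_def intro!: add_pos_pos)
    have "2 / (e0 - e1) \<le> A" "2 / e1 \<le> A"
      using e by (auto simp: A_def)
    then show "2 \<le> A * (e0 - e1)" "2 \<le> A * e1" using e by (simp_all add: pos_divide_le_eq)
  qed
  have \<phi>_mono: "exp (- p * r\<^sup>2) \<le> \<phi> y" if "norm y \<le> r" for y r
    using power_mono[OF that, of 2] p2 by (simp add: \<phi>_def dot_square_norm)
  have \<phi>_anti: "\<phi> y \<le> exp (- p * r\<^sup>2)" if "r \<le> norm y" "r \<ge> 0" for y r
    using power_mono[OF that(1), of 2] that p2 by (simp add: \<phi>_def dot_square_norm)
  have \<phi>_le1: "\<phi> y \<le> 1" for y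
    using \<phi>_anti[of 0 y] by simp
  have lb_\<phi>: "loc_bdd_measurable \<phi>" and lb_\<psi>: "loc_bdd_measurable \<psi>"
    unfolding \<psi>_def \<phi>_def by (intro loc_bdd_measurable_continuous continuous_intros)+
  have avg_\<psi>: "avg (\<lambda>h. \<psi> (x + \<epsilon> *\<^sub>R h)) = A * avg (\<lambda>h. \<phi> (x + \<epsilon> *\<^sub>R h)) - A * e1" for x \<epsilon>
    using avg_add[OF loc_bdd_measurable_cmult[OF loc_bdd_measurable_affine[OF lb_\<phi>], of A x \<epsilon>]
        loc_bdd_measurable_const[of "- (A * e1)"]]
    unfolding \<psi>_def by (simp add: avg_const avg_cmult)
  have "\<exists>x\<^sub>1\<in>ball 0 (1 / 4). u x\<^sub>1 \<le> A"
    if \<epsilon>: "0 < \<epsilon>" "\<epsilon> < \<epsilon>\<^sub>1" and u: "supersol \<epsilon> 1 (ball 0 (K + 2)) u"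
      and nonneg: "\<forall>y\<in>ball 0 (K + 3). 0 \<le> u y" and x0: "norm x\<^sub>0 \<le> K" "u x\<^sub>0 \<le> 1"
    for \<epsilon> and u :: "real ^ 'n \<Rightarrow> real" and x\<^sub>0
  proof (rule ccontr)
    assume "\<not> ?thesis"
    then have big: "u y > A" if "norm y < 1 / 4" for y
      using that by (force simp: not_le)
    have pe: "p * \<epsilon>\<^sup>2 \<le> 1 / 2" and \<Lambda>e: "\<epsilon> * \<Lambda> < 2" and "\<epsilon> < 1"
    proof -
      have "\<epsilon> * (2 * p) < 1" using \<epsilon> p2 by (simp add: \<epsilon>\<^sub>1_def field_simps)
      then have 1: "p * \<epsilon> < 1 / 2" by (simp add: mult.commute)
      have "2 * \<epsilon> \<le> p * \<epsilon>" using p2 \<epsilon> by (intro mult_right_mono) auto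
      then show "\<epsilon> < 1" using 1 by linarith
      then have "p * \<epsilon> * \<epsilon> \<le> 1 / 2 * 1" using 1 \<epsilon> p2 by (intro mult_mono) auto
      then show "p * \<epsilon>\<^sup>2 \<le> 1 / 2" by (simp add: power2_eq_square mult.assoc)
      show "\<epsilon> * \<Lambda> < 2" using \<epsilon> Lambda by (simp add: \<epsilon>\<^sub>1_def field_simps)
    qed
    define w where "w y = u y - \<psi> y" for y
    define m where "m = (INF y\<in>ball 0 (K + 3). w y)"
    have \<psi>_le: "\<psi> y \<le> A" for y
    proof -
      have "A * \<phi> y \<le> A * 1" using A by (intro mult_left_mono \<phi>_le1) auto
      then show ?thesis using A unfolding \<psi>_def by linarith
    qed
    have bdd: "bdd_below (w ` ball 0 (K + 3))"
    proof (rule bdd_belowI2)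
      show "- A \<le> w y" if "y \<in> ball 0 (K + 3)" for y
        using nonneg that \<psi>_le[of y] by (force simp: w_def)
    qed
    have m_le: "m \<le> w y" if "norm y < K + 3" for y
      using that bdd by (auto simp: m_def intro!: cINF_lower)
    have "2 \<le> \<psi> x\<^sub>0"
    proof -
      have "A * e0 \<le> A * \<phi> x\<^sub>0"
        unfolding e0_def using A by (intro mult_left_mono \<phi>_mono x0(1)) auto
      then show ?thesis using A(2) unfolding \<psi>_def right_diff_distrib by linarith
    qed
    then have "m \<le> -1"
      using m_le[of x\<^sub>0] x0 by (simp add: w_def)
    \<comment> \<open>The strict gain \<open>G \<ge> 2 * \<epsilon>\<^sup>2\<close> pays for two
      errors of size \<open>\<epsilon>\<^sup>2\<close>: this slack in the infimum and the source
      term.\<close>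
    obtain x where x: "norm x < K + 3" "w x < m + \<epsilon>\<^sup>2"
    proof -
      have "\<exists>x\<in>ball 0 (K + 3). w x < m + \<epsilon>\<^sup>2"
        unfolding m_def using \<epsilon> bdd \<open>K > 0\<close> by (subst cINF_less_iff[symmetric]) auto
      then show ?thesis using that by auto
    qed
    have "\<epsilon>\<^sup>2 < 1" using \<epsilon> \<open>\<epsilon> < 1\<close> by (simp add: power_less_one_iff abs_square_less_1)
    then have neg: "w x < 0" using x \<open>m \<le> -1\<close> by linarith
    have "norm x < K + 1"
    proof (rule ccontr)
      assume "\<not> ?thesis"
      then have "\<phi> x \<le> e1" unfolding e1_def using \<open>K > 0\<close> by (intro \<phi>_anti) auto
      then have "\<psi> x \<le> 0" using A by (simp add: \<psi>_def)
      then show False using neg nonneg x by (force simp: w_def)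
    qed
    moreover have "1 / 4 \<le> norm x"
    proof (rule ccontr)
      assume "\<not> ?thesis"
      then show False using big[of x] \<psi>_le[of x] neg by (simp add: w_def)
    qed
    ultimately have nx: "1 / 4 \<le> norm x" "norm x < K + 1" by auto
    define G where "G = A * \<phi> x * \<epsilon>\<^sup>2"
    have "e1 \<le> \<phi> x" unfolding e1_def using nx by (intro \<phi>_mono) auto
    then have "2 \<le> A * \<phi> x" using mult_left_mono[of e1 "\<phi> x" A] A by linarith
    then have G: "2 * \<epsilon>\<^sup>2 \<le> G" unfolding G_def by (intro mult_right_mono) auto
    have near: "norm (x + \<epsilon> *\<^sub>R h) < K + 3" if "norm h < \<Lambda>" for h
    proof -
      have "norm (x + \<epsilon> *\<^sub>R h) \<le> norm x + \<epsilon> * norm h"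
        using norm_triangle_ineq[of x "\<epsilon> *\<^sub>R h"] \<epsilon> by simp
      also have "\<epsilon> * norm h \<le> \<epsilon> * \<Lambda>" using that \<epsilon> by (intro mult_left_mono) auto
      finally show ?thesis using nx \<Lambda>e by linarith
    qed
    have "(1 - \<beta>) * (m + \<psi> x - G * (p * \<Lambda>\<^sup>2))
      + \<beta> * (avg (\<lambda>h. u (x + \<epsilon> *\<^sub>R h) - \<psi> (x + \<epsilon> *\<^sub>R h)) + avg (\<lambda>h. \<psi> (x + \<epsilon> *\<^sub>R h))) - \<epsilon>\<^sup>2 * 1 \<le> u x"
    proof (rule supersol_test[OF u _ lb_\<psi>])
      show "m \<le> u (x + \<epsilon> *\<^sub>R h) - \<psi> (x + \<epsilon> *\<^sub>R h)" if "norm h < \<Lambda>" for h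
        using m_le[OF near[OF that]] by (simp add: w_def)
      show "\<psi> x - G * (p * \<Lambda>\<^sup>2) \<le> (\<psi> (x + \<epsilon> *\<^sub>R h) + \<psi> (x - \<epsilon> *\<^sub>R h)) / 2" if "norm h < \<Lambda>" for h
      proof -
        have "\<phi> x * (1 - p * \<epsilon>\<^sup>2 * \<Lambda>\<^sup>2) \<le> (\<phi> (x + \<epsilon> *\<^sub>R h) + \<phi> (x - \<epsilon> *\<^sub>R h)) / 2"
          unfolding \<phi>_def using that p2 by (intro gaussian_symmetrized_lower) auto
        from mult_left_mono[OF this, of A] show ?thesis
          using A by (simp add: \<psi>_def G_def algebra_simps)
      qed
    qed (use nx in auto)
    moreover have avg_w: "m \<le> avg (\<lambda>h. u (x + \<epsilon> *\<^sub>R h) - \<psi> (x + \<epsilon> *\<^sub>R h))"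
    proof -
      have "loc_bdd_measurable w"
        unfolding w_def by (intro loc_bdd_measurable_diff lb_\<psi> supersol_loc_bdd[OF u])
      then have "avg (\<lambda>h :: real ^ 'n. m) \<le> avg (\<lambda>h. w (x + \<epsilon> *\<^sub>R h))"
        using m_le[OF near] Lambda
        by (intro avg_mono[OF loc_bdd_measurable_const loc_bdd_measurable_affine]) auto
      then show ?thesis by (simp add: avg_const w_def)
    qed
    moreover have avg_\<psi>_lower: "\<psi> x + G * (p\<^sup>2 * c - p) \<le> avg (\<lambda>h. \<psi> (x + \<epsilon> *\<^sub>R h))"
    proof -
      have "(1 / 4)\<^sup>2 \<le> x \<bullet> x"
        unfolding dot_square_norm using nx by (intro power_mono) auto
      then have "p\<^sup>2 * \<epsilon>\<^sup>2 * ((1 / 4)\<^sup>2 / (64 * 4 ^ CARD('n))) \<le> p\<^sup>2 * \<epsilon>\<^sup>2 * ((x \<bullet> x) / (64 * 4 ^ CARD('n)))"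
        by (intro mult_left_mono divide_right_mono) auto
      then have 1: "p\<^sup>2 * \<epsilon>\<^sup>2 * c \<le> p\<^sup>2 * \<epsilon>\<^sup>2 * (x \<bullet> x) / (64 * 4 ^ CARD('n))"
        by (simp add: c_def power2_eq_square)
      have "\<phi> x * (1 - p * \<epsilon>\<^sup>2 + p\<^sup>2 * \<epsilon>\<^sup>2 * c)
          \<le> \<phi> x * (1 - p * \<epsilon>\<^sup>2 + p\<^sup>2 * \<epsilon>\<^sup>2 * (x \<bullet> x) / (64 * 4 ^ CARD('n)))"
        using 1 by (intro mult_left_mono) (auto simp: \<phi>_def)
      also have "\<dots> \<le> avg (\<lambda>h. \<phi> (x + \<epsilon> *\<^sub>R h))"
        unfolding \<phi>_def using p2 pe by (intro gaussian_avg_lower) auto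
      finally have "A * (\<phi> x * (1 - p * \<epsilon>\<^sup>2 + p\<^sup>2 * \<epsilon>\<^sup>2 * c)) \<le> A * avg (\<lambda>h. \<phi> (x + \<epsilon> *\<^sub>R h))"
        using A by (intro mult_left_mono) auto
      then show ?thesis
        unfolding avg_\<psi> by (simp add: \<psi>_def G_def algebra_simps)
    qed
    ultimately have "(1 - \<beta>) * (m + \<psi> x - G * (p * \<Lambda>\<^sup>2)) + \<beta> * (m + (\<psi> x + G * (p\<^sup>2 * c - p))) - \<epsilon>\<^sup>2 * 1 \<le> u x"
      using mult_left_mono[OF add_mono[OF avg_w avg_\<psi>_lower], of \<beta>] beta by linarith
    then have "m + G * (\<beta> * p\<^sup>2 * c - \<beta> * p - (1 - \<beta>) * p * \<Lambda>\<^sup>2) - \<epsilon>\<^sup>2 \<le> w x"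
      by (simp add: w_def algebra_simps)
    moreover have "1 \<le> \<beta> * p\<^sup>2 * c - \<beta> * p - (1 - \<beta>) * p * \<Lambda>\<^sup>2"
    proof -
      have "\<beta> * p\<^sup>2 * c = p * (\<beta> * p * c)" by (simp add: power2_eq_square)
      then have "\<beta> * p\<^sup>2 * c - \<beta> * p - (1 - \<beta>) * p * \<Lambda>\<^sup>2 = p * (2 - \<beta> + \<beta> * \<Lambda>\<^sup>2)"
        unfolding pbc by (simp add: algebra_simps)
      moreover have "1 \<le> 2 - \<beta> + \<beta> * \<Lambda>\<^sup>2" using beta by (simp add: add_increasing2)
      ultimately show ?thesis using p2 mult_mono[of 1 p 1 "2 - \<beta> + \<beta> * \<Lambda>\<^sup>2"] by simp
    qed
    then have "G \<le> G * (\<beta> * p\<^sup>2 * c - \<beta> * p - (1 - \<beta>) * p * \<Lambda>\<^sup>2)"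
      using mult_left_mono[of 1 "\<beta> * p\<^sup>2 * c - \<beta> * p - (1 - \<beta>) * p * \<Lambda>\<^sup>2" G]
        order_trans[OF _ G, of 0] by simp
    ultimately show False using x(2) G by linarith
  qed
  moreover have "\<epsilon>\<^sub>1 > 0" using p2 Lambda by (simp add: \<epsilon>\<^sub>1_def)
  ultimately show ?thesis using A(1) by blast
qed

end

subsection \<open>Dyadic cells\<close>

text \<open>Floors give half-open cells. They partition space exactly, without null sets to discard,
  and passing to the parent cell is integer division of the index by 2.\<close>

definition cell :: "real \<Rightarrow> ('n::finite \<Rightarrow> int) \<Rightarrow> (real ^ 'n) set" where
  "cell s k = {x. \<forall>i. \<lfloor>x $ i / s\<rfloor> = k i}"

definition cell_center :: "real \<Rightarrow> ('n::finite \<Rightarrow> int) \<Rightarrow> real ^ 'n" where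
  "cell_center s k = (\<chi> i. s * (of_int (k i) + 1 / 2))"

definition children :: "('n::finite \<Rightarrow> int) \<Rightarrow> ('n \<Rightarrow> int) set" where
  "children k = {k'. \<forall>i. k' i div 2 = k i}"

lemma mem_cell_iff:
  assumes "s > 0"
  shows "x \<in> cell s k \<longleftrightarrow> (\<forall>i. s * of_int (k i) \<le> x $ i \<and> x $ i < s * (of_int (k i) + 1))"
  using assms by (auto simp: cell_def floor_eq_iff field_simps)

lemma cell_disjoint: "k \<noteq> k' \<Longrightarrow> cell s k \<inter> cell s k' = {}"
  by (auto simp: cell_def fun_eq_iff)

lemma mem_cell_floor: "x \<in> cell s (\<lambda>i. \<lfloor>x $ i / s\<rfloor>)"
  by (simp add: cell_def)

lemma sets_cell [measurable]: "cell s k \<in> sets borel"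
proof -
  have "cell s k = (\<Inter>i. (\<lambda>x. \<lfloor>x $ i / s\<rfloor>) -` {k i} \<inter> space borel)"
    by (auto simp: cell_def)
  also have "\<dots> \<in> sets borel"
    by (intro sets.finite_INT measurable_sets[where A = "count_space UNIV"]) auto
  finally show ?thesis .
qed

lemma measure_cell:
  assumes "s > 0"
  shows "emeasure lborel (cell s (k :: 'n::finite \<Rightarrow> int)) < \<infinity>"
    "measure lborel (cell s k) = s ^ CARD('n)"
proof -
  define a b :: "real ^ 'n" where "a = (\<chi> i. s * of_int (k i))" and "b = (\<chi> i. s * (of_int (k i) + 1))"
  have ab: "box a b \<subseteq> cell s k" "cell s k \<subseteq> cbox a b"
    using assms by (auto simp: mem_cell_iff a_def b_def mem_box_cart less_imp_le)
  have ne: "cbox a b \<noteq> {}"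
    using assms by (auto simp: a_def b_def interval_ne_empty_cart)
  have cb: "measure lborel (cbox a b) = s ^ CARD('n)"
    unfolding content_cbox_cart[OF ne] by (simp add: a_def b_def algebra_simps)
  have bx: "measure lborel (box a b) = measure lborel (cbox a b)"
    using ne by (simp add: measure_lborel_box_eq measure_lborel_cbox_eq box_ne_empty)
  show fin: "emeasure lborel (cell s k) < \<infinity>"
    using emeasure_mono[OF ab(2), of lborel] emeasure_lborel_cbox_finite[of a b] by auto
  have "measure lborel (box a b) \<le> measure lborel (cell s k)"
    using ab fin by (intro measure_mono_fmeasurable fmeasurableI) auto
  moreover have "measure lborel (cell s k) \<le> measure lborel (cbox a b)"
    using ab by (intro measure_mono_fmeasurable) auto
  ultimately show "measure lborel (cell s k) = s ^ CARD('n)"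
    using cb bx by linarith
qed

lemma norm_le_of_components:
  fixes x :: "real ^ 'n" and r :: real
  assumes "\<And>i. \<bar>x $ i\<bar> \<le> r"
  shows "norm x \<le> CARD('n) * r"
proof -
  have "norm x \<le> (\<Sum>i\<in>UNIV. \<bar>x $ i\<bar>)" by (rule norm_le_l1_cart)
  also have "\<dots> \<le> (\<Sum>i\<in>(UNIV :: 'n set). r)" by (intro sum_mono assms)
  finally show ?thesis by simp
qed

lemma cell_diameter:
  fixes x y :: "real ^ 'n" and s :: real
  assumes "s > 0" "x \<in> cell s k" "y \<in> cell s k"
  shows "norm (x - y) \<le> CARD('n) * s"
proof (rule norm_le_of_components)
  fix i
  have "s * k i \<le> x $ i" "x $ i < s * k i + s" "s * k i \<le> y $ i" "y $ i < s * k i + s"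
    using assms by (auto simp: mem_cell_iff distrib_left)
  then show "\<bar>(x - y) $ i\<bar> \<le> s" by auto
qed

lemma cell_center_mem: "s > 0 \<Longrightarrow> cell_center s k \<in> cell s k"
  by (simp add: mem_cell_iff cell_center_def)

lemma ball_subset_cell:
  fixes k :: "'n::finite \<Rightarrow> int"
  assumes "s > 0"
  shows "ball (cell_center s k) (s / 2) \<subseteq> cell s k"
proof
  fix x assume x: "x \<in> ball (cell_center s k) (s / 2)"
  have "s * k i \<le> x $ i \<and> x $ i < s * (k i + 1)" for i
  proof -
    have "\<bar>(cell_center s k - x) $ i\<bar> < s / 2"
      using x component_le_norm_cart[of "cell_center s k - x" i] by (simp add: dist_norm)
    moreover have "(cell_center s k) $ i = s * k i + s / 2"
      by (simp add: cell_center_def algebra_simps)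
    ultimately have "\<bar>s * k i + s / 2 - x $ i\<bar> < s / 2" by simp
    then have "s * k i \<le> x $ i" "x $ i < s * k i + s"
      unfolding abs_less_iff by linarith+
    then show ?thesis by (simp add: distrib_left)
  qed
  then show "x \<in> cell s k" using assms by (simp add: mem_cell_iff)
qed

lemma finite_int_funs: "(\<And>i. finite (A i)) \<Longrightarrow> finite {k :: 'n::finite \<Rightarrow> int. \<forall>i. k i \<in> A i}"
proof -
  assume "\<And>i. finite (A i)"
  then have "finite (PiE UNIV A)" by (intro finite_PiE) auto
  moreover have "PiE UNIV A = {k. \<forall>i. k i \<in> A i}" by (auto simp: PiE_def)
  ultimately show ?thesis by simp
qed

lemma finite_cells_bounded:
  assumes "s > 0" and B: "\<And>y. y \<in> S \<Longrightarrow> norm (X y :: real ^ 'n) \<le> B"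
  shows "finite ((\<lambda>y i. \<lfloor>X y $ i / s\<rfloor>) ` S)"
proof (rule finite_subset)
  show "(\<lambda>y i. \<lfloor>X y $ i / s\<rfloor>) ` S \<subseteq> {k. \<forall>i. k i \<in> {\<lfloor>- B / s\<rfloor>..\<lfloor>B / s\<rfloor>}}"
  proof clarify
    fix y i assume "y \<in> S"
    then have "\<bar>X y $ i\<bar> \<le> B" using B component_le_norm_cart order_trans by blast
    then have "- B / s \<le> X y $ i / s" "X y $ i / s \<le> B / s"
      using assms(1) by (auto intro!: divide_right_mono simp del: divide_minus_left)
    then show "\<lfloor>X y $ i / s\<rfloor> \<in> {\<lfloor>- B / s\<rfloor>..\<lfloor>B / s\<rfloor>}"
      by (simp add: floor_mono del: divide_minus_left)
  qed
qed (rule finite_int_funs, simp)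

lemma finite_children: "finite (children k)"
proof (rule finite_subset)
  show "children k \<subseteq> {k'. \<forall>i. k' i \<in> {2 * k i..2 * k i + 1}}"
  proof clarify
    fix k' i assume "k' \<in> children k"
    then have "k' i div 2 = k i" by (simp add: children_def)
    then show "k' i \<in> {2 * k i..2 * k i + 1}" by auto
  qed
qed (rule finite_int_funs, simp)

lemma cell_double_eq:
  assumes "s > 0"
  shows "cell (2 * s) (k :: 'n::finite \<Rightarrow> int) = (\<Union>k'\<in>children k. cell s k')"
proof -
  have "\<lfloor>x $ i / (2 * s)\<rfloor> = \<lfloor>x $ i / s\<rfloor> div 2" for x :: "real ^ 'n" and i
    using floor_divide_real_eq_div[of 2 "x $ i / s"] by (simp add: mult.commute)
  then have "x \<in> cell (2 * s) k \<longleftrightarrow> (\<lambda>i. \<lfloor>x $ i / s\<rfloor>) \<in> children k" for x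
    by (simp add: cell_def children_def)
  moreover have "x \<in> cell s k' \<longleftrightarrow> k' = (\<lambda>i. \<lfloor>x $ i / s\<rfloor>)" for x k'
    by (auto simp: cell_def fun_eq_iff)
  ultimately show ?thesis by auto
qed

lemma measure_Int_cell_double:
  assumes "s > 0" and [measurable]: "E \<in> sets borel"
  shows "measure lborel (E \<inter> cell (2 * s) (k :: 'n::finite \<Rightarrow> int))
       = (\<Sum>k'\<in>children k. measure lborel (E \<inter> cell s k'))"
proof -
  have eq: "E \<inter> cell (2 * s) k = (\<Union>k'\<in>children k. E \<inter> cell s k')"
    using cell_double_eq[OF assms(1)] by auto
  have fin: "emeasure lborel (E \<inter> cell s k') \<noteq> \<infinity>" for k' :: "'n \<Rightarrow> int"
  proof -
    have "emeasure lborel (E \<inter> cell s k') \<le> emeasure lborel (cell s k')"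
      by (intro emeasure_mono) auto
    then show ?thesis using measure_cell(1)[OF assms(1), of k'] by auto
  qed
  have disj: "disjoint_family_on (\<lambda>k'. E \<inter> cell s k') (children k)"
    unfolding disjoint_family_on_def using cell_disjoint[of _ _ s] by blast
  show ?thesis
    unfolding eq by (rule measure_finite_Union[OF finite_children _ disj fin]) auto
qed

subsection \<open>Sliding paraboloids\<close>

text \<open>The centre is displaced by \<open>r / 2\<close> along \<open>d\<close>. The radius
  \<open>r / 4\<close> and the offset \<open>r / 8\<close> of \<open>x'\<close> leave a progress of
  \<open>r / 8\<close> in that direction.\<close>

lemma direction_ball:
  fixes x d :: "real ^ 'n"
  assumes "d \<noteq> 0" "r > 0" "norm (x - x') \<le> r / 8"
  shows "ball (x + (r / (2 * norm d)) *\<^sub>R d) (r / 4) \<subseteq> ball x r"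
    and "z \<in> ball (x + (r / (2 * norm d)) *\<^sub>R d) (r / 4) \<Longrightarrow> norm d * (r / 8) \<le> (z - x') \<bullet> d"
proof -
  define e where "e = (r / (2 * norm d)) *\<^sub>R d"
  have ne: "norm e = r / 2" and ed: "e \<bullet> d = norm d * (r / 2)"
    using assms by (auto simp: e_def dot_square_norm power2_eq_square)
  show "ball (x + (r / (2 * norm d)) *\<^sub>R d) (r / 4) \<subseteq> ball x r"
    unfolding e_def[symmetric]
  proof
    fix z assume "z \<in> ball (x + e) (r / 4)"
    then have "norm (x + e - z) < r / 4" by (simp add: dist_norm)
    then show "z \<in> ball x r"
      using norm_triangle_ineq4[of "x + e - z" e] ne assms(2) by (simp add: dist_norm)
  qed
  show "norm d * (r / 8) \<le> (z - x') \<bullet> d" if "z \<in> ball (x + (r / (2 * norm d)) *\<^sub>R d) (r / 4)"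
  proof -
    have "norm (x + e - z) < r / 4" using that by (simp add: dist_norm e_def)
    then have "norm ((x + e - z) - (x - x')) \<le> 3 * r / 8"
      using norm_triangle_ineq4[of "x + e - z" "x - x'"] assms(3) by linarith
    then have "norm ((x + e - z) - (x - x')) * norm d \<le> 3 * r / 8 * norm d"
      by (rule mult_right_mono) auto
    then have "((x + e - z) - (x - x')) \<bullet> d \<le> 3 * r / 8 * norm d"
      using norm_cauchy_schwarz[of "(x + e - z) - (x - x')" d] by linarith
    then show ?thesis
      using ed by (simp add: inner_diff_left inner_add_left algebra_simps)
  qed
qed

text \<open>Two paraboloids of the same opening differ by an affine function whose slope is
  \<open>a\<close> times the difference of the vertices. Near contact at \<open>x'\<close>, together
  with a point \<open>z\<close> of almost contact about \<epsilon> away along the slope, bounds its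
  increment by \<open>(T + 1) * \<epsilon>\<^sup>2\<close>; hence the slope is of order \<epsilon>.
  This replaces a Lipschitz bound for the map from contact points to vertices.\<close>

lemma touching_vertices_close:
  fixes u :: "real ^ 'n \<Rightarrow> real"
  assumes "a > 0" "\<epsilon> > 0" "norm (x - x') \<le> \<epsilon> / 8"
    and below': "\<And>z. z \<in> ball x \<epsilon> \<Longrightarrow> m' \<le> u z + a / 2 * (norm (z - y'))\<^sup>2"
    and touch': "u x' + a / 2 * (norm (x' - y'))\<^sup>2 \<le> m' + \<epsilon>\<^sup>2"
    and below: "m \<le> u x' + a / 2 * (norm (x' - y))\<^sup>2"
    and most: "y \<noteq> y' \<Longrightarrow> \<exists>z\<in>ball (x + (\<epsilon> / (2 * norm (y' - y))) *\<^sub>R (y' - y)) (\<epsilon> / 4).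
        u z + a / 2 * (norm (z - y))\<^sup>2 \<le> m + T * \<epsilon>\<^sup>2"
    and "T \<ge> 0"
  shows "norm (y - y') \<le> 8 * (T + 1) / a * \<epsilon>"
proof (cases "y = y'")
  case True
  then show ?thesis using assms by simp
next
  case False
  obtain z where z: "z \<in> ball (x + (\<epsilon> / (2 * norm (y' - y))) *\<^sub>R (y' - y)) (\<epsilon> / 4)"
    "u z + a / 2 * (norm (z - y))\<^sup>2 \<le> m + T * \<epsilon>\<^sup>2"
    using most[OF False] by blast
  have d: "y' - y \<noteq> 0" using False by simp
  have "z \<in> ball x \<epsilon>" using direction_ball(1)[OF d assms(2,3)] z(1) by blast
  have "a * (norm (y' - y) * (\<epsilon> / 8)) \<le> a * ((z - x') \<bullet> (y' - y))"
    using direction_ball(2)[OF d assms(2,3) z(1)] assms(1) by (intro mult_left_mono) auto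
  \<comment> \<open>The quadratic parts cancel in this combination of four values, leaving the
    affine difference evaluated between \<open>x'\<close> and \<open>z\<close>.\<close>
  also have "\<dots> = a / 2 * ((norm (z - y))\<^sup>2 - (norm (z - y'))\<^sup>2 - (norm (x' - y))\<^sup>2 + (norm (x' - y'))\<^sup>2)"
    by (simp add: power2_norm_eq_inner inner_diff_left inner_diff_right inner_commute algebra_simps)
  also have "\<dots> \<le> T * \<epsilon>\<^sup>2 + \<epsilon>\<^sup>2"
    using z(2) below'[OF \<open>z \<in> ball x \<epsilon>\<close>] touch' below by (simp add: algebra_simps)
  finally have "\<epsilon> * (a * norm (y' - y)) \<le> \<epsilon> * (8 * (T + 1) * \<epsilon>)"
    by (simp add: power2_eq_square algebra_simps)
  then have "a * norm (y' - y) \<le> 8 * (T + 1) * \<epsilon>" using \<open>\<epsilon> > 0\<close> by simp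
  then show ?thesis using \<open>a > 0\<close> by (simp add: field_simps norm_minus_commute)
qed

section \<open>Contact of supersolutions with paraboloids\<close>

context dpp begin

text \<open>At a near contact point, the excess of \<open>u\<close> over the paraboloid is
  nonnegative and weighted by \<beta>, so it can only compensate the slack, the source and the drop
  of the paraboloid: \<open>1 + 1 + a * \<Lambda>\<^sup>2 / 2\<close> units of
  \<open>\<epsilon>\<^sup>2\<close>.\<close>

lemma supersol_touching_avg:
  fixes u :: "real ^ 'n \<Rightarrow> real"
  assumes u: "supersol \<epsilon> 1 S u" and x: "x \<in> S" and "\<epsilon> > 0" "a > 0"
    and below: "\<And>z. z \<in> ball x (\<Lambda> * \<epsilon>) \<Longrightarrow> m \<le> u z + a / 2 * (norm (z - y))\<^sup>2"
    and touch: "u x + a / 2 * (norm (x - y))\<^sup>2 \<le> m + \<epsilon>\<^sup>2"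
  shows "avg (\<lambda>h. u (x + \<epsilon> *\<^sub>R h) + a / 2 * (norm (x + \<epsilon> *\<^sub>R h - y))\<^sup>2 - m)
       \<le> (2 + a * \<Lambda>\<^sup>2 / 2) / \<beta> * \<epsilon>\<^sup>2"
proof -
  define \<psi> where "\<psi> z = - (a / 2) * (norm (z - y))\<^sup>2" for z
  define \<kappa> where "\<kappa> = a / 2 * \<epsilon>\<^sup>2 * \<Lambda>\<^sup>2"
  have lb_\<psi>: "loc_bdd_measurable \<psi>"
    unfolding \<psi>_def by (intro loc_bdd_measurable_continuous continuous_intros)
  have sym: "(\<psi> (x + \<epsilon> *\<^sub>R h) + \<psi> (x - \<epsilon> *\<^sub>R h)) / 2 = \<psi> x - a / 2 * \<epsilon>\<^sup>2 * (norm h)\<^sup>2" for h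
  proof -
    have par: "(norm (v + k))\<^sup>2 + (norm (v - k))\<^sup>2 = 2 * (norm v)\<^sup>2 + 2 * (norm k)\<^sup>2" for v k :: "real ^ 'n"
      by (simp add: power2_norm_eq_inner inner_diff_left inner_diff_right inner_add_left inner_add_right inner_commute)
    have "(\<psi> (x + \<epsilon> *\<^sub>R h) + \<psi> (x - \<epsilon> *\<^sub>R h)) / 2
        = - (a / 4) * ((norm ((x - y) + \<epsilon> *\<^sub>R h))\<^sup>2 + (norm ((x - y) - \<epsilon> *\<^sub>R h))\<^sup>2)"
    proof -
      have "x + \<epsilon> *\<^sub>R h - y = (x - y) + \<epsilon> *\<^sub>R h" "x - \<epsilon> *\<^sub>R h - y = (x - y) - \<epsilon> *\<^sub>R h"
        by simp_all
      then show ?thesis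
        unfolding \<psi>_def by (simp only:) (simp add: field_simps)
    qed
    then show ?thesis
      unfolding par by (simp add: \<psi>_def power_mult_distrib algebra_simps)
  qed
  have \<kappa>: "\<psi> x - \<kappa> \<le> (\<psi> (x + \<epsilon> *\<^sub>R h) + \<psi> (x - \<epsilon> *\<^sub>R h)) / 2" if "norm h < \<Lambda>" for h
  proof -
    have "a / 2 * \<epsilon>\<^sup>2 * (norm h)\<^sup>2 \<le> \<kappa>"
      unfolding \<kappa>_def using that \<open>a > 0\<close> by (intro mult_left_mono power_mono) auto
    then show ?thesis unfolding sym by simp
  qed
  have m: "m \<le> u (x + \<epsilon> *\<^sub>R h) - \<psi> (x + \<epsilon> *\<^sub>R h)" if "norm h < \<Lambda>" for h
    using below[of "x + \<epsilon> *\<^sub>R h"] that \<open>\<epsilon> > 0\<close> by (simp add: \<psi>_def dist_norm)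
  have avg_\<psi>: "\<psi> x - \<kappa> \<le> avg (\<lambda>h. \<psi> (x + \<epsilon> *\<^sub>R h))"
  proof -
    have c: "continuous_on UNIV \<psi>" unfolding \<psi>_def by (intro continuous_intros)
    have "avg (\<lambda>h :: real ^ 'n. \<psi> x - \<kappa>) \<le> avg (\<lambda>h. (\<psi> (x + \<epsilon> *\<^sub>R h) + \<psi> (x - \<epsilon> *\<^sub>R h)) / 2)"
      using \<kappa> Lambda
      by (intro avg_mono loc_bdd_measurable_continuous continuous_intros continuous_on_compose2[OF c]) auto
    then show ?thesis by (simp add: avg_const avg_symmetrize[OF lb_\<psi>])
  qed
  have test: "(1 - \<beta>) * (m + \<psi> x - \<kappa>)
      + \<beta> * (avg (\<lambda>h. u (x + \<epsilon> *\<^sub>R h) - \<psi> (x + \<epsilon> *\<^sub>R h)) + avg (\<lambda>h. \<psi> (x + \<epsilon> *\<^sub>R h))) - \<epsilon>\<^sup>2 * 1 \<le> u x"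
    by (rule supersol_test[OF u x lb_\<psi> m \<kappa>])
  have avg_eq: "avg (\<lambda>h. u (x + \<epsilon> *\<^sub>R h) - \<psi> (x + \<epsilon> *\<^sub>R h))
      = avg (\<lambda>h. u (x + \<epsilon> *\<^sub>R h) + a / 2 * (norm (x + \<epsilon> *\<^sub>R h - y))\<^sup>2 - m) + m"
  proof -
    have "loc_bdd_measurable (\<lambda>z. u z - \<psi> z - m)"
      by (intro loc_bdd_measurable_diff loc_bdd_measurable_const lb_\<psi> supersol_loc_bdd[OF u])
    from avg_add[OF loc_bdd_measurable_affine[OF this, of x \<epsilon>] loc_bdd_measurable_const[of m]]
    show ?thesis by (simp add: avg_const \<psi>_def)
  qed
  have "\<beta> * (\<psi> x - \<kappa>) \<le> \<beta> * avg (\<lambda>h. \<psi> (x + \<epsilon> *\<^sub>R h))"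
    using avg_\<psi> beta by (intro mult_left_mono) auto
  then have "(1 - \<beta>) * (m + \<psi> x - \<kappa>)
      + \<beta> * (avg (\<lambda>h. u (x + \<epsilon> *\<^sub>R h) + a / 2 * (norm (x + \<epsilon> *\<^sub>R h - y))\<^sup>2 - m) + m + (\<psi> x - \<kappa>)) - \<epsilon>\<^sup>2 \<le> u x"
    (is "_ + \<beta> * (?A + m + _) - _ \<le> _")
    using test unfolding avg_eq distrib_left by linarith
  then have "\<beta> * ?A \<le> u x - \<psi> x - m + \<kappa> + \<epsilon>\<^sup>2"
    by (simp add: algebra_simps)
  also have "u x - \<psi> x - m + \<kappa> + \<epsilon>\<^sup>2 \<le> (2 + a * \<Lambda>\<^sup>2 / 2) * \<epsilon>\<^sup>2"
    using touch by (simp add: \<psi>_def \<kappa>_def algebra_simps)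
  finally show ?thesis using beta by (simp add: field_simps)
qed

text \<open>Contact points in one cell of side comparable to \<epsilon> belong to vertices in a ball
  of radius of order \<epsilon>, so vertices filling a fixed ball force a number of cells of order
  \<open>1 / \<epsilon> ^ CARD('n)\<close>. In each of them \<open>u\<close> is bounded on at least
  half of the volume, and the powers of \<epsilon> cancel.\<close>

lemma supersol_paraboloid_measure:
  fixes M\<^sub>1 :: real
  assumes "M\<^sub>1 > 0"
  shows "\<exists>M>0. \<exists>\<mu>>0. \<exists>\<epsilon>\<^sub>1>0. \<forall>\<epsilon> (u :: real ^ 'n \<Rightarrow> real). 0 < \<epsilon> \<longrightarrow> \<epsilon> < \<epsilon>\<^sub>1 \<longrightarrow>
    supersol \<epsilon> 1 (ball 0 1) u \<longrightarrow> (\<forall>y\<in>ball 0 2. 0 \<le> u y) \<longrightarrow> (\<exists>x\<^sub>1\<in>ball 0 (1 / 4). u x\<^sub>1 \<le> M\<^sub>1) \<longrightarrow>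
    \<mu> \<le> measure lborel ({y. u y \<le> M} \<inter> ball 0 1)"
proof -
  define N where "N = real CARD('n)"
  define V where "V = measure lborel (ball (0 :: real ^ 'n) 1)"
  \<comment> \<open>The opening satisfies \<open>M\<^sub>1 + a / 8 + 1 = 5 * a / 32\<close>, so a
    near contact point lies within distance 3/5 of its vertex.\<close>
  define a where "a = 32 * (M\<^sub>1 + 1)"
  define H where "H = (2 + a * \<Lambda>\<^sup>2 / 2) / \<beta>"
  \<comment> \<open>The Chebyshev factor. Exceeding \<open>4 ^ CARD('n)\<close> produces an almost
    contact point in every quarter ball; the last summand limits the bad part of a cell to half its
    volume.\<close>
  define l where "l = 4 ^ CARD('n) + 1 + 2 * V * (8 * N) ^ CARD('n)"
  define T where "T = l * H"
  define C where "C = 8 * (T + 1) / a"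
  define M where "M = M\<^sub>1 + a / 8 + T"
  \<comment> \<open>The product of the number of cells, at least
    \<open>(1 / (8 * C * \<epsilon>)) ^ CARD('n)\<close>, and half the volume
    \<open>(\<epsilon> / (8 * N)) ^ CARD('n)\<close> of one cell.\<close>
  define \<mu> where "\<mu> = (1 / (64 * C * N)) ^ CARD('n) / 2"
  define \<epsilon>\<^sub>1 where "\<epsilon>\<^sub>1 = 1 / (8 * \<Lambda>)"
  have N: "N \<ge> 1" by (simp add: N_def Suc_le_eq)
  have V: "V > 0" unfolding V_def by (rule unit_ball_measure_pos)
  have a: "a > 32" using assms by (simp add: a_def)
  have H: "H > 0" using a beta by (auto simp: H_def intro!: divide_pos_pos add_pos_nonneg)
  have l: "4 ^ CARD('n) < l" "2 * V * (8 * N) ^ CARD('n) \<le> l" "l > 0"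
    using V N by (auto simp: l_def intro!: add_pos_nonneg add_nonneg_pos mult_nonneg_nonneg)
  have T: "T > 0" using l H by (simp add: T_def)
  have C: "C > 0" using T a by (simp add: C_def)
  have M: "M > 0" using assms a T by (simp add: M_def)
  have \<mu>: "\<mu> > 0" using C N by (simp add: \<mu>_def)
  have e1: "\<epsilon>\<^sub>1 > 0" using Lambda by (simp add: \<epsilon>\<^sub>1_def)
  have "\<mu> \<le> measure lborel ({y. u y \<le> M} \<inter> ball 0 1)"
    if \<epsilon>: "0 < \<epsilon>" "\<epsilon> < \<epsilon>\<^sub>1" and u: "supersol \<epsilon> 1 (ball 0 1) u" and nonneg: "\<forall>y\<in>ball 0 2. 0 \<le> u y"
      and x1: "x\<^sub>1 \<in> ball 0 (1 / 4)" "u x\<^sub>1 \<le> M\<^sub>1" for \<epsilon> and u :: "real ^ 'n \<Rightarrow> real" and x\<^sub>1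
  proof -
    have [measurable]: "u \<in> borel_measurable borel" using u by (simp add: supersol_def)
    have \<Lambda>e: "\<Lambda> * \<epsilon> < 1 / 8" using \<epsilon> Lambda by (simp add: \<epsilon>\<^sub>1_def field_simps)
    have "1 * \<epsilon> \<le> \<Lambda> * \<epsilon>" using Lambda \<epsilon> by (intro mult_right_mono) auto
    then have e8: "\<epsilon> < 1 / 8" using \<Lambda>e by linarith
    have "\<epsilon> * \<epsilon> \<le> 1 * 1" using e8 \<epsilon> by (intro mult_mono) auto
    then have esq: "\<epsilon>\<^sup>2 \<le> 1" "\<epsilon>\<^sup>2 > 0" using \<epsilon> by (auto simp: power2_eq_square)
    \<comment> \<open>A cell of this side has diameter at most \<open>\<epsilon> / 8\<close>, the
      distance allowed in \<open>touching_vertices_close\<close>.\<close>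
    define s where "s = \<epsilon> / (8 * N)"
    have s: "s > 0" "N * s = \<epsilon> / 8" using \<epsilon> N by (auto simp: s_def)
    define w where "w y z = u z + a / 2 * (norm (z - y))\<^sup>2" for y z
    define m where "m y = (INF z\<in>ball 0 2. w y z)" for y
    have bdd: "bdd_below (w y ` ball 0 2)" for y
      using nonneg a by (intro bdd_belowI2[of _ 0]) (auto simp: w_def)
    have m_le: "m y \<le> w y z" if "norm z < 2" for y z
      using that bdd by (auto simp: m_def intro!: cINF_lower)
    have m_up: "m y \<le> M\<^sub>1 + a / 8" if "norm y < 1 / 4" for y
    proof -
      have "norm (x\<^sub>1 - y) \<le> 1 / 2"
        using norm_triangle_ineq4[of x\<^sub>1 y] x1 that by simp
      then have "(norm (x\<^sub>1 - y))\<^sup>2 \<le> (1 / 2)\<^sup>2" by (intro power_mono) auto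
      then have "a / 2 * (norm (x\<^sub>1 - y))\<^sup>2 \<le> a / 2 * (1 / 2)\<^sup>2" using a by (intro mult_left_mono) auto
      then have "w y x\<^sub>1 \<le> M\<^sub>1 + a / 8" using x1(2) by (simp add: w_def power2_eq_square)
      then show ?thesis using m_le[of x\<^sub>1 y] x1 by simp
    qed
    have "\<exists>z. norm z < 2 \<and> w y z \<le> m y + \<epsilon>\<^sup>2" for y
    proof -
      have "\<exists>z\<in>ball 0 2. w y z < m y + \<epsilon>\<^sup>2"
        unfolding m_def using esq bdd by (subst cINF_less_iff[symmetric]) auto
      then show ?thesis by (auto intro: less_imp_le)
    qed
    then obtain X where X: "\<And>y. norm (X y) < 2" "\<And>y. w y (X y) \<le> m y + \<epsilon>\<^sup>2" by metis
    \<comment> \<open>The margin 1/8 to the unit sphere leaves room for the \<epsilon>-ball of a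
      contact point, and keeps the range of the bracket inside the ball of radius 2.\<close>
    have X78: "norm (X y) < 7 / 8" if "norm y < 1 / 4" for y
    proof -
      have "0 \<le> u (X y)" using nonneg X(1) by auto
      then have "a / 2 * (norm (X y - y))\<^sup>2 \<le> M\<^sub>1 + a / 8 + 1"
        using X(2)[of y] m_up[OF that] esq by (simp add: w_def)
      then have "a * (norm (X y - y))\<^sup>2 \<le> a * (5 / 16)"
        using a by (simp add: a_def field_simps)
      then have "(norm (X y - y))\<^sup>2 \<le> 5 / 16" using a by simp
      also have "\<dots> < (3 / 5)\<^sup>2" by (simp add: power2_eq_square)
      finally have "norm (X y - y) < 3 / 5" by (rule power_less_imp_less_base) simp
      then show ?thesis using norm_triangle_ineq2[of "X y" y] that by linarith
    qed
    have ball_2: "norm z < 2" if "norm y < 1 / 4" "z \<in> ball (X y) (\<Lambda> * \<epsilon>)" for y z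
      using norm_triangle_ineq2[of z "X y"] that X78[of y] \<Lambda>e by (simp add: dist_norm norm_minus_commute)
    have eps_ball: "ball x \<epsilon> \<subseteq> ball x (\<Lambda> * \<epsilon>)" for x :: "real ^ 'n"
      using \<open>1 * \<epsilon> \<le> \<Lambda> * \<epsilon>\<close> by (intro subset_ball) simp
    have avg_le: "avg (\<lambda>h. w y (X y + \<epsilon> *\<^sub>R h) - m y) \<le> H * \<epsilon>\<^sup>2" if "norm y < 1 / 4" for y
      unfolding w_def H_def
    proof (rule supersol_touching_avg[OF u _ \<epsilon>(1)])
      show "m y \<le> u z + a / 2 * (norm (z - y))\<^sup>2" if "z \<in> ball (X y) (\<Lambda> * \<epsilon>)" for z
        using m_le[OF ball_2[OF \<open>norm y < 1 / 4\<close> that], of y] by (simp add: w_def)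
    qed (use X78[OF that] X(2)[of y] a in \<open>auto simp: w_def\<close>)
    have lb_w: "loc_bdd_measurable (\<lambda>z. w y z - m y)" for y
      unfolding w_def
      by (intro loc_bdd_measurable_diff loc_bdd_measurable_add loc_bdd_measurable_const supersol_loc_bdd[OF u])
         (intro loc_bdd_measurable_continuous continuous_intros)
    have w_nonneg: "0 \<le> w y z - m y" if "norm y < 1 / 4" "z \<in> ball (X y) \<epsilon>" for y z
    proof -
      have "z \<in> ball (X y) (\<Lambda> * \<epsilon>)" using eps_ball that(2) by blast
      then show ?thesis using m_le[OF ball_2[OF that(1)], of z y] by simp
    qed
    have good_point: "\<exists>z\<in>B. w y z \<le> m y + T * \<epsilon>\<^sup>2"
      if y: "norm y < 1 / 4" and B: "B = ball c (\<epsilon> / 4)" "B \<subseteq> ball (X y) \<epsilon>" for y B c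
    proof (rule ccontr)
      assume "\<not> ?thesis"
      then have "T * \<epsilon>\<^sup>2 / 4 ^ CARD('n) \<le> avg (\<lambda>h. w y (X y + \<epsilon> *\<^sub>R h) - m y)"
        using B w_nonneg[OF y] \<epsilon> by (intro avg_lower_ball[OF lb_w, where z = c]) force+
      then have "T * \<epsilon>\<^sup>2 / 4 ^ CARD('n) \<le> H * \<epsilon>\<^sup>2" using avg_le[OF y] by linarith
      then have "l * (H * \<epsilon>\<^sup>2) \<le> 4 ^ CARD('n) * (H * \<epsilon>\<^sup>2)" by (simp add: T_def field_simps)
      then show False using l H esq by (simp add: mult_less_cancel_right not_le[symmetric])
    qed
    have close: "norm (y - y') \<le> C * \<epsilon>"
      if y: "norm y < 1 / 4" "norm y' < 1 / 4" "norm (X y - X y') \<le> \<epsilon> / 8" for y y'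
      unfolding C_def
    proof (rule touching_vertices_close[where u = u and x = "X y" and x' = "X y'" and m = "m y" and m' = "m y'"])
      show "m y' \<le> u z + a / 2 * (norm (z - y'))\<^sup>2" if "z \<in> ball (X y) \<epsilon>" for z
        using m_le[OF ball_2[OF y(1) subsetD[OF eps_ball that]], of y'] by (simp add: w_def)
      show "m y \<le> u (X y') + a / 2 * (norm (X y' - y))\<^sup>2"
        using m_le[OF X(1), of y y'] by (simp add: w_def)
      show "\<exists>z\<in>ball (X y + (\<epsilon> / (2 * norm (y' - y))) *\<^sub>R (y' - y)) (\<epsilon> / 4).
          u z + a / 2 * (norm (z - y))\<^sup>2 \<le> m y + T * \<epsilon>\<^sup>2" if "y \<noteq> y'"
        using good_point[OF y(1) refl direction_ball(1)[OF _ \<epsilon>(1) y(3)]] that by (simp add: w_def)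
    qed (use a \<epsilon> y X(2) T in \<open>auto simp: w_def\<close>)
    define idx where "idx y = (\<lambda>i. \<lfloor>X y $ i / s\<rfloor>)" for y
    define I where "I = idx ` ball 0 (1 / 4)"
    have finI: "finite I"
      unfolding I_def idx_def using X(1) by (intro finite_cells_bounded[where B = 2] s) (auto intro: less_imp_le)
    define Y where "Y k = (SOME y. y \<in> ball 0 (1 / 4) \<and> idx y = k)" for k
    have Y: "norm (Y k) < 1 / 4" "idx (Y k) = k" if "k \<in> I" for k
    proof -
      have "\<exists>y. y \<in> ball 0 (1 / 4) \<and> idx y = k" using that by (auto simp: I_def)
      from someI_ex[OF this] show "norm (Y k) < 1 / 4" "idx (Y k) = k" by (auto simp: Y_def)
    qed
    have X_cell: "X y \<in> cell s (idx y)" for y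
      unfolding idx_def by (rule mem_cell_floor)
    have cover: "ball 0 (1 / 4) \<subseteq> (\<Union>k\<in>I. ball (Y k) (2 * C * \<epsilon>))"
    proof
      fix y :: "real ^ 'n" assume y: "y \<in> ball 0 (1 / 4)"
      define k where "k = idx y"
      have k: "k \<in> I" using y by (simp add: k_def I_def)
      have "norm (X (Y k) - X y) \<le> CARD('n) * s"
        using X_cell[of "Y k"] X_cell[of y] Y(2)[OF k] by (intro cell_diameter[OF s(1)]) (auto simp: k_def)
      then have "norm (Y k - y) \<le> C * \<epsilon>"
        using y Y(1)[OF k] s(2) by (intro close) (auto simp: N_def)
      also have "\<dots> < 2 * C * \<epsilon>" using C \<epsilon> by simp
      finally show "y \<in> (\<Union>k\<in>I. ball (Y k) (2 * C * \<epsilon>))" using k by (auto simp: dist_norm)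
    qed
    have card: "(1 / 4) ^ CARD('n) \<le> card I * (2 * C * \<epsilon>) ^ CARD('n)"
    proof -
      have "(1 / 4) ^ CARD('n) * V = measure lborel (ball (0 :: real ^ 'n) (1 / 4))"
        unfolding V_def by (subst measure_ball_scale) auto
      also have "\<dots> \<le> measure lborel (\<Union>k\<in>I. ball (Y k) (2 * C * \<epsilon>))"
        using cover finI emeasure_lborel_ball_finite
        by (intro measure_mono_fmeasurable fmeasurable.finite_UN) (auto intro!: fmeasurableI)
      also have "\<dots> \<le> (\<Sum>k\<in>I. measure lborel (ball (Y k) (2 * C * \<epsilon>)))"
        by (intro measure_UNION_le finI) auto
      also have "\<dots> = card I * ((2 * C * \<epsilon>) ^ CARD('n) * V)"
        using C \<epsilon> unfolding V_def by (subst measure_ball_scale) auto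
      finally show ?thesis using V by simp
    qed
    have half: "s ^ CARD('n) / 2 \<le> measure lborel ({y. u y \<le> M} \<inter> ball 0 1 \<inter> cell s k)" if k: "k \<in> I" for k
    proof -
      define y where "y = Y k"
      have y: "norm y < 1 / 4" using Y(1)[OF k] by (simp add: y_def)
      define D where "D = {z. T * \<epsilon>\<^sup>2 < w y z - m y} \<inter> cell s k"
      have D_sets [measurable]: "D \<in> sets borel"
        using loc_bdd_measurableD[OF lb_w] unfolding D_def by measurable
      have cell_ball: "cell s k \<subseteq> ball (X y) \<epsilon>"
      proof
        fix z assume "z \<in> cell s k"
        then have "norm (X y - z) \<le> CARD('n) * s"
          using X_cell[of y] Y(2)[OF k] by (intro cell_diameter[OF s(1)]) (auto simp: y_def)
        then show "z \<in> ball (X y) \<epsilon>" using s(2) \<epsilon> by (simp add: dist_norm N_def)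
      qed
      have "T * \<epsilon>\<^sup>2 * measure lborel D / (\<epsilon> ^ CARD('n) * V) \<le> avg (\<lambda>h. w y (X y + \<epsilon> *\<^sub>R h) - m y)"
        unfolding V_def using cell_ball w_nonneg[OF y] \<epsilon>
        by (intro avg_lower_bound[OF lb_w _ D_sets]) (auto simp: D_def)
      then have "T * \<epsilon>\<^sup>2 * measure lborel D / (\<epsilon> ^ CARD('n) * V) \<le> H * \<epsilon>\<^sup>2"
        using avg_le[OF y] by linarith
      then have "T * \<epsilon>\<^sup>2 * measure lborel D \<le> H * \<epsilon>\<^sup>2 * (\<epsilon> ^ CARD('n) * V)"
        using \<epsilon> V by (simp add: pos_divide_le_eq)
      then have "(H * \<epsilon>\<^sup>2) * (l * measure lborel D) \<le> (H * \<epsilon>\<^sup>2) * (\<epsilon> ^ CARD('n) * V)"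
        by (simp add: T_def mult_ac)
      then have lD: "l * measure lborel D \<le> \<epsilon> ^ CARD('n) * V"
        using H esq by (subst (asm) mult_le_cancel_left_pos) auto
      have "2 * V * (8 * N) ^ CARD('n) * measure lborel D \<le> \<epsilon> ^ CARD('n) * V"
        using mult_right_mono[OF l(2), of "measure lborel D"] lD by simp
      then have "V * ((8 * N) ^ CARD('n) * (2 * measure lborel D)) \<le> V * \<epsilon> ^ CARD('n)"
        by (simp add: mult_ac)
      then have "(8 * N) ^ CARD('n) * (2 * measure lborel D) \<le> \<epsilon> ^ CARD('n)"
        using V by simp
      then have D: "measure lborel D \<le> s ^ CARD('n) / 2"
        using N by (simp add: s_def power_divide field_simps)
      have sub: "cell s k - D \<subseteq> {y. u y \<le> M} \<inter> ball 0 1 \<inter> cell s k"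
      proof
        fix z assume z: "z \<in> cell s k - D"
        then have "w y z \<le> m y + T * \<epsilon>\<^sup>2" by (auto simp: D_def)
        also have "T * \<epsilon>\<^sup>2 \<le> T * 1" using T by (intro mult_left_mono esq) auto
        also have "m y + T * 1 \<le> M" using m_up[OF y] by (simp add: M_def)
        finally have "w y z \<le> M" by simp
        moreover have "0 \<le> a / 2 * (norm (z - y))\<^sup>2" using a by simp
        ultimately have "u z \<le> M" unfolding w_def by linarith
        moreover have "norm z < 1"
          using cell_ball z norm_triangle_ineq2[of z "X y"] X78[OF y] e8 by (auto simp: dist_norm norm_minus_commute)
        ultimately show "z \<in> {y. u y \<le> M} \<inter> ball 0 1 \<inter> cell s k" using z by auto
      qed
      have fm: "cell s k \<in> fmeasurable lborel" using measure_cell(1)[OF s(1)] by (intro fmeasurableI) auto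
      have "D \<subseteq> cell s k" by (simp add: D_def)
      then have "measure lborel (cell s k - D) = measure lborel (cell s k) - measure lborel D"
        using fm by (intro measure_Diff) (auto simp: fmeasurable_def)
      moreover have "measure lborel (cell s k - D) \<le> measure lborel ({y. u y \<le> M} \<inter> ball 0 1 \<inter> cell s k)"
        by (intro measure_mono_fmeasurable sub fmeasurableI2[OF fm]) auto
      ultimately show ?thesis using D measure_cell(2)[OF s(1), of k] by linarith
    qed
    have "\<mu> \<le> card I * (s ^ CARD('n) / 2)"
    proof -
      have "(64 * C * N) ^ CARD('n) * \<mu> = 1 / 2"
        using C N by (simp add: \<mu>_def power_divide)
      have "64 * C * N * s = 8 * C * \<epsilon>" using N by (simp add: s_def)
      then have "64 * C * N * s = 4 * (2 * C * \<epsilon>)" by simp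
      then have "(64 * C * N) ^ CARD('n) * s ^ CARD('n) = 4 ^ CARD('n) * (2 * C * \<epsilon>) ^ CARD('n)"
        by (metis power_mult_distrib)
      then have "card I / 2 * ((64 * C * N) ^ CARD('n) * s ^ CARD('n))
          = card I / 2 * (4 ^ CARD('n) * (2 * C * \<epsilon>) ^ CARD('n))"
        by (simp only:)
      then have "(64 * C * N) ^ CARD('n) * (card I * (s ^ CARD('n) / 2))
          = 4 ^ CARD('n) * (card I * (2 * C * \<epsilon>) ^ CARD('n)) / 2"
        by (simp only: mult_ac times_divide_eq_right times_divide_eq_left)
      also have "\<dots> \<ge> 4 ^ CARD('n) * (1 / 4) ^ CARD('n) / 2"
        using card by (intro divide_right_mono mult_left_mono) auto
      finally have "(64 * C * N) ^ CARD('n) * \<mu> \<le> (64 * C * N) ^ CARD('n) * (card I * (s ^ CARD('n) / 2))"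
        using \<open>(64 * C * N) ^ CARD('n) * \<mu> = 1 / 2\<close> by (simp add: power_divide)
      then show ?thesis using C N by (subst (asm) mult_le_cancel_left_pos) auto
    qed
    also have "\<dots> = (\<Sum>k\<in>I. s ^ CARD('n) / 2)" by simp
    also have "\<dots> \<le> (\<Sum>k\<in>I. measure lborel ({y. u y \<le> M} \<inter> ball 0 1 \<inter> cell s k))"
      by (intro sum_mono half)
    also have "\<dots> = measure lborel (\<Union>k\<in>I. {y. u y \<le> M} \<inter> ball 0 1 \<inter> cell s k)"
    proof (rule measure_finite_Union[OF finI, symmetric])
      show "disjoint_family_on (\<lambda>k. {y. u y \<le> M} \<inter> ball 0 1 \<inter> cell s k) I"
        unfolding disjoint_family_on_def using cell_disjoint[of _ _ s] by blast
      show "emeasure lborel ({y. u y \<le> M} \<inter> ball 0 1 \<inter> cell s k) \<noteq> \<infinity>" for k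
      proof -
        have "emeasure lborel ({y. u y \<le> M} \<inter> ball 0 1 \<inter> cell s k) \<le> emeasure lborel (cell s k)"
          by (intro emeasure_mono) auto
        then show ?thesis using measure_cell(1)[OF s(1), of k] by auto
      qed
    qed auto
    also have "\<dots> \<le> measure lborel ({y. u y \<le> M} \<inter> ball 0 1)"
    proof (rule measure_mono_fmeasurable)
      have "ball (0 :: real ^ 'n) 1 \<in> fmeasurable lborel"
        using emeasure_lborel_ball_finite by (intro fmeasurableI) auto
      then show "{y. u y \<le> M} \<inter> ball 0 1 \<in> fmeasurable lborel"
        by (rule fmeasurableI2) auto
      show "(\<Union>k\<in>I. {y. u y \<le> M} \<inter> ball 0 1 \<inter> cell s k) \<in> sets lborel"
        using finI by (intro sets.finite_UN) auto
    qed auto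
    finally show ?thesis .
  qed
  then show ?thesis using M \<mu> e1 by blast
qed

subsection \<open>From a point value to measure\<close>

text \<open>The large distance allowed for \<open>x\<^sub>0\<close> is dictated by the dyadic
  argument: with \<rho> half the side of a cell, its parent has diameter at most
  \<open>4 * CARD('n) * \<rho>\<close>, and a small value anywhere in the parent must be felt in the
  cell.\<close>

lemma supersol_point_to_measure:
  shows "\<exists>M>0. \<exists>\<mu>>0. \<exists>\<epsilon>\<^sub>1>0. \<forall>\<epsilon> F t (\<rho> :: real) c S (u :: real ^ 'n \<Rightarrow> real) x\<^sub>0.
    0 < \<epsilon> \<longrightarrow> 0 < \<rho> \<longrightarrow> \<epsilon> < \<epsilon>\<^sub>1 * \<rho> \<longrightarrow> 0 < t \<longrightarrow> F * \<rho>\<^sup>2 \<le> t \<longrightarrow> supersol \<epsilon> F S u \<longrightarrow>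
    ball c ((4 * real CARD('n) + 3) * \<rho>) \<subseteq> S \<longrightarrow> (\<forall>y\<in>ball c ((4 * real CARD('n) + 3) * \<rho>). 0 \<le> u y) \<longrightarrow>
    norm (x\<^sub>0 - c) \<le> 4 * real CARD('n) * \<rho> \<longrightarrow> u x\<^sub>0 \<le> t \<longrightarrow>
    \<mu> * \<rho> ^ CARD('n) \<le> measure lborel ({y. u y \<le> M * t} \<inter> ball c \<rho>)"
proof -
  define K where "K = 4 * real CARD('n)"
  have K: "K > 0" by (simp add: K_def)
  obtain M\<^sub>1 e1 where M1: "M\<^sub>1 > 0" "e1 > 0" and barrier: "\<And>\<epsilon> (u :: real ^ 'n \<Rightarrow> real) x\<^sub>0. 0 < \<epsilon> \<Longrightarrow> \<epsilon> < e1 \<Longrightarrow>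
    supersol \<epsilon> 1 (ball 0 (K + 2)) u \<Longrightarrow> \<forall>y\<in>ball 0 (K + 3). 0 \<le> u y \<Longrightarrow>
    norm x\<^sub>0 \<le> K \<Longrightarrow> u x\<^sub>0 \<le> 1 \<Longrightarrow> \<exists>x\<^sub>1\<in>ball 0 (1 / 4). u x\<^sub>1 \<le> M\<^sub>1"
    using supersol_barrier[OF K, where 'n = 'n] by metis
  obtain M \<mu> e2 where M: "M > 0" "\<mu> > 0" "e2 > 0" and meas: "\<And>\<epsilon> (u :: real ^ 'n \<Rightarrow> real). 0 < \<epsilon> \<Longrightarrow> \<epsilon> < e2 \<Longrightarrow>
    supersol \<epsilon> 1 (ball 0 1) u \<Longrightarrow> \<forall>y\<in>ball 0 2. 0 \<le> u y \<Longrightarrow> \<exists>x\<^sub>1\<in>ball 0 (1 / 4). u x\<^sub>1 \<le> M\<^sub>1 \<Longrightarrow>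
    \<mu> \<le> measure lborel ({y. u y \<le> M} \<inter> ball 0 1)"
    using supersol_paraboloid_measure[OF M1(1), where 'n = 'n] by metis
  have main: "\<mu> * \<rho> ^ CARD('n) \<le> measure lborel ({y. u y \<le> M * t} \<inter> ball c \<rho>)"
    if \<epsilon>: "0 < \<epsilon>" "0 < \<rho>" "\<epsilon> < min e1 e2 * \<rho>" and t: "0 < t" "F * \<rho>\<^sup>2 \<le> t" and u: "supersol \<epsilon> F S u"
      and sub: "ball c ((K + 3) * \<rho>) \<subseteq> S" and nonneg: "\<forall>y\<in>ball c ((K + 3) * \<rho>). 0 \<le> u y"
      and x0: "norm (x\<^sub>0 - c) \<le> K * \<rho>" "u x\<^sub>0 \<le> t"
    for \<epsilon> F t \<rho> c S and u :: "real ^ 'n \<Rightarrow> real" and x\<^sub>0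
  proof -
    have [measurable]: "u \<in> borel_measurable borel" using u by (simp add: supersol_def)
    define v where "v x = (u (c + \<rho> *\<^sub>R x) + 0) / t" for x
    have img: "c + \<rho> *\<^sub>R x \<in> ball c (r * \<rho>)" if "norm x < r" for x r
      using that \<epsilon>(2) by (simp add: dist_norm mult.commute)
    have "supersol (\<epsilon> / \<rho>) (F * \<rho>\<^sup>2 / t) (ball 0 (K + 3)) v"
      unfolding v_def using sub img by (intro supersol_rescale[OF u \<epsilon>(2) t(1)]) auto
    then have v: "supersol (\<epsilon> / \<rho>) 1 (ball 0 r) v" if "r \<le> K + 3" for r
      by (rule supersol_mono) (use that t in auto)
    have "\<epsilon> / \<rho> < min e1 e2"
      using \<epsilon>(3) pos_divide_less_eq[OF \<epsilon>(2)] by blast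
    then have eps: "0 < \<epsilon> / \<rho>" "\<epsilon> / \<rho> < e1" "\<epsilon> / \<rho> < e2"
      using \<epsilon>(1,2) by auto
    have v_nonneg: "\<forall>y\<in>ball 0 r. 0 \<le> v y" if "r \<le> K + 3" for r
    proof
      fix y :: "real ^ 'n" assume "y \<in> ball 0 r"
      then have "0 \<le> u (c + \<rho> *\<^sub>R y)" using that by (intro bspec[OF nonneg] img) simp
      then show "0 \<le> v y" using t by (simp add: v_def)
    qed
    have 1: "norm ((1 / \<rho>) *\<^sub>R (x\<^sub>0 - c)) \<le> K" using x0(1) \<epsilon>(2) by (simp add: pos_divide_le_eq)
    have 2: "v ((1 / \<rho>) *\<^sub>R (x\<^sub>0 - c)) \<le> 1" using x0(2) \<epsilon>(2) t by (simp add: v_def)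
    have "\<exists>x\<^sub>1\<in>ball 0 (1 / 4). v x\<^sub>1 \<le> M\<^sub>1"
      by (rule barrier[OF eps(1,2) v v_nonneg 1 2]) auto
    then have "\<mu> \<le> measure lborel ({y. v y \<le> M} \<inter> ball 0 1)"
      using K by (intro meas[OF eps(1,3) v[of 1] v_nonneg[of 2]]) auto
    also have "{y. v y \<le> M} \<inter> ball 0 1 = {x. c + \<rho> *\<^sub>R x \<in> {y. u y \<le> M * t} \<inter> ball c \<rho>}"
      using t \<epsilon>(2) by (auto simp: v_def dist_norm pos_divide_le_eq)
    finally have "\<rho> ^ CARD('n) * \<mu> \<le> \<rho> ^ CARD('n) * measure lborel {x. c + \<rho> *\<^sub>R x \<in> {y. u y \<le> M * t} \<inter> ball c \<rho>}"
      using \<epsilon>(2) by (intro mult_left_mono) auto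
    also have "\<dots> = measure lborel ({y. u y \<le> M * t} \<inter> ball c \<rho>)"
      using \<epsilon>(2) by (intro measure_affine[symmetric]) auto
    finally show ?thesis by (simp add: mult.commute)
  qed
  have "min e1 e2 > 0" using M1 M by simp
  show ?thesis
    by (rule exI[of _ M], rule conjI, fact M, rule exI[of _ \<mu>], rule conjI, fact M,
        rule exI[of _ "min e1 e2"], rule conjI, fact, intro allI impI,
        rule main[unfolded K_def], assumption+)
qed

text \<open>Contrapositive of the preceding estimate in the ball inscribed in the cell: a value of
  at most \<open>t\<close> within reach would make \<open>u \<le> M * t\<close> on a fixed fraction
  of the cell. The reach covers the whole parent cell.\<close>

lemma supersol_cell_density:
  shows "\<exists>M>1. \<exists>\<mu>>0. \<mu> \<le> 1 / 2 \<and> (\<exists>\<epsilon>\<^sub>1>0. \<forall>\<epsilon> F t (\<sigma> :: real) k S (u :: real ^ 'n \<Rightarrow> real) x.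
    0 < \<epsilon> \<longrightarrow> 0 < \<sigma> \<longrightarrow> \<epsilon> < \<epsilon>\<^sub>1 * \<sigma> \<longrightarrow> 0 < t \<longrightarrow> 0 \<le> F \<longrightarrow> F * \<sigma>\<^sup>2 \<le> t \<longrightarrow> supersol \<epsilon> F S u \<longrightarrow>
    ball (cell_center \<sigma> k) (4 * real CARD('n) * \<sigma>) \<subseteq> S \<longrightarrow> (\<forall>y\<in>S. 0 \<le> u y) \<longrightarrow>
    norm (x - cell_center \<sigma> k) \<le> 2 * real CARD('n) * \<sigma> \<longrightarrow>
    (1 - \<mu>) * \<sigma> ^ CARD('n) < measure lborel ({y. M * t < u y} \<inter> cell \<sigma> k) \<longrightarrow> t < u x)"
proof -
  define N where "N = real CARD('n)"
  have N: "N \<ge> 1" by (simp add: N_def Suc_le_eq)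
  obtain M \<mu> \<epsilon>\<^sub>1 where M: "M > 0" "\<mu> > 0" "\<epsilon>\<^sub>1 > 0" and ptm: "\<forall>\<epsilon> F t \<rho> c S (u :: real ^ 'n \<Rightarrow> real) x\<^sub>0.
    0 < \<epsilon> \<longrightarrow> 0 < \<rho> \<longrightarrow> \<epsilon> < \<epsilon>\<^sub>1 * \<rho> \<longrightarrow> 0 < t \<longrightarrow> F * \<rho>\<^sup>2 \<le> t \<longrightarrow> supersol \<epsilon> F S u \<longrightarrow>
    ball c ((4 * N + 3) * \<rho>) \<subseteq> S \<longrightarrow> (\<forall>y\<in>ball c ((4 * N + 3) * \<rho>). 0 \<le> u y) \<longrightarrow>
    norm (x\<^sub>0 - c) \<le> 4 * N * \<rho> \<longrightarrow> u x\<^sub>0 \<le> t \<longrightarrow>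
    \<mu> * \<rho> ^ CARD('n) \<le> measure lborel ({y. u y \<le> M * t} \<inter> ball c \<rho>)"
    using supersol_point_to_measure[where 'n = 'n, folded N_def]
    by (elim exE conjE) (rule that; assumption)
  define M' where "M' = M + 1"
  \<comment> \<open>The power of 2 compares the inscribed ball of radius \<open>\<sigma> / 2\<close>
    with the cell. The cap 1/2 keeps \<open>1 - \<mu>'\<close> positive and above the density
    threshold used for the smallest cells.\<close>
  define \<mu>' where "\<mu>' = min (1 / 2) (\<mu> / 2 ^ CARD('n))"
  have main: "t < u x"
    if \<epsilon>: "0 < \<epsilon>" "0 < \<sigma>" "\<epsilon> < \<epsilon>\<^sub>1 / 2 * \<sigma>" and t: "0 < t" "0 \<le> F" "F * \<sigma>\<^sup>2 \<le> t" and u: "supersol \<epsilon> F S u"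
      and sub: "ball (cell_center \<sigma> k) (4 * N * \<sigma>) \<subseteq> S" and nonneg: "\<forall>y\<in>S. 0 \<le> u y"
      and x: "norm (x - cell_center \<sigma> k) \<le> 2 * N * \<sigma>"
      and dens: "(1 - \<mu>') * \<sigma> ^ CARD('n) < measure lborel ({y. M' * t < u y} \<inter> cell \<sigma> k)"
    for \<epsilon> F t \<sigma> k S and u :: "real ^ 'n \<Rightarrow> real" and x
  proof (rule ccontr)
    assume "\<not> t < u x"
    have [measurable]: "u \<in> borel_measurable borel" using u by (simp add: supersol_def)
    define c where "c = cell_center \<sigma> k"
    define B where "B = {y. u y \<le> M * t} \<inter> ball c (\<sigma> / 2)"
    have "(4 * N + 3) * (\<sigma> / 2) \<le> 4 * N * \<sigma>"
      using mult_right_mono[of "4 * N + 3" "8 * N" "\<sigma> / 2"] N \<epsilon> by simp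
    then have inS: "ball c ((4 * N + 3) * (\<sigma> / 2)) \<subseteq> S"
      using sub subset_ball unfolding c_def by blast
    have "F * (\<sigma> / 2)\<^sup>2 \<le> F * \<sigma>\<^sup>2"
      using t \<epsilon> by (intro mult_left_mono power_mono) auto
    then have "\<mu> * (\<sigma> / 2) ^ CARD('n) \<le> measure lborel B"
      unfolding B_def using \<epsilon> t u inS nonneg x \<open>\<not> t < u x\<close>
      by (intro ptm[rule_format, where F = F and S = S and x\<^sub>0 = x]) (auto simp: c_def)
    moreover have "\<mu>' * \<sigma> ^ CARD('n) \<le> \<mu> * (\<sigma> / 2) ^ CARD('n)"
    proof -
      have "\<mu>' * \<sigma> ^ CARD('n) \<le> \<mu> / 2 ^ CARD('n) * \<sigma> ^ CARD('n)"
        using \<epsilon> by (intro mult_right_mono) (auto simp: \<mu>'_def)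
      then show ?thesis by (simp add: power_divide)
    qed
    moreover have "measure lborel B + measure lborel ({y. M' * t < u y} \<inter> cell \<sigma> k) \<le> \<sigma> ^ CARD('n)"
    proof -
      have fm: "cell \<sigma> k \<in> fmeasurable lborel"
        using measure_cell(1)[OF \<epsilon>(2)] by (intro fmeasurableI) auto
      have B: "B \<subseteq> cell \<sigma> k" "B \<in> fmeasurable lborel"
        using ball_subset_cell[OF \<epsilon>(2), of k] unfolding B_def c_def
        by (auto intro!: fmeasurableI2[OF fm])
      have E: "{y. M' * t < u y} \<inter> cell \<sigma> k \<in> fmeasurable lborel"
        by (rule fmeasurableI2[OF fm]) auto
      have "B \<inter> ({y. M' * t < u y} \<inter> cell \<sigma> k) = {}"
        using t by (auto simp: B_def M'_def algebra_simps)
      then have "measure lborel B + measure lborel ({y. M' * t < u y} \<inter> cell \<sigma> k)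
          = measure lborel (B \<union> ({y. M' * t < u y} \<inter> cell \<sigma> k))"
        using B E by (intro measure_Union[symmetric]) (auto simp: fmeasurable_def less_top)
      also have "\<dots> \<le> measure lborel (cell \<sigma> k)"
        using B E by (intro measure_mono_fmeasurable fm) auto
      finally show ?thesis using measure_cell(2)[OF \<epsilon>(2), of k] by simp
    qed
    ultimately show False using dens by (simp add: algebra_simps)
  qed
  have pos: "M' > 1" "\<mu>' > 0" "\<mu>' \<le> 1 / 2" "\<epsilon>\<^sub>1 / 2 > 0" using M min.cobounded1[of "1 / 2" "\<mu> / 2 ^ CARD('n)"]
    unfolding M'_def \<mu>'_def by (auto simp del: min.cobounded1)
  show ?thesis
    by (rule exI[of _ M'], rule conjI, fact pos, rule exI[of _ \<mu>'], rule conjI, fact pos,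
        rule conjI, fact pos, rule exI[of _ "\<epsilon>\<^sub>1 / 2"], rule conjI, fact pos, intro allI impI,
        rule main[unfolded N_def], assumption+)
qed

text \<open>A point less than \<open>\<epsilon> / 2\<close> outside a ball has a quarter ball inside
  its averaging ball that still lies in the old ball. Each enlargement by
  \<open>\<epsilon> / 2\<close> thus costs the factor \<open>\<beta> / 4 ^ CARD('n)\<close> and one
  source term. A bounded number of such steps covers the scales too close to \<epsilon> for the
  point-to-measure estimate.\<close>

lemma supersol_spread:
  fixes u :: "real ^ 'n \<Rightarrow> real"
  assumes u: "supersol \<epsilon> F S u" and "\<epsilon> > 0" "F \<ge> 0" "T \<ge> 0"
    and sub: "ball c (\<epsilon> / 4 + n * (\<epsilon> / 2)) \<subseteq> S"
    and nonneg: "\<forall>y\<in>ball c (\<epsilon> / 4 + n * (\<epsilon> / 2) + \<Lambda> * \<epsilon>). 0 \<le> u y"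
    and start: "\<forall>y\<in>ball c (\<epsilon> / 4). T \<le> u y"
    and x: "x \<in> ball c (\<epsilon> / 4 + n * (\<epsilon> / 2))"
  shows "(\<beta> / 4 ^ CARD('n)) ^ n * T - n * (\<epsilon>\<^sup>2 * F) \<le> u x"
  using sub nonneg x
proof (induction n arbitrary: x)
  case 0
  then show ?case using start by simp
next
  case (Suc n)
  define \<kappa> where "\<kappa> = \<beta> / 4 ^ CARD('n)"
  have "\<beta> \<le> 4 ^ CARD('n)" by (rule order_trans[OF beta(2)]) simp
  then have \<kappa>: "0 < \<kappa>" "\<kappa> \<le> 1" using beta by (auto simp: \<kappa>_def divide_le_eq)
  define r where "r = \<epsilon> / 4 + n * (\<epsilon> / 2)"
  have r: "\<epsilon> / 4 + real (Suc n) * (\<epsilon> / 2) = r + \<epsilon> / 2" by (simp add: r_def field_simps)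
  have F: "0 \<le> \<epsilon>\<^sup>2 * F" using \<open>F \<ge> 0\<close> by simp
  define T' where "T' = \<kappa> ^ n * T - n * (\<epsilon>\<^sup>2 * F)"
  have IH: "T' \<le> u y" if "y \<in> ball c r" for y
    unfolding T'_def \<kappa>_def
  proof (rule Suc.IH)
    show "ball c (\<epsilon> / 4 + n * (\<epsilon> / 2)) \<subseteq> S"
      using Suc.prems(1) subset_ball[of r "r + \<epsilon> / 2" c] \<open>\<epsilon> > 0\<close> unfolding r r_def[symmetric] by auto
    show "\<forall>y\<in>ball c (\<epsilon> / 4 + n * (\<epsilon> / 2) + \<Lambda> * \<epsilon>). 0 \<le> u y"
      using Suc.prems(2) subset_ball[of "r + \<Lambda> * \<epsilon>" "r + \<epsilon> / 2 + \<Lambda> * \<epsilon>" c] \<open>\<epsilon> > 0\<close>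
      unfolding r r_def[symmetric] by auto
    show "y \<in> ball c (\<epsilon> / 4 + n * (\<epsilon> / 2))" using that by (simp add: r_def)
  qed
  have "\<kappa> ^ Suc n * T \<le> \<kappa> ^ n * T"
    using \<kappa> \<open>T \<ge> 0\<close> by (intro mult_right_mono) (auto simp: mult_left_le_one_le)
  then have le: "\<kappa> ^ Suc n * T - Suc n * (\<epsilon>\<^sup>2 * F) \<le> T'"
    using F by (simp add: T'_def algebra_simps)
  have "\<kappa> * (n * (\<epsilon>\<^sup>2 * F)) \<le> 1 * (n * (\<epsilon>\<^sup>2 * F))"
    using \<kappa> F by (intro mult_right_mono) auto
  then have step: "\<kappa> ^ Suc n * T - Suc n * (\<epsilon>\<^sup>2 * F) \<le> \<kappa> * T' - \<epsilon>\<^sup>2 * F"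
    by (simp add: T'_def algebra_simps)
  show ?case
  proof (cases "x \<in> ball c r")
    case True
    then show ?thesis using IH le unfolding \<kappa>_def by fastforce
  next
    case False
    define d where "d = norm (c - x)"
    have d: "r \<le> d" "d < r + \<epsilon> / 2" "d > 0"
    proof -
      show "r \<le> d" using False by (simp add: d_def dist_norm)
      moreover have "r > 0" using \<open>\<epsilon> > 0\<close> by (simp add: r_def add_pos_nonneg)
      ultimately show "d > 0" by simp
      show "d < r + \<epsilon> / 2" using Suc.prems(3) unfolding r by (simp add: d_def dist_norm)
    qed
    define b where "b = n * (\<epsilon> / 2)"
    have b: "b \<ge> 0" "r = \<epsilon> / 4 + b" using \<open>\<epsilon> > 0\<close> by (auto simp: b_def r_def)
    \<comment> \<open>\<open>z\<close> lies on the segment from \<open>x\<close> to \<open>c\<close>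
      at distance \<open>b\<close> from \<open>c\<close>, so the quarter ball around it fits into
      the old ball of radius \<open>\<epsilon> / 4 + b\<close>; its distance to \<open>x\<close> is
      below \<open>3 * \<epsilon> / 4\<close>, so that ball also fits into the averaging
      ball.\<close>
    define z where "z = x + ((d - b) / d) *\<^sub>R (c - x)"
    have q: "\<epsilon> / 4 \<le> d - b" "d - b < 3 * \<epsilon> / 4"
      using d b by auto
    have zx: "norm (z - x) = d - b"
      using q \<open>\<epsilon> > 0\<close> d(3) by (simp add: z_def flip: d_def)
    have "c - z = (b / d) *\<^sub>R (c - x)"
      using d(3) by (simp add: z_def diff_divide_distrib scaleR_diff_left)
    then have zc: "norm (c - z) = b"
      using b(1) d(3) by (simp flip: d_def)
    have sub1: "ball z (\<epsilon> / 4) \<subseteq> ball x \<epsilon>"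
    proof
      fix y assume "y \<in> ball z (\<epsilon> / 4)"
      then show "y \<in> ball x \<epsilon>"
        using norm_triangle_ineq4[of "z - y" "z - x"] zx q by (simp add: dist_norm norm_minus_commute)
    qed
    have sub2: "ball z (\<epsilon> / 4) \<subseteq> ball c r"
    proof
      fix y assume "y \<in> ball z (\<epsilon> / 4)"
      then show "y \<in> ball c r"
        using norm_triangle_ineq[of "c - z" "z - y"] zc by (simp add: dist_norm b(2))
    qed
    have pos: "0 \<le> u y" if "y \<in> ball x (\<Lambda> * \<epsilon>)" for y
    proof (rule bspec[OF Suc.prems(2)])
      show "y \<in> ball c (\<epsilon> / 4 + real (Suc n) * (\<epsilon> / 2) + \<Lambda> * \<epsilon>)"
        unfolding r using that d(2) norm_triangle_ineq[of "c - x" "x - y"] by (simp add: dist_norm d_def)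
    qed
    have "1 * \<epsilon> \<le> \<Lambda> * \<epsilon>" using Lambda \<open>\<epsilon> > 0\<close> by (intro mult_right_mono) auto
    then have "T' / 4 ^ CARD('n) \<le> avg (\<lambda>h. u (x + \<epsilon> *\<^sub>R h))"
      using pos IH sub2
      by (intro avg_lower_ball[OF supersol_loc_bdd[OF u] \<open>\<epsilon> > 0\<close> sub1]) auto
    then have "\<kappa> * T' \<le> \<beta> * avg (\<lambda>h. u (x + \<epsilon> *\<^sub>R h))"
      using mult_left_mono[of "T' / 4 ^ CARD('n)" _ \<beta>] beta by (simp add: \<kappa>_def)
    moreover have "\<beta> * avg (\<lambda>h. u (x + \<epsilon> *\<^sub>R h)) - \<epsilon>\<^sup>2 * F \<le> u x"
      using supersol_nonneg_avg[OF u _ \<open>\<epsilon> > 0\<close> pos] Suc.prems(1,3) by blast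
    ultimately show ?thesis using step unfolding \<kappa>_def by linarith
  qed
qed

text \<open>Since \<open>N * s \<le> \<epsilon> / 4\<close>, every averaging ball centred within
  \<open>\<epsilon> / 4\<close> of \<open>z\<close> contains the whole cell, so positive density
  becomes a pointwise bound at once and can then be spread. The reverse comparison
  \<open>\<epsilon> \<le> 8 * N * s\<close> bounds the volume lost between ball and cell.\<close>

lemma supersol_small_cell:
  fixes u :: "real ^ 'n \<Rightarrow> real"
  defines "N \<equiv> real CARD('n)" and "V \<equiv> measure lborel (ball (0 :: real ^ 'n) 1)"
  assumes u: "supersol \<epsilon> F S u" and "\<epsilon> > 0" "F \<ge> 0" "T \<ge> 0" "c\<^sub>0 > 0"
    and s: "0 < s" "N * s \<le> \<epsilon> / 4" "\<epsilon> \<le> 8 * N * s"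
    and dens: "c\<^sub>0 * s ^ CARD('n) \<le> measure lborel ({y. T < u y} \<inter> cell s k)" and z: "z \<in> cell s k"
    and sub: "ball z (\<epsilon> / 4 + n * (\<epsilon> / 2)) \<subseteq> S"
    and nonneg: "\<forall>y\<in>ball z (\<epsilon> / 4 + n * (\<epsilon> / 2) + \<Lambda> * \<epsilon>). 0 \<le> u y"
    and x: "x \<in> ball z (\<epsilon> / 4 + n * (\<epsilon> / 2))"
  shows "(\<beta> / 4 ^ CARD('n)) ^ n * (\<beta> * c\<^sub>0 / ((8 * N) ^ CARD('n) * V)) * T - (n + 1) * (\<epsilon>\<^sup>2 * F) \<le> u x"
proof -
  have [measurable]: "u \<in> borel_measurable borel" using u by (simp add: supersol_def)
  have N: "N \<ge> 1" by (simp add: N_def Suc_le_eq)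
  have V: "V > 0" unfolding V_def by (rule unit_ball_measure_pos)
  define \<kappa> where "\<kappa> = \<beta> / 4 ^ CARD('n)"
  have "\<beta> \<le> 4 ^ CARD('n)" by (rule order_trans[OF beta(2)]) simp
  then have \<kappa>: "0 < \<kappa>" "\<kappa> \<le> 1" using beta by (auto simp: \<kappa>_def divide_le_eq)
  define T\<^sub>1 where "T\<^sub>1 = \<beta> * c\<^sub>0 / ((8 * N) ^ CARD('n) * V) * T"
  have T1: "T\<^sub>1 \<ge> 0" using beta \<open>c\<^sub>0 > 0\<close> N V \<open>T \<ge> 0\<close> by (simp add: T\<^sub>1_def)
  have F: "0 \<le> \<epsilon>\<^sup>2 * F" using \<open>F \<ge> 0\<close> by simp
  have n\<epsilon>: "0 \<le> n * (\<epsilon> / 2)" using \<open>\<epsilon> > 0\<close> by simp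
  have Le: "1 * \<epsilon> \<le> \<Lambda> * \<epsilon>" using Lambda \<open>\<epsilon> > 0\<close> by (intro mult_right_mono) auto
  have "T\<^sub>1 - \<epsilon>\<^sup>2 * F \<le> u y" if y: "y \<in> ball z (\<epsilon> / 4)" for y
  proof -
    have zy: "norm (z - y) < \<epsilon> / 4" using y by (simp add: dist_norm)
    have pos: "0 \<le> u w" if "w \<in> ball y (\<Lambda> * \<epsilon>)" for w
    proof (rule bspec[OF nonneg])
      have "norm (z - w) < \<epsilon> / 4 + \<Lambda> * \<epsilon>"
        using zy that norm_triangle_ineq[of "z - y" "y - w"] by (simp add: dist_norm)
      then show "w \<in> ball z (\<epsilon> / 4 + n * (\<epsilon> / 2) + \<Lambda> * \<epsilon>)"
        using n\<epsilon> unfolding mem_ball dist_norm by linarith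
    qed
    have cell_sub: "cell s k \<subseteq> ball y \<epsilon>"
    proof
      fix w assume w: "w \<in> cell s k"
      have "norm (z - w) \<le> N * s" unfolding N_def by (rule cell_diameter[OF s(1) z w])
      then show "w \<in> ball y \<epsilon>"
        using zy s(2) \<open>\<epsilon> > 0\<close> norm_triangle_ineq4[of "z - w" "z - y"] by (simp add: dist_norm)
    qed
    define m where "m = measure lborel ({y. T < u y} \<inter> cell s k)"
    have "T * m / (\<epsilon> ^ CARD('n) * V) \<le> avg (\<lambda>h. u (y + \<epsilon> *\<^sub>R h))"
      unfolding V_def m_def using cell_sub pos Le
      by (intro avg_lower_bound[OF supersol_loc_bdd[OF u] \<open>\<epsilon> > 0\<close>]) auto
    moreover have "T * c\<^sub>0 / ((8 * N) ^ CARD('n) * V) \<le> T * m / (\<epsilon> ^ CARD('n) * V)"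
    proof -
      have "c\<^sub>0 * \<epsilon> ^ CARD('n) \<le> c\<^sub>0 * (8 * N * s) ^ CARD('n)"
        using s \<open>\<epsilon> > 0\<close> \<open>c\<^sub>0 > 0\<close> by (intro mult_left_mono power_mono) auto
      also have "\<dots> = (8 * N) ^ CARD('n) * (c\<^sub>0 * s ^ CARD('n))"
        by (simp add: power_mult_distrib)
      also have "\<dots> \<le> (8 * N) ^ CARD('n) * m"
        using dens N unfolding m_def by (intro mult_left_mono) auto
      finally have "c\<^sub>0 / (8 * N) ^ CARD('n) \<le> m / \<epsilon> ^ CARD('n)"
        using N \<open>\<epsilon> > 0\<close> by (simp add: field_simps)
      then have "T / V * (c\<^sub>0 / (8 * N) ^ CARD('n)) \<le> T / V * (m / \<epsilon> ^ CARD('n))"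
        using \<open>T \<ge> 0\<close> V by (intro mult_left_mono) auto
      then show ?thesis by (simp add: mult.commute)
    qed
    ultimately have "\<beta> * (T * c\<^sub>0 / ((8 * N) ^ CARD('n) * V)) \<le> \<beta> * avg (\<lambda>h. u (y + \<epsilon> *\<^sub>R h))"
      using beta by (intro mult_left_mono) auto
    moreover have "y \<in> S"
    proof (rule subsetD[OF sub])
      show "y \<in> ball z (\<epsilon> / 4 + n * (\<epsilon> / 2))"
        using zy n\<epsilon> unfolding mem_ball dist_norm by linarith
    qed
    then have "\<beta> * avg (\<lambda>h. u (y + \<epsilon> *\<^sub>R h)) - \<epsilon>\<^sup>2 * F \<le> u y"
      using supersol_nonneg_avg[OF u _ \<open>\<epsilon> > 0\<close> pos] by blast
    ultimately show ?thesis by (simp add: T\<^sub>1_def mult_ac)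
  qed
  moreover have "0 \<le> u y" if "y \<in> ball z (\<epsilon> / 4)" for y
  proof (rule bspec[OF nonneg])
    show "y \<in> ball z (\<epsilon> / 4 + n * (\<epsilon> / 2) + \<Lambda> * \<epsilon>)"
      using that n\<epsilon> Le \<open>\<epsilon> > 0\<close> unfolding mem_ball by linarith
  qed
  \<comment> \<open>Truncation at 0 because \<open>supersol_spread\<close> starts from a nonnegative
    level.\<close>
  ultimately have start: "\<forall>y\<in>ball z (\<epsilon> / 4). max 0 (T\<^sub>1 - \<epsilon>\<^sup>2 * F) \<le> u y"
    by simp
  have "\<kappa> ^ n * T\<^sub>1 - \<epsilon>\<^sup>2 * F \<le> \<kappa> ^ n * T\<^sub>1 - \<kappa> ^ n * (\<epsilon>\<^sup>2 * F)"
    using \<kappa> F mult_right_mono[of "\<kappa> ^ n" 1 "\<epsilon>\<^sup>2 * F"] by (simp add: power_le_one)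
  also have "\<dots> \<le> \<kappa> ^ n * max 0 (T\<^sub>1 - \<epsilon>\<^sup>2 * F)"
    using \<kappa> mult_left_mono[of "T\<^sub>1 - \<epsilon>\<^sup>2 * F" "max 0 (T\<^sub>1 - \<epsilon>\<^sup>2 * F)" "\<kappa> ^ n"] by (simp add: algebra_simps)
  finally have "\<kappa> ^ n * T\<^sub>1 - \<epsilon>\<^sup>2 * F - n * (\<epsilon>\<^sup>2 * F) \<le> u x"
    using supersol_spread[OF u \<open>\<epsilon> > 0\<close> \<open>F \<ge> 0\<close> _ sub nonneg start x] unfolding \<kappa>_def by simp
  then show ?thesis
    by (simp add: \<kappa>_def T\<^sub>1_def algebra_simps)
qed

end

subsection \<open>From measure to pointwise growth\<close>

text \<open>Additivity of volume stands in for counting the children.\<close>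

lemma sum_children_volume:
  assumes "(s :: real) > 0"
  shows "(\<Sum>k'\<in>children (k :: 'n::finite \<Rightarrow> int). s ^ CARD('n)) = (2 * s) ^ CARD('n)"
proof -
  have "(\<Sum>k'\<in>children k. s ^ CARD('n)) = (\<Sum>k'\<in>children k. measure lborel (UNIV \<inter> cell s k'))"
    unfolding Int_UNIV_left measure_cell(2)[OF assms] ..
  also have "\<dots> = measure lborel (UNIV \<inter> cell (2 * s) k)"
    by (rule measure_Int_cell_double[OF assms, symmetric]) simp
  also have "\<dots> = (2 * s) ^ CARD('n)"
    unfolding Int_UNIV_left using assms by (intro measure_cell) simp
  finally show ?thesis .
qed

text \<open>Used in contrapositive form: a cell whose density exceeds the threshold contains a
  smallest cell whose density exceeds it too.\<close>

lemma density_of_subcells: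
  assumes "s > 0" and [measurable]: "E \<in> sets borel"
    and "\<And>k'. cell s k' \<subseteq> cell (2 ^ j * s) k \<Longrightarrow> measure lborel (E \<inter> cell s k') \<le> c\<^sub>0 * s ^ CARD('n)"
  shows "measure lborel (E \<inter> cell (2 ^ j * s) (k :: 'n::finite \<Rightarrow> int)) \<le> c\<^sub>0 * (2 ^ j * s) ^ CARD('n)"
  using assms(3)
proof (induction j arbitrary: k)
  case 0
  then show ?case by simp
next
  case (Suc j)
  have pos: "2 ^ j * s > 0" using assms(1) by simp
  have sub: "cell (2 ^ j * s) k' \<subseteq> cell (2 ^ Suc j * s) k" if "k' \<in> children k" for k'
    using cell_double_eq[OF pos, of k] that by (auto simp: mult.assoc)
  have "measure lborel (E \<inter> cell (2 ^ Suc j * s) k) = (\<Sum>k'\<in>children k. measure lborel (E \<inter> cell (2 ^ j * s) k'))"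
    using measure_Int_cell_double[OF pos assms(2), of k] by (simp add: mult.assoc)
  also have "\<dots> \<le> (\<Sum>k'\<in>children k. c\<^sub>0 * (2 ^ j * s) ^ CARD('n))"
    using sub Suc.prems by (intro sum_mono Suc.IH) blast
  also have "\<dots> = c\<^sub>0 * (2 ^ Suc j * s) ^ CARD('n)"
    using sum_children_volume[OF pos, of k] by (simp add: mult.assoc flip: sum_distrib_left)
  finally show ?case .
qed

text \<open>The Calderon-Zygmund decomposition run upwards from the stopping scale. For a cell
  inside \<open>G\<close> the density bound is the claim. Otherwise \<open>step\<close> shows that
  no child has density above \<open>1 - \<mu>\<close>, so the induction hypothesis holds for all
  children and adds up. The term with \<open>c\<^sub>0\<close> is the residue of smallest cells not
  contained in \<open>G\<close>.\<close>

lemma calderon_zygmund_growth: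
  assumes s: "s > 0" and [measurable]: "E \<in> sets borel" "G \<in> sets borel" and "\<mu> < 1" "c\<^sub>0 \<ge> 0"
    and base: "\<And>k. cell s k \<subseteq> Q \<Longrightarrow> c\<^sub>0 * s ^ CARD('n) < measure lborel (E \<inter> cell s k) \<Longrightarrow> cell s k \<subseteq> G"
    and step: "\<And>j k k'. cell (2 ^ Suc j * s) k \<subseteq> Q \<Longrightarrow> k' \<in> children k \<Longrightarrow>
      (1 - \<mu>) * (2 ^ j * s) ^ CARD('n) < measure lborel (E \<inter> cell (2 ^ j * s) k') \<Longrightarrow> cell (2 ^ Suc j * s) k \<subseteq> G"
    and "cell (2 ^ j * s) k \<subseteq> Q"
    and "measure lborel (E \<inter> cell (2 ^ j * s) k) \<le> (1 - \<mu>) * (2 ^ j * s) ^ CARD('n)"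
  shows "measure lborel (E \<inter> cell (2 ^ j * s) (k :: 'n::finite \<Rightarrow> int))
       \<le> (1 - \<mu>) * measure lborel (G \<inter> cell (2 ^ j * s) k) + c\<^sub>0 * (2 ^ j * s) ^ CARD('n)"
  using assms(8,9)
proof (induction j arbitrary: k)
  case 0
  show ?case
  proof (cases "cell s k \<subseteq> G")
    case True
    then have "G \<inter> cell s k = cell s k" by blast
    moreover have "0 \<le> c\<^sub>0 * s ^ CARD('n)" using s \<open>c\<^sub>0 \<ge> 0\<close> by simp
    ultimately show ?thesis using 0 s by (simp add: measure_cell)
  next
    case False
    then have "measure lborel (E \<inter> cell s k) \<le> c\<^sub>0 * s ^ CARD('n)" using base 0 by force
    then show ?thesis using \<open>\<mu> < 1\<close> by (simp add: add_increasing)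
  qed
next
  case (Suc j)
  have pos: "2 ^ j * s > 0" using s by simp
  have sub: "cell (2 ^ j * s) k' \<subseteq> cell (2 ^ Suc j * s) k" if "k' \<in> children k" for k'
    using cell_double_eq[OF pos, of k] that by (auto simp: mult.assoc)
  show ?case
  proof (cases "cell (2 ^ Suc j * s) k \<subseteq> G")
    case True
    then have "G \<inter> cell (2 ^ Suc j * s) k = cell (2 ^ Suc j * s) k" by blast
    moreover have "0 \<le> c\<^sub>0 * (2 ^ Suc j * s) ^ CARD('n)" using s \<open>c\<^sub>0 \<ge> 0\<close> by simp
    moreover have "measure lborel (cell (2 ^ Suc j * s) k) = (2 ^ Suc j * s) ^ CARD('n)"
      using s by (intro measure_cell) simp
    ultimately show ?thesis using Suc.prems(2) by (simp only:)
  next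
    case False
    have "measure lborel (E \<inter> cell (2 ^ Suc j * s) k) = (\<Sum>k'\<in>children k. measure lborel (E \<inter> cell (2 ^ j * s) k'))"
      using measure_Int_cell_double[OF pos assms(2), of k] by (simp add: mult.assoc)
    also have "\<dots> \<le> (\<Sum>k'\<in>children k. (1 - \<mu>) * measure lborel (G \<inter> cell (2 ^ j * s) k') + c\<^sub>0 * (2 ^ j * s) ^ CARD('n))"
      using False step[OF Suc.prems(1)] sub Suc.prems(1) by (intro sum_mono Suc.IH) (force simp: not_le[symmetric])+
    also have "\<dots> = (1 - \<mu>) * measure lborel (G \<inter> cell (2 ^ Suc j * s) k) + c\<^sub>0 * (2 ^ Suc j * s) ^ CARD('n)"
      using sum_children_volume[OF pos, of k] measure_Int_cell_double[OF pos assms(3), of k]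
      by (simp add: sum.distrib mult.assoc flip: sum_distrib_left)
    finally show ?thesis .
  qed
qed

lemma exists_dyadic_scale:
  fixes a :: real
  assumes "0 < a" "a < 1"
  shows "\<exists>L. 1 / 2 ^ L \<le> a \<and> a \<le> 2 * (1 / 2 ^ L)"
proof -
  obtain n where n: "(1 / 2) ^ n < a" using real_arch_pow_inv[OF assms(1), of "1 / 2"] by auto
  define L where "L = (LEAST n. (1 / 2) ^ n \<le> a)"
  have L: "(1 / 2) ^ L \<le> a" unfolding L_def by (rule LeastI[of _ n]) (use n in auto)
  have "L \<noteq> 0" using L assms by (intro notI) simp
  then obtain l where l: "L = Suc l" by (cases L) auto
  have "\<not> (1 / 2) ^ l \<le> a" using not_less_Least[of l "\<lambda>n. (1 / 2) ^ n \<le> a"] l unfolding L_def by simp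
  then show ?thesis using L l by (intro exI[of _ L]) (simp add: power_divide)
qed

section \<open>Growth of superlevel sets in the unit cell\<close>

context dpp begin

text \<open>One link of the iteration, named so that its constants can be fixed once for all levels;
  the last argument carries the dimension. \<open>n\<close> counts spreading steps, each costing one
  source term, and one more arises at the start. The radius is \<open>CARD('n)\<close> for points of
  the unit cell plus \<open>4 * CARD('n)\<close> for the reach of
  \<open>supersol_cell_density\<close> at side at most 1.\<close>

definition growth_step :: "real \<Rightarrow> real \<Rightarrow> nat \<Rightarrow> real \<Rightarrow> 'n::finite itself \<Rightarrow> bool" where
  "growth_step M \<mu> n \<epsilon>\<^sub>1 _ \<longleftrightarrow> (\<forall>\<epsilon> F t (u :: real ^ 'n \<Rightarrow> real).
     0 < \<epsilon> \<longrightarrow> \<epsilon> < \<epsilon>\<^sub>1 \<longrightarrow> 0 \<le> F \<longrightarrow> (n + 1) * F < t \<longrightarrow>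
     supersol \<epsilon> F (ball 0 (5 * real CARD('n))) u \<longrightarrow> (\<forall>y\<in>ball 0 (5 * real CARD('n)). 0 \<le> u y) \<longrightarrow>
     (\<forall>x\<in>cell 1 (\<lambda>_. 0). t < u x) \<or>
     measure lborel ({y. M * t < u y} \<inter> cell 1 (\<lambda>_. 0))
       \<le> (1 - \<mu>) * measure lborel ({y. t < u y} \<inter> cell 1 (\<lambda>_. 0)) + \<mu> / 4)"

lemma supersol_growth_step:
  "\<exists>M>1. \<exists>\<mu>>0. \<mu> \<le> 1 / 2 \<and> (\<exists>n. \<exists>\<epsilon>\<^sub>1>0. growth_step M \<mu> n \<epsilon>\<^sub>1 TYPE('n::finite))"
proof -
  define N where "N = real CARD('n)"
  define V where "V = measure lborel (ball (0 :: real ^ 'n) 1)"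
  have N: "N \<ge> 1" by (simp add: N_def Suc_le_eq)
  have V: "V > 0" unfolding V_def by (rule unit_ball_measure_pos)
  obtain M\<^sub>0 \<mu> \<epsilon>\<^sub>1 where M0: "M\<^sub>0 > 1" "\<mu> > 0" "\<mu> \<le> 1 / 2" "\<epsilon>\<^sub>1 > 0"
    and high: "\<forall>\<epsilon> F t (\<sigma> :: real) k S (u :: real ^ 'n \<Rightarrow> real) x.
    0 < \<epsilon> \<longrightarrow> 0 < \<sigma> \<longrightarrow> \<epsilon> < \<epsilon>\<^sub>1 * \<sigma> \<longrightarrow> 0 < t \<longrightarrow> 0 \<le> F \<longrightarrow> F * \<sigma>\<^sup>2 \<le> t \<longrightarrow> supersol \<epsilon> F S u \<longrightarrow>
    ball (cell_center \<sigma> k) (4 * N * \<sigma>) \<subseteq> S \<longrightarrow> (\<forall>y\<in>S. 0 \<le> u y) \<longrightarrow>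
    norm (x - cell_center \<sigma> k) \<le> 2 * N * \<sigma> \<longrightarrow>
    (1 - \<mu>) * \<sigma> ^ CARD('n) < measure lborel ({y. M\<^sub>0 * t < u y} \<inter> cell \<sigma> k) \<longrightarrow> t < u x"
    using supersol_cell_density[where 'n = 'n, folded N_def]
    by (elim exE conjE) (rule that; assumption)
  \<comment> \<open>Small enough to stay below \<open>1 - \<mu>\<close>, so that dense cells contain
    dense smallest cells, and to put the fixed point of the measure recursion at 1/4.\<close>
  define c\<^sub>0 where "c\<^sub>0 = \<mu> / 4"
  \<comment> \<open>Cells of side at most \<open>\<epsilon> / \<epsilon>\<^sub>1\<close> are too small for the point-to-measure estimate,
    but their parents have diameter at most \<open>n \<epsilon> / 2\<close> and are reached in \<open>n\<close> steps of the averaging term.\<close>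
  define n where "n = nat \<lceil>4 * N / \<epsilon>\<^sub>1\<rceil> + 1"
  define \<kappa> where "\<kappa> = (\<beta> / 4 ^ CARD('n)) ^ n * (\<beta> * c\<^sub>0 / ((8 * N) ^ CARD('n) * V))"
  \<comment> \<open>After the spreading loss \<kappa>, the level \<open>M * t\<close> still gives
    \<open>2 * t\<close>, of which the accumulated source terms take less than \<open>t\<close>. The
    bound on \<open>e\<close> keeps the region used by the spreading within distance 1 of the unit
    cell.\<close>
  define M where "M = max M\<^sub>0 (2 / \<kappa>)"
  define e where "e = min \<epsilon>\<^sub>1 (1 / (1 + n + \<Lambda>))"
  have c0: "c\<^sub>0 > 0" "c\<^sub>0 \<le> 1 - \<mu>" using M0 by (auto simp: c\<^sub>0_def)
  have n: "4 * N / \<epsilon>\<^sub>1 < n" "n \<ge> 1" unfolding n_def by linarith+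
  have \<kappa>: "\<kappa> > 0" using beta c0 N V by (simp add: \<kappa>_def)
  have M: "M > 1" "M\<^sub>0 \<le> M" "2 \<le> \<kappa> * M"
  proof -
    have "2 / \<kappa> \<le> M" by (simp add: M_def)
    then show "2 \<le> \<kappa> * M" using \<kappa> by (simp add: pos_divide_le_eq mult.commute)
  qed (use M0 in \<open>auto simp: M_def\<close>)
  have e: "e > 0" using M0 Lambda by (simp add: e_def)
  have step: "(\<forall>x\<in>cell 1 (\<lambda>_. 0). t < u x) \<or>
     measure lborel ({y. M * t < u y} \<inter> cell 1 (\<lambda>_. 0))
       \<le> (1 - \<mu>) * measure lborel ({y. t < u y} \<inter> cell 1 (\<lambda>_. 0)) + \<mu> / 4"
    if \<epsilon>: "0 < \<epsilon>" "\<epsilon> < e" and F: "0 \<le> F" "(n + 1) * F < t"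
      and u: "supersol \<epsilon> F (ball 0 (5 * N)) u" and nonneg: "\<forall>y\<in>ball 0 (5 * N). 0 \<le> u y"
    for \<epsilon> F t :: real and u :: "real ^ 'n \<Rightarrow> real"
  proof -
    have [measurable]: "u \<in> borel_measurable borel" using u by (simp add: supersol_def)
    define Q :: "(real ^ 'n) set" where "Q = cell 1 (\<lambda>_. 0)"
    define E where "E = {y. M * t < u y}"
    define G where "G = {y. t < u y}"
    have EG [measurable]: "E \<in> sets borel" "G \<in> sets borel" unfolding E_def G_def by measurable
    have t: "t > 0" "F \<le> t" "\<epsilon>\<^sup>2 * F * (n + 1) < t"
    proof -
      have "0 \<le> real n * F" "F + real n * F < t" using F by (auto simp: algebra_simps)
      then show "F \<le> t" "t > 0" using F(1) by linarith+
      have "e \<le> 1 / (1 + n + \<Lambda>)" by (simp add: e_def)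
      also have "\<dots> \<le> 1" using Lambda by simp
      finally have "\<epsilon> \<le> 1" using \<epsilon> by simp
      then have "\<epsilon>\<^sup>2 \<le> 1" using \<epsilon> by (simp add: power_le_one)
      then have "\<epsilon>\<^sup>2 * (F * (n + 1)) \<le> 1 * (F * (n + 1))" using F by (intro mult_right_mono) auto
      then show "\<epsilon>\<^sup>2 * F * (n + 1) < t" using F by (simp add: algebra_simps)
    qed
    have \<epsilon>1: "\<epsilon> < \<epsilon>\<^sub>1" using \<epsilon> by (simp add: e_def)
    have \<epsilon>n: "\<epsilon> * (1 + n + \<Lambda>) < 1"
    proof -
      have "\<epsilon> < 1 / (1 + n + \<Lambda>)" using \<epsilon> by (simp add: e_def)
      then show ?thesis using Lambda by (simp add: field_simps)
    qed
    have \<epsilon>4: "\<epsilon> < 1"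
    proof -
      have "\<epsilon> * 1 \<le> \<epsilon> * (1 + n + \<Lambda>)" using \<epsilon> Lambda by (intro mult_left_mono) auto
      then show ?thesis using \<epsilon>n by simp
    qed
    \<comment> \<open>The smallest side must be dyadic, so that the unit cell is an ancestor of the
      smallest cells; this fixes it only up to the factor 2 between
      \<open>N * s \<le> \<epsilon> / 4\<close> and
      \<open>\<epsilon> \<le> 8 * N * s\<close>.\<close>
    have "0 < \<epsilon> / (4 * N)" "\<epsilon> / (4 * N) < 1" using \<epsilon> \<epsilon>4 N by auto
    then obtain L where L: "1 / 2 ^ L \<le> \<epsilon> / (4 * N)" "\<epsilon> / (4 * N) \<le> 2 * (1 / 2 ^ L)"
      using exists_dyadic_scale by blast
    define s :: real where "s = 1 / 2 ^ L"
    have s: "0 < s" "N * s \<le> \<epsilon> / 4" "\<epsilon> \<le> 8 * N * s" "2 ^ L * s = 1"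
      using L N by (auto simp: s_def field_simps)
    have Q_norm: "norm x \<le> N" if "x \<in> Q" for x
      unfolding N_def
    proof (rule norm_le_of_components[where r = 1, simplified])
      show "\<bar>x $ i\<bar> \<le> 1" for i using that by (auto simp: Q_def mem_cell_iff less_imp_le)
    qed
    have side_le_1: "\<sigma> \<le> 1" if "0 < \<sigma>" "cell \<sigma> k \<subseteq> Q" for \<sigma> k
    proof -
      have "measure lborel (cell \<sigma> k) \<le> measure lborel Q"
        using that(2) measure_cell(1)[of 1 "\<lambda>_ :: 'n. 0"] unfolding Q_def
        by (intro measure_mono_fmeasurable fmeasurableI) auto
      then have "\<sigma> ^ CARD('n) \<le> 1 ^ CARD('n)" using that(1) by (simp add: Q_def measure_cell)
      then show ?thesis using that(1) by (simp add: power_le_one_iff)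
    qed
    have near: "z \<in> Q \<Longrightarrow> ball z (\<epsilon> / 4 + n * (\<epsilon> / 2) + \<Lambda> * \<epsilon>) \<subseteq> ball 0 (5 * N)" for z
    proof
      fix y assume "z \<in> Q" "y \<in> ball z (\<epsilon> / 4 + n * (\<epsilon> / 2) + \<Lambda> * \<epsilon>)"
      then have "norm (y - z) < \<epsilon> / 4 + n * (\<epsilon> / 2) + \<Lambda> * \<epsilon>" by (simp add: dist_norm norm_minus_commute)
      also have "\<dots> \<le> \<epsilon> * (1 + n + \<Lambda>)"
      proof -
        have "n * (\<epsilon> / 2) \<le> n * \<epsilon>" using \<epsilon> by (intro mult_left_mono) auto
        moreover have "\<epsilon> * (1 + n + \<Lambda>) = \<epsilon> + n * \<epsilon> + \<Lambda> * \<epsilon>" by (simp add: algebra_simps)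
        ultimately show ?thesis using \<epsilon> by linarith
      qed
      also have "\<dots> < 1" by (rule \<epsilon>n)
      finally show "y \<in> ball 0 (5 * N)"
        using Q_norm[OF \<open>z \<in> Q\<close>] N norm_triangle_ineq2[of y z] by simp
    qed
    have low: "t < u x"
      if k: "cell s k \<subseteq> Q" "c\<^sub>0 * s ^ CARD('n) \<le> measure lborel (E \<inter> cell s k)"
        and z: "z \<in> cell s k" "norm (x - z) < \<epsilon> / 4 + n * (\<epsilon> / 2)" for k x z
    proof -
      have zQ: "z \<in> Q" using k z by blast
      have "ball z (\<epsilon> / 4 + n * (\<epsilon> / 2)) \<subseteq> ball z (\<epsilon> / 4 + n * (\<epsilon> / 2) + \<Lambda> * \<epsilon>)"
        using Lambda \<epsilon> by (intro subset_ball) simp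
      then have sub: "ball z (\<epsilon> / 4 + n * (\<epsilon> / 2)) \<subseteq> ball 0 (5 * N)" using near[OF zQ] by (rule order_trans)
      have nn: "\<forall>y\<in>ball z (\<epsilon> / 4 + n * (\<epsilon> / 2) + \<Lambda> * \<epsilon>). 0 \<le> u y"
        using near[OF zQ] nonneg by blast
      have "\<kappa> * (M * t) - (real n + 1) * (\<epsilon>\<^sup>2 * F) \<le> u x"
        unfolding \<kappa>_def N_def V_def
        using t M k z(2) nn s
        by (intro supersol_small_cell[OF u[unfolded N_def] \<epsilon>(1) F(1) _ c0(1) s(1) _ _ _ z(1) sub[unfolded N_def]])
           (auto simp: E_def N_def dist_norm norm_minus_commute)
      moreover have "2 * t \<le> \<kappa> * M * t" using M(3) t by (intro mult_right_mono) auto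
      ultimately show ?thesis using t(3) by (simp add: algebra_simps)
    qed
    \<comment> \<open>Two regimes. For sides above \<open>\<epsilon> / \<epsilon>\<^sub>1\<close>
      the density estimate applies directly; below, a dense smallest cell is located inside and its
      lower bound is spread by averaging.\<close>
    have dense: "t < u x"
      if "cell (2 ^ j * s) k \<subseteq> Q" "(1 - \<mu>) * (2 ^ j * s) ^ CARD('n) < measure lborel (E \<inter> cell (2 ^ j * s) k)"
        and x: "\<And>z. z \<in> cell (2 ^ j * s) k \<Longrightarrow> norm (x - z) \<le> 2 * N * (2 ^ j * s)" for j k x
    proof -
      define \<sigma> where "\<sigma> = 2 ^ j * s"
      have \<sigma>: "\<sigma> > 0" "\<sigma> \<le> 1" using s side_le_1[OF _ that(1)] by (auto simp: \<sigma>_def)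
      show ?thesis
      proof (cases "\<epsilon> < \<epsilon>\<^sub>1 * \<sigma>")
        case True
        have c: "cell_center \<sigma> k \<in> Q" using cell_center_mem[OF \<sigma>(1), of k] that(1) by (auto simp: \<sigma>_def)
        have "ball (cell_center \<sigma> k) (4 * N * \<sigma>) \<subseteq> ball 0 (5 * N)"
        proof
          fix y assume "y \<in> ball (cell_center \<sigma> k) (4 * N * \<sigma>)"
          then have "norm (y - cell_center \<sigma> k) < 4 * N * \<sigma>" by (simp add: dist_norm norm_minus_commute)
          also have "\<dots> \<le> 4 * N * 1" using \<sigma> N by (intro mult_left_mono) auto
          finally show "y \<in> ball 0 (5 * N)"
            using Q_norm[OF c] norm_triangle_ineq2[of y "cell_center \<sigma> k"] by simp
        qed
        moreover have "F * \<sigma>\<^sup>2 \<le> t"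
        proof -
          have "F * \<sigma>\<^sup>2 \<le> F * 1" using \<sigma> F by (intro mult_left_mono) (auto simp: power_le_one)
          then show ?thesis using t by simp
        qed
        moreover have "norm (x - cell_center \<sigma> k) \<le> 2 * N * \<sigma>"
          using x cell_center_mem[OF \<sigma>(1), of k] by (simp add: \<sigma>_def)
        moreover have "(1 - \<mu>) * \<sigma> ^ CARD('n) < measure lborel ({y. M\<^sub>0 * t < u y} \<inter> cell \<sigma> k)"
        proof -
          have "cell \<sigma> k \<in> fmeasurable lborel" using measure_cell(1)[OF \<sigma>(1)] by (intro fmeasurableI) auto
          then have fm: "{y. M\<^sub>0 * t < u y} \<inter> cell \<sigma> k \<in> fmeasurable lborel" by (rule fmeasurableI2) auto
          have "M\<^sub>0 * t \<le> M * t" using M t by (intro mult_right_mono) auto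
          then have "measure lborel (E \<inter> cell \<sigma> k) \<le> measure lborel ({y. M\<^sub>0 * t < u y} \<inter> cell \<sigma> k)"
            by (intro measure_mono_fmeasurable fm) (auto simp: E_def)
          then show ?thesis using that(2) unfolding \<sigma>_def by linarith
        qed
        ultimately show ?thesis
          using high \<epsilon>(1) \<sigma>(1) True t(1) F(1) u nonneg by blast
      next
        case False
        have "\<exists>k'. cell s k' \<subseteq> cell (2 ^ j * s) k \<and> c\<^sub>0 * s ^ CARD('n) \<le> measure lborel (E \<inter> cell s k')"
        proof (rule ccontr)
          assume "\<not> ?thesis"
          then have no: "measure lborel (E \<inter> cell s k') \<le> c\<^sub>0 * s ^ CARD('n)"
            if "cell s k' \<subseteq> cell (2 ^ j * s) k" for k'
            using that by force
          have "c\<^sub>0 * (2 ^ j * s) ^ CARD('n) \<le> (1 - \<mu>) * (2 ^ j * s) ^ CARD('n)"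
            using c0 s(1) by (intro mult_right_mono) auto
          then show False
            using density_of_subcells[OF s(1) EG(1), of j k, OF no] that(2) by linarith
        qed
        then obtain k' where k': "cell s k' \<subseteq> cell (2 ^ j * s) k" "c\<^sub>0 * s ^ CARD('n) \<le> measure lborel (E \<inter> cell s k')"
          by blast
        have z: "cell_center s k' \<in> cell s k'" by (rule cell_center_mem[OF s(1)])
        have "norm (x - cell_center s k') \<le> 2 * N * \<sigma>" using x k'(1) z unfolding \<sigma>_def by blast
        also have "2 * N * \<sigma> \<le> 2 * N * (\<epsilon> / \<epsilon>\<^sub>1)"
          using False M0 N by (intro mult_left_mono) (auto simp: field_simps)
        also have "\<dots> = (4 * N / \<epsilon>\<^sub>1) * (\<epsilon> / 2)" by simp
        also have "\<dots> \<le> n * (\<epsilon> / 2)" using n \<epsilon> by (intro mult_right_mono) auto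
        also have "\<dots> < \<epsilon> / 4 + n * (\<epsilon> / 2)" using \<epsilon> by simp
        finally show ?thesis using low[OF _ k'(2) z] k'(1) that(1) by blast
      qed
    qed
    show ?thesis
    \<comment> \<open>The decomposition needs a top cell of density at most
      \<open>1 - \<mu>\<close>. If this fails, the unit cell is itself dense and the pointwise
      alternative holds.\<close>
    proof (cases "measure lborel (E \<inter> Q) \<le> 1 - \<mu>")
      case False
      have "t < u x" if x: "x \<in> Q" for x
      proof (rule dense[of L "\<lambda>_. 0"])
        show "norm (x - z) \<le> 2 * N * (2 ^ L * s)" if "z \<in> cell (2 ^ L * s) (\<lambda>_. 0)" for z
          using cell_diameter[of 1 x "\<lambda>_. 0" z] x that N unfolding s(4) by (simp add: Q_def N_def)
      qed (use False in \<open>auto simp: s(4) Q_def\<close>)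
      then show ?thesis by (simp add: Q_def)
    next
      case True
      have "measure lborel (E \<inter> cell (2 ^ L * s) (\<lambda>_ :: 'n. 0))
        \<le> (1 - \<mu>) * measure lborel (G \<inter> cell (2 ^ L * s) (\<lambda>_. 0)) + c\<^sub>0 * (2 ^ L * s) ^ CARD('n)"
      proof (rule calderon_zygmund_growth[OF s(1) EG, where Q = Q])
        show "0 \<le> c\<^sub>0" "\<mu> < 1" using c0 M0 by auto
        show "cell s k \<subseteq> G" if "cell s k \<subseteq> Q" "c\<^sub>0 * s ^ CARD('n) < measure lborel (E \<inter> cell s k)" for k
        proof
          fix x assume x: "x \<in> cell s k"
          have "0 \<le> real n * (\<epsilon> / 2)" using \<epsilon> by simp
          then have "t < u x" using that x \<epsilon> n by (intro low[OF that(1) _ x]) (auto intro: add_pos_nonneg)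
          then show "x \<in> G" by (simp add: G_def)
        qed
        show "cell (2 ^ Suc j * s) k \<subseteq> G"
          if "cell (2 ^ Suc j * s) k \<subseteq> Q" "k' \<in> children k"
            "(1 - \<mu>) * (2 ^ j * s) ^ CARD('n) < measure lborel (E \<inter> cell (2 ^ j * s) k')" for j k k'
        proof
          fix x assume x: "x \<in> cell (2 ^ Suc j * s) k"
          have sub: "cell (2 ^ j * s) k' \<subseteq> cell (2 ^ Suc j * s) k"
            using cell_double_eq[of "2 ^ j * s" k] that(2) s(1) by (auto simp: mult.assoc)
          have "t < u x"
          proof (rule dense[OF _ that(3)])
            show "cell (2 ^ j * s) k' \<subseteq> Q" using sub that(1) by blast
            show "norm (x - z) \<le> 2 * N * (2 ^ j * s)" if "z \<in> cell (2 ^ j * s) k'" for z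
            proof -
              have "norm (x - z) \<le> CARD('n) * (2 ^ Suc j * s)"
                using x sub that s(1) by (intro cell_diameter) auto
              then show ?thesis by (simp add: N_def)
            qed
          qed
          then show "x \<in> G" by (simp add: G_def)
        qed
      qed (use True in \<open>auto simp: s(4) Q_def\<close>)
      then show ?thesis by (simp add: s(4) E_def G_def c\<^sub>0_def)
    qed
  qed
  show ?thesis
    using M M0 e step unfolding growth_step_def N_def[symmetric] by blast
qed

subsection \<open>Oscillation decay\<close>

lemma supersol_growth:
  "\<exists>\<theta>>0. \<theta> < 1 \<and> (\<exists>F\<^sub>0>0. \<exists>\<epsilon>\<^sub>1>0. \<forall>\<epsilon> (u :: real ^ 'n \<Rightarrow> real). 0 < \<epsilon> \<longrightarrow> \<epsilon> < \<epsilon>\<^sub>1 \<longrightarrow>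
     supersol \<epsilon> F\<^sub>0 (ball 0 (5 * real CARD('n))) u \<longrightarrow> (\<forall>y\<in>ball 0 (5 * real CARD('n)). 0 \<le> u y) \<longrightarrow>
     1 / 2 \<le> measure lborel ({y. 1 < u y} \<inter> cell 1 (\<lambda>_. 0)) \<longrightarrow> (\<forall>x\<in>cell 1 (\<lambda>_. 0). \<theta> < u x))"
proof -
  obtain M \<mu> n \<epsilon>\<^sub>1 where M: "M > 1" "\<mu> > 0" "\<mu> \<le> 1 / 2" "\<epsilon>\<^sub>1 > 0" and gs: "growth_step M \<mu> n \<epsilon>\<^sub>1 TYPE('n)"
    using supersol_growth_step[where 'n = 'n] by blast
  define \<tau> where "\<tau> = 1 / M"
  have \<tau>: "0 < \<tau>" "\<tau> < 1" "M * \<tau> = 1" using M by (auto simp: \<tau>_def)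
  obtain m0 where m0: "2 < (1 + \<mu> / 2) ^ m0" using real_arch_pow[of "1 + \<mu> / 2" 2] M by auto
  define m where "m = Suc m0"
  have "(1 + \<mu> / 2) ^ m0 \<le> (1 + \<mu> / 2) ^ m" unfolding m_def using M by (intro power_increasing) auto
  then have m: "2 < (1 + \<mu> / 2) ^ m" using m0 by linarith
  \<comment> \<open>Makes the source admissible at the lowest level \<open>\<tau> ^ m\<close>, hence
    at all levels of the iteration.\<close>
  define F\<^sub>0 where "F\<^sub>0 = \<tau> ^ m / (n + 2)"
  have F0: "F\<^sub>0 > 0" using \<tau> by (simp add: F\<^sub>0_def)
  have nF: "(n + 1) * F\<^sub>0 < \<tau> ^ m"
  proof -
    have "(n + 2) * F\<^sub>0 = \<tau> ^ m" by (simp add: F\<^sub>0_def)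
    then show ?thesis using F0 by (simp add: algebra_simps)
  qed
  have main: "\<forall>x\<in>cell 1 (\<lambda>_. 0). \<tau> ^ m < u x"
    if \<epsilon>: "0 < \<epsilon>" "\<epsilon> < \<epsilon>\<^sub>1" and u: "supersol \<epsilon> F\<^sub>0 (ball 0 (5 * real CARD('n))) u"
      and nonneg: "\<forall>y\<in>ball 0 (5 * real CARD('n)). 0 \<le> u y"
      and half: "1 / 2 \<le> measure lborel ({y. 1 < u y} \<inter> cell 1 (\<lambda>_. 0))"
    for \<epsilon> and u :: "real ^ 'n \<Rightarrow> real"
  proof -
    have [measurable]: "u \<in> borel_measurable borel" using u by (simp add: supersol_def)
    define a where "a t = measure lborel ({y. t < u y} \<inter> cell 1 (\<lambda>_. 0))" for t
    have a1: "a t \<le> 1" for t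
    proof -
      have "a t \<le> measure lborel (cell 1 (\<lambda>_ :: 'n. 0))"
        unfolding a_def using measure_cell(1)[of 1 "\<lambda>_ :: 'n. 0"]
        by (intro measure_mono_fmeasurable fmeasurableI) auto
      then show ?thesis by (simp add: measure_cell)
    qed
    have "(\<forall>x\<in>cell 1 (\<lambda>_. 0). \<tau> ^ k < u x) \<or> (1 + \<mu> / 2) ^ k / 2 \<le> a (\<tau> ^ k)" if "k \<le> m" for k
      using that
    proof (induction k)
      case 0
      then show ?case using half by (simp add: a_def)
    next
      case (Suc k)
      have "\<tau> ^ m \<le> \<tau> ^ Suc k" using \<tau> Suc.prems by (intro power_decreasing) auto
      then have "(n + 1) * F\<^sub>0 < \<tau> ^ Suc k" using nF by linarith
      then have "(\<forall>x\<in>cell 1 (\<lambda>_. 0). \<tau> ^ Suc k < u x) \<or> a (M * \<tau> ^ Suc k) \<le> (1 - \<mu>) * a (\<tau> ^ Suc k) + \<mu> / 4"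
        using gs \<epsilon> F0 u nonneg unfolding growth_step_def a_def by (meson less_imp_le)
      moreover have "M * \<tau> ^ Suc k = \<tau> ^ k" using \<tau>(3) by (simp flip: mult.assoc)
      moreover have "\<tau> ^ Suc k \<le> \<tau> ^ k" using \<tau> by (intro power_decreasing) auto
      moreover have "(1 + \<mu> / 2) ^ Suc k / 2 \<le> a (\<tau> ^ Suc k)"
        if step: "a (\<tau> ^ k) \<le> (1 - \<mu>) * a (\<tau> ^ Suc k) + \<mu> / 4" and IH: "(1 + \<mu> / 2) ^ k / 2 \<le> a (\<tau> ^ k)"
      proof -
        define b where "b = (1 + \<mu> / 2) ^ k / 2"
        have b: "1 / 2 \<le> b" using M by (simp add: b_def)
        \<comment> \<open>For \<open>b \<ge> 1 / 2\<close> the right side is at most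
          \<open>b - \<mu> / 4\<close>: the rate \<open>1 + \<mu> / 2\<close> is low enough to
          absorb the additive error, so the measure grows by this factor at every step.\<close>
        have "(1 - \<mu>) * ((1 + \<mu> / 2) * b) = b - (1 / 2) * (\<mu> * b) - \<mu> * \<mu> / 2 * b"
          by (simp add: field_simps)
        also have "\<dots> \<le> b - (1 / 2) * (\<mu> * (1 / 2))"
        proof -
          have "\<mu> * (1 / 2) \<le> \<mu> * b" using M b by (intro mult_left_mono) auto
          moreover have "0 \<le> \<mu> * \<mu> / 2 * b" using M b by simp
          ultimately show ?thesis by simp
        qed
        also have "\<dots> \<le> (1 - \<mu>) * a (\<tau> ^ Suc k)" using step IH by (simp add: b_def)
        finally have "(1 + \<mu> / 2) * b \<le> a (\<tau> ^ Suc k)" using M by (subst (asm) mult_le_cancel_left_pos) auto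
        then show ?thesis by (simp add: b_def)
      qed
      ultimately show ?case using Suc by (metis Suc_leD order.strict_trans1)
    qed
    from this[of m] show ?thesis using m a1[of "\<tau> ^ m"] by auto
  qed
  have "\<tau> ^ m < 1" unfolding m_def by (rule power_Suc_less_one) (use \<tau> in auto)
  moreover have "\<tau> ^ m > 0" using \<tau> by simp
  ultimately show ?thesis using F0 M(4) main by blast
qed

text \<open>The normalized distances of \<open>u\<close> to its lower and upper bound sum to 4, so
  at each point one of them exceeds 1, and one does so on at least half of the unit cell. Its growth
  removes the fraction \<open>\<theta> / 4\<close> of the range from that side. The radius reflects
  the ball of radius 1/2 inscribed in the unit cell, at scale
  \<open>r / (6 * CARD('n))\<close>.\<close>

lemma oscillation_decay:
  "\<exists>\<theta>>0. \<theta> < 1 \<and> (\<exists>e>0. \<exists>\<delta>>0. \<forall>\<epsilon> F r A b x\<^sub>0 (u :: real ^ 'n \<Rightarrow> real).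
     0 < r \<longrightarrow> 0 < \<epsilon> \<longrightarrow> \<epsilon> < e * r \<longrightarrow> 0 < A \<longrightarrow> 0 \<le> F \<longrightarrow> F * r\<^sup>2 \<le> \<delta> * A \<longrightarrow>
     supersol \<epsilon> F (ball x\<^sub>0 r) u \<longrightarrow> supersol \<epsilon> F (ball x\<^sub>0 r) (\<lambda>x. - u x) \<longrightarrow>
     (\<forall>x\<in>ball x\<^sub>0 r. b \<le> u x \<and> u x \<le> b + A) \<longrightarrow>
     (\<exists>b'. \<forall>x\<in>ball x\<^sub>0 (r / (12 * real CARD('n))). b' \<le> u x \<and> u x \<le> b' + \<theta> * A))"
proof -
  define N where "N = real CARD('n)"
  have N: "N \<ge> 1" by (simp add: N_def Suc_le_eq)
  define Q :: "(real ^ 'n) set" where "Q = cell 1 (\<lambda>_. 0)"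
  obtain \<theta> F\<^sub>0 \<epsilon>\<^sub>1 where \<theta>: "\<theta> > 0" "\<theta> < 1" "F\<^sub>0 > 0" "\<epsilon>\<^sub>1 > 0" and growth: "\<And>\<epsilon> (u :: real ^ 'n \<Rightarrow> real) x.
     0 < \<epsilon> \<Longrightarrow> \<epsilon> < \<epsilon>\<^sub>1 \<Longrightarrow> supersol \<epsilon> F\<^sub>0 (ball 0 (5 * N)) u \<Longrightarrow> \<forall>y\<in>ball 0 (5 * N). 0 \<le> u y \<Longrightarrow>
     1 / 2 \<le> measure lborel ({y. 1 < u y} \<inter> Q) \<Longrightarrow> x \<in> Q \<Longrightarrow> \<theta> < u x"
    using supersol_growth[where 'n = 'n] unfolding N_def Q_def by metis
  have main: "\<exists>b'. \<forall>x\<in>ball x\<^sub>0 (r / (12 * N)). b' \<le> u x \<and> u x \<le> b' + (1 - \<theta> / 4) * A"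
    if r: "0 < r" "0 < \<epsilon>" "\<epsilon> < \<epsilon>\<^sub>1 / (6 * N) * r" and A: "0 < A" "0 \<le> F" "F * r\<^sup>2 \<le> F\<^sub>0 / 4 * A"
      and u: "supersol \<epsilon> F (ball x\<^sub>0 r) u" "supersol \<epsilon> F (ball x\<^sub>0 r) (\<lambda>x. - u x)"
      and bnd: "\<forall>x\<in>ball x\<^sub>0 r. b \<le> u x \<and> u x \<le> b + A"
    for \<epsilon> F r A b x\<^sub>0 and u :: "real ^ 'n \<Rightarrow> real"
  proof -
    have [measurable]: "u \<in> borel_measurable borel" using u by (simp add: supersol_def)
    define \<rho> where "\<rho> = r / (6 * N)"
    have \<rho>: "\<rho> > 0" "6 * N * \<rho> = r" using r N by (auto simp: \<rho>_def)
    define h :: "real ^ 'n" where "h = cell_center 1 (\<lambda>_. 0)"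
    have h: "h \<in> Q" "norm h \<le> N"
    proof -
      show "h \<in> Q" unfolding h_def Q_def by (rule cell_center_mem) simp
      show "norm h \<le> N"
        unfolding N_def by (rule norm_le_of_components[where r = 1, simplified]) (simp add: h_def cell_center_def)
    qed
    \<comment> \<open>The affine map sends the centre \<open>h\<close> of the unit cell to
      \<open>x\<^sub>0\<close>. Since \<open>norm h \<le> N\<close>, the ball of radius
      \<open>5 * N\<close> about the origin lies within \<open>6 * N\<close> of \<open>h\<close>,
      which is \<open>r\<close> after scaling.\<close>
    define c where "c = x\<^sub>0 - \<rho> *\<^sub>R h"
    have img: "c + \<rho> *\<^sub>R x \<in> ball x\<^sub>0 r" if "x \<in> ball 0 (5 * N)" for x
    proof -
      have "norm (h - x) < 6 * N" using that h norm_triangle_ineq4[of h x] by simp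
      then have "\<rho> * norm (h - x) < \<rho> * (6 * N)" using \<rho>(1) by (intro mult_strict_left_mono)
      moreover have "\<rho> * (6 * N) = r" using \<rho>(2) by (simp add: mult_ac)
      ultimately have "\<rho> * norm (h - x) < r" by linarith
      moreover have "x\<^sub>0 - (c + \<rho> *\<^sub>R x) = \<rho> *\<^sub>R (h - x)" by (simp add: c_def algebra_simps)
      ultimately show ?thesis using \<rho>(1) by (simp add: dist_norm)
    qed
    have F: "F * \<rho>\<^sup>2 / (A / 4) \<le> F\<^sub>0"
    proof -
      have "1 * \<rho> \<le> 6 * N * \<rho>" using N \<rho>(1) by (intro mult_right_mono) auto
      then have "F * \<rho>\<^sup>2 \<le> F * r\<^sup>2" using A \<rho> by (intro mult_left_mono power_mono) auto
      then show ?thesis using A by (simp add: field_simps)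
    qed
    have \<epsilon>: "0 < \<epsilon> / \<rho>" "\<epsilon> / \<rho> < \<epsilon>\<^sub>1"
    proof -
      have "\<epsilon> < \<epsilon>\<^sub>1 * \<rho>" using r(3) by (simp add: \<rho>_def)
      then show "0 < \<epsilon> / \<rho>" "\<epsilon> / \<rho> < \<epsilon>\<^sub>1" using r(2) \<rho>(1) by (auto simp: pos_divide_less_eq)
    qed
    have A4: "A / 4 > 0" using A by simp
    define v where "v x = (u (c + \<rho> *\<^sub>R x) + (- b)) / (A / 4)" for x
    define v' where "v' x = (- u (c + \<rho> *\<^sub>R x) + (b + A)) / (A / 4)" for x
    have v: "supersol (\<epsilon> / \<rho>) F\<^sub>0 (ball 0 (5 * N)) v" "supersol (\<epsilon> / \<rho>) F\<^sub>0 (ball 0 (5 * N)) v'"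
      unfolding v_def v'_def
      by (rule supersol_mono[OF supersol_rescale[OF u(1) \<rho>(1) A4 img] F subset_refl]
               supersol_mono[OF supersol_rescale[OF u(2) \<rho>(1) A4 img] F subset_refl]; assumption)+
    have v_nonneg: "\<forall>y\<in>ball 0 (5 * N). 0 \<le> v y" "\<forall>y\<in>ball 0 (5 * N). 0 \<le> v' y"
      using img bnd A4 unfolding v_def v'_def by fastforce+
    have [measurable]: "v \<in> borel_measurable borel" "v' \<in> borel_measurable borel"
      using v by (auto simp: supersol_def)
    have fmQ: "Q \<in> fmeasurable lborel"
      using measure_cell(1)[of 1 "\<lambda>_ :: 'n. 0"] unfolding Q_def by (intro fmeasurableI) auto
    have fm: "{y. 1 < v y} \<inter> Q \<in> fmeasurable lborel" "{y. 1 < v' y} \<inter> Q \<in> fmeasurable lborel"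
      by (rule fmeasurableI2[OF fmQ]; auto simp: Q_def)+
    have "v y + v' y = 4" for y using A by (simp add: v_def v'_def field_simps)
    then have "1 < v y \<or> 1 < v' y" for y by (smt (verit))
    then have "Q = ({y. 1 < v y} \<inter> Q) \<union> ({y. 1 < v' y} \<inter> Q)" by blast
    then have "measure lborel Q \<le> measure lborel ({y. 1 < v y} \<inter> Q) + measure lborel ({y. 1 < v' y} \<inter> Q)"
      using measure_Un_le[of "{y. 1 < v y} \<inter> Q" lborel "{y. 1 < v' y} \<inter> Q"] fm by (simp add: fmeasurable_def)
    moreover have "measure lborel Q = 1" by (simp add: Q_def measure_cell)
    ultimately consider "1 / 2 \<le> measure lborel ({y. 1 < v y} \<inter> Q)" | "1 / 2 \<le> measure lborel ({y. 1 < v' y} \<inter> Q)"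
      by linarith
    then have "(\<forall>x\<in>Q. \<theta> < v x) \<or> (\<forall>x\<in>Q. \<theta> < v' x)"
      using growth[OF \<epsilon> v(1) v_nonneg(1)] growth[OF \<epsilon> v(2) v_nonneg(2)] by cases blast+
    moreover have preimage: "\<exists>y\<in>Q. c + \<rho> *\<^sub>R y = x" if "x \<in> ball x\<^sub>0 (r / (12 * N))" for x
    proof
      define y where "y = h + (1 / \<rho>) *\<^sub>R (x - x\<^sub>0)"
      show "c + \<rho> *\<^sub>R y = x" using \<rho>(1) by (simp add: c_def y_def algebra_simps)
      have "r / (12 * N) = \<rho> / 2" by (simp add: \<rho>_def)
      then have "norm (x - x\<^sub>0) < \<rho> / 2" using that by (simp add: dist_norm norm_minus_commute)
      moreover have "norm ((1 / \<rho>) *\<^sub>R (x - x\<^sub>0)) = norm (x - x\<^sub>0) / \<rho>"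
        using \<rho>(1) unfolding norm_scaleR by simp
      ultimately have "norm ((1 / \<rho>) *\<^sub>R (x - x\<^sub>0)) < 1 / 2"
        using \<rho>(1) by (simp only: pos_divide_less_eq)
      then have "y \<in> ball (cell_center 1 (\<lambda>_ :: 'n. 0)) (1 / 2)"
        by (simp add: y_def dist_norm flip: h_def)
      then show "y \<in> Q" using ball_subset_cell[of 1 "\<lambda>_ :: 'n. 0"] by (auto simp: Q_def)
    qed
    moreover have in_ball: "x \<in> ball x\<^sub>0 r" if "x \<in> ball x\<^sub>0 (r / (12 * N))" for x
    proof -
      have "r / (12 * N) \<le> r" using r N by (simp add: field_simps)
      then show ?thesis using that by simp
    qed
    ultimately consider "\<forall>x\<in>ball x\<^sub>0 (r / (12 * N)). b + \<theta> / 4 * A < u x"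
      | "\<forall>x\<in>ball x\<^sub>0 (r / (12 * N)). u x < b + (1 - \<theta> / 4) * A"
    proof (elim disjE)
      assume *: "\<forall>x\<in>Q. \<theta> < v x"
      have "b + \<theta> / 4 * A < u x" if x: "x \<in> ball x\<^sub>0 (r / (12 * N))" for x
      proof -
        obtain y where "y \<in> Q" "c + \<rho> *\<^sub>R y = x" using preimage[OF x] by blast
        then have "\<theta> < (u x - b) / (A / 4)" using * by (auto simp: v_def)
        then show ?thesis using A by (simp add: field_simps)
      qed
      then show thesis using that(1) by blast
    next
      assume *: "\<forall>x\<in>Q. \<theta> < v' x"
      have "u x < b + (1 - \<theta> / 4) * A" if x: "x \<in> ball x\<^sub>0 (r / (12 * N))" for x
      proof -
        obtain y where "y \<in> Q" "c + \<rho> *\<^sub>R y = x" using preimage[OF x] by blast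
        then have "\<theta> < (- u x + (b + A)) / (A / 4)" using * by (auto simp: v'_def)
        then show ?thesis using A by (simp add: field_simps)
      qed
      then show thesis using that(2) by blast
    qed
    then show ?thesis
    proof cases
      case 1
      then show ?thesis
        using in_ball bnd by (intro exI[of _ "b + \<theta> / 4 * A"]) (force simp: algebra_simps)
    next
      case 2
      then show ?thesis using in_ball bnd by (intro exI[of _ b]) force
    qed
  qed
  have pos: "0 < 1 - \<theta> / 4" "1 - \<theta> / 4 < 1" "\<epsilon>\<^sub>1 / (6 * N) > 0" "F\<^sub>0 / 4 > 0" using \<theta> N by auto
  show ?thesis
    by (rule exI[of _ "1 - \<theta> / 4"], rule conjI, fact pos, rule conjI, fact pos,
        rule exI[of _ "\<epsilon>\<^sub>1 / (6 * N)"], rule conjI, fact pos, rule exI[of _ "F\<^sub>0 / 4"], rule conjI, fact pos,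
        intro allI impI, rule main[unfolded N_def], assumption+) (simp add: N_def)
qed

section \<open>Iterated oscillation decay and the Hoelder bound\<close>

lemma hoelder_estimate:
  "\<exists>C>0. \<exists>\<gamma>>0. \<forall>\<epsilon> F R A x z (u :: real ^ 'n \<Rightarrow> real).
     0 < R \<longrightarrow> 0 < \<epsilon> \<longrightarrow> 0 \<le> F \<longrightarrow> 0 < A \<longrightarrow> F * R\<^sup>2 \<le> A \<longrightarrow>
     supersol \<epsilon> F (ball x R) u \<longrightarrow> supersol \<epsilon> F (ball x R) (\<lambda>x. - u x) \<longrightarrow>
     (\<forall>y\<in>ball x R. \<bar>u y\<bar> \<le> A) \<longrightarrow> \<bar>u z\<bar> \<le> A \<longrightarrow>
     \<bar>u x - u z\<bar> \<le> C / R powr \<gamma> * A * (norm (x - z) powr \<gamma> + \<epsilon> powr \<gamma>)"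
proof -
  define K where "K = 12 * real CARD('n)"
  have K: "K \<ge> 12" by (simp add: K_def Suc_le_eq)
  obtain \<theta> e \<delta> where \<theta>: "\<theta> > 0" "\<theta> < 1" "e > 0" "\<delta> > 0" and decay: "\<And>\<epsilon> F r A b x\<^sub>0 (u :: real ^ 'n \<Rightarrow> real).
     0 < r \<Longrightarrow> 0 < \<epsilon> \<Longrightarrow> \<epsilon> < e * r \<Longrightarrow> 0 < A \<Longrightarrow> 0 \<le> F \<Longrightarrow> F * r\<^sup>2 \<le> \<delta> * A \<Longrightarrow>
     supersol \<epsilon> F (ball x\<^sub>0 r) u \<Longrightarrow> supersol \<epsilon> F (ball x\<^sub>0 r) (\<lambda>x. - u x) \<Longrightarrow>
     \<forall>x\<in>ball x\<^sub>0 r. b \<le> u x \<and> u x \<le> b + A \<Longrightarrow>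
     \<exists>b'. \<forall>x\<in>ball x\<^sub>0 (r / K). b' \<le> u x \<and> u x \<le> b' + \<theta> * A"
    using oscillation_decay[where 'n = 'n] unfolding K_def by metis
  \<comment> \<open>The second entry lets the oscillation bound decrease no faster than the squared
    radius, so the condition relating \<open>F * r\<^sup>2\<close> to the oscillation persists
    through all iterations.\<close>
  define q where "q = max \<theta> (1 / K\<^sup>2)"
  have q: "0 < q" "q < 1" "\<theta> \<le> q" "1 / K\<^sup>2 \<le> q"
    using \<theta> K by (auto simp: q_def power2_eq_square less_1_mult)
  define \<gamma> where "\<gamma> = - ln q / ln K"
  have \<gamma>: "\<gamma> > 0" using q K by (simp add: \<gamma>_def divide_neg_pos)
  have Kq: "(1 / K) powr \<gamma> = q"
  proof -
    have "ln K \<noteq> 0" using K by simp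
    then show ?thesis using q K by (simp add: powr_def \<gamma>_def ln_div)
  qed
  \<comment> \<open>The summand 2 bounds the initial oscillation by \<open>A\<^sub>0\<close>; the
    summand \<open>1 / \<delta>\<close> turns \<open>F * R\<^sup>2 \<le> A\<close> into the
    smallness condition of the decay.\<close>
  define B where "B = 2 + 1 / \<delta>"
  define C where "C = B * K powr \<gamma> * max 1 ((1 / e) powr \<gamma>)"
  have B: "B \<ge> 2" "B * \<delta> \<ge> 1" using \<theta> by (auto simp: B_def distrib_right)
  have C: "C > 0" using B K by (simp add: C_def zero_less_mult_iff less_max_iff_disj)
  have main: "\<bar>u x - u z\<bar> \<le> C / R powr \<gamma> * A * (norm (x - z) powr \<gamma> + \<epsilon> powr \<gamma>)"
    if R: "0 < R" "0 < \<epsilon>" and F: "0 \<le> F" "0 < A" "F * R\<^sup>2 \<le> A"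
      and u: "supersol \<epsilon> F (ball x R) u" "supersol \<epsilon> F (ball x R) (\<lambda>x. - u x)"
      and bnd: "\<forall>y\<in>ball x R. \<bar>u y\<bar> \<le> A" "\<bar>u z\<bar> \<le> A"
    for \<epsilon> F R A x z and u :: "real ^ 'n \<Rightarrow> real"
  proof -
    define A\<^sub>0 where "A\<^sub>0 = B * A"
    have A0: "A\<^sub>0 > 0" "2 * A \<le> A\<^sub>0" "F * R\<^sup>2 \<le> \<delta> * A\<^sub>0"
    proof -
      show "2 * A \<le> A\<^sub>0" unfolding A\<^sub>0_def using B F by (intro mult_right_mono) auto
      then show "A\<^sub>0 > 0" using F by linarith
      have "1 * A \<le> (B * \<delta>) * A" using B F by (intro mult_right_mono) auto
      then have "A \<le> \<delta> * A\<^sub>0" by (simp add: A\<^sub>0_def mult_ac)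
      then show "F * R\<^sup>2 \<le> \<delta> * A\<^sub>0" using F by linarith
    qed
    have osc: "\<exists>b. \<forall>y\<in>ball x (R / K ^ j). b \<le> u y \<and> u y \<le> b + A\<^sub>0 * q ^ j" if "\<And>i. i < j \<Longrightarrow> \<epsilon> < e * (R / K ^ i)" for j
      using that
    proof (induction j)
      case 0
      show ?case using bnd A0 by (intro exI[of _ "- A"]) (force simp: abs_le_iff)
    next
      case (Suc j)
      obtain b where b: "\<forall>y\<in>ball x (R / K ^ j). b \<le> u y \<and> u y \<le> b + A\<^sub>0 * q ^ j" using Suc by force
      have Kj: "1 \<le> K ^ j" using K by simp
      have "R / K ^ j \<le> R" using Kj R by (simp add: divide_le_eq mult_left_mono[of 1 "K ^ j" R, simplified])
      then have sub: "ball x (R / K ^ j) \<subseteq> ball x R" by (rule subset_ball)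
      have "F * (R / K ^ j)\<^sup>2 \<le> \<delta> * (A\<^sub>0 * q ^ j)"
      proof -
        have "F * (R / K ^ j)\<^sup>2 = F * R\<^sup>2 * (1 / K\<^sup>2) ^ j"
          by (simp add: power_divide power_mult_distrib flip: power_mult) (simp add: mult.commute)
        also have "\<dots> \<le> \<delta> * A\<^sub>0 * q ^ j"
          using A0 q K \<theta> by (intro mult_mono[OF A0(3) power_mono]) auto
        finally show ?thesis by (simp add: mult.assoc)
      qed
      then have "\<exists>b'. \<forall>y\<in>ball x (R / K ^ j / K). b' \<le> u y \<and> u y \<le> b' + \<theta> * (A\<^sub>0 * q ^ j)"
        using R K Suc.prems[of j] A0 q F b
        by (intro decay[of "R / K ^ j" \<epsilon> "A\<^sub>0 * q ^ j" F x u b]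
            supersol_mono[OF u(1) _ sub] supersol_mono[OF u(2) _ sub]) auto
      moreover have "\<theta> * (A\<^sub>0 * q ^ j) \<le> A\<^sub>0 * q ^ Suc j"
        using mult_right_mono[OF q(3), of "A\<^sub>0 * q ^ j"] A0 q by (simp add: mult_ac)
      moreover have "R / K ^ j / K = R / K ^ Suc j" by (simp add: mult.commute)
      ultimately show ?case by (metis add_left_mono order_trans)
    qed
    \<comment> \<open>The effective distance: decay is available only while the radius exceeds
      \<open>\<epsilon> / e\<close>, which is the origin of the term with \<epsilon> in the
      estimate. For \<open>D \<ge> R\<close> the trivial bound \<open>2 * A\<close> suffices;
      otherwise there is a radius \<open>R / K ^ j\<close> above \<open>D\<close> and at most
      \<open>K * D\<close>.\<close>
    define D where "D = max (norm (x - z)) (\<epsilon> / e)"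
    have D: "D > 0" "norm (x - z) \<le> D" "\<epsilon> / e \<le> D"
    proof -
      have "\<epsilon> / e > 0" using R \<theta> by simp
      then show "D > 0" by (simp add: D_def less_max_iff_disj)
    qed (auto simp: D_def)
    have "\<bar>u x - u z\<bar> \<le> A\<^sub>0 * (K * D / R) powr \<gamma>"
    proof (cases "D < R")
      case False
      have "1 * 1 \<le> K * (D / R)" using False K R by (intro mult_mono) auto
      then have "1 powr \<gamma> \<le> (K * D / R) powr \<gamma>" using \<gamma> by (intro powr_mono2) auto
      then have "A\<^sub>0 * 1 \<le> A\<^sub>0 * (K * D / R) powr \<gamma>" using A0 by (intro mult_left_mono) auto
      moreover have "\<bar>u x\<bar> \<le> A" using bnd R by simp
      ultimately show ?thesis using bnd(2) A0 by linarith
    next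
      case True
      have ex: "\<exists>n. R / K ^ n \<le> D"
      proof -
        obtain n where "R / D < K ^ n" using real_arch_pow[of K "R / D"] K by auto
        then have "R / K ^ n \<le> D" using D K by (simp add: field_simps)
        then show ?thesis by blast
      qed
      define n where "n = (LEAST n. R / K ^ n \<le> D)"
      have n: "R / K ^ n \<le> D" unfolding n_def by (rule LeastI_ex[OF ex])
      have "n \<noteq> 0" using n True by (intro notI) simp
      then obtain j where j: "n = Suc j" by (cases n) auto
      have "\<not> R / K ^ j \<le> D" using not_less_Least[of j "\<lambda>n. R / K ^ n \<le> D"] j unfolding n_def by simp
      then have Dj: "D < R / K ^ j" by simp
      have "\<epsilon> < e * (R / K ^ i)" if "i < j" for i
      proof -
        have "R / K ^ j \<le> R / K ^ i" using that K R by (intro divide_left_mono power_increasing) auto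
        then have "\<epsilon> / e < R / K ^ i" using D Dj by linarith
        then show ?thesis using \<theta> by (simp add: pos_divide_less_eq mult.commute)
      qed
      then obtain b where b: "\<forall>y\<in>ball x (R / K ^ j). b \<le> u y \<and> u y \<le> b + A\<^sub>0 * q ^ j" using osc by blast
      have "z \<in> ball x (R / K ^ j)" "x \<in> ball x (R / K ^ j)" using D Dj R K by (auto simp: dist_norm)
      then have "\<bar>u x - u z\<bar> \<le> A\<^sub>0 * q ^ j" using b by (smt (verit))
      also have "q ^ j = ((1 / K) ^ j) powr \<gamma>"
        using K unfolding Kq[symmetric] by (simp add: powr_powr mult.commute flip: powr_realpow)
      also have "A\<^sub>0 * \<dots> \<le> A\<^sub>0 * (K * D / R) powr \<gamma>"
        using n K R A0 \<gamma> by (intro mult_left_mono powr_mono2) (auto simp: j field_simps)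
      finally show ?thesis .
    qed
    also have "A\<^sub>0 * (K * D / R) powr \<gamma> = A\<^sub>0 * (K powr \<gamma> * D powr \<gamma> / R powr \<gamma>)"
      using K D R by (simp add: powr_mult powr_divide)
    also have "\<dots> \<le> A\<^sub>0 * (K powr \<gamma> * (max 1 ((1 / e) powr \<gamma>) * (norm (x - z) powr \<gamma> + \<epsilon> powr \<gamma>)) / R powr \<gamma>)"
    proof (intro mult_left_mono divide_right_mono)
      have "D powr \<gamma> \<le> norm (x - z) powr \<gamma> + (\<epsilon> / e) powr \<gamma>"
        by (cases "norm (x - z) \<le> \<epsilon> / e") (auto simp: D_def max_def)
      also have "(\<epsilon> / e) powr \<gamma> = (1 / e) powr \<gamma> * \<epsilon> powr \<gamma>"
        using R \<theta> by (simp add: powr_divide)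
      also have "norm (x - z) powr \<gamma> + \<dots> \<le> max 1 ((1 / e) powr \<gamma>) * norm (x - z) powr \<gamma> + max 1 ((1 / e) powr \<gamma>) * \<epsilon> powr \<gamma>"
        using mult_right_mono[OF max.cobounded1[of 1 "(1 / e) powr \<gamma>"], of "norm (x - z) powr \<gamma>"]
          mult_right_mono[OF max.cobounded2[of "(1 / e) powr \<gamma>" 1], of "\<epsilon> powr \<gamma>"]
        by simp
      finally show "D powr \<gamma> \<le> max 1 ((1 / e) powr \<gamma>) * (norm (x - z) powr \<gamma> + \<epsilon> powr \<gamma>)"
        by (simp add: distrib_left)
    qed (use A0 in auto)
    also have "\<dots> = C / R powr \<gamma> * A * (norm (x - z) powr \<gamma> + \<epsilon> powr \<gamma>)"
      by (simp add: A\<^sub>0_def C_def)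
    finally show ?thesis .
  qed
  show ?thesis
    by (rule exI[of _ C], rule conjI, fact C, rule exI[of _ \<gamma>], rule conjI, fact \<gamma>,
        intro allI impI, rule main, assumption+)
qed

section \<open>Passage from the two inequalities to supersolutions\<close>

lemma supersolI:
  fixes u f :: "real ^ 'n \<Rightarrow> real"
  assumes [measurable]: "u \<in> borel_measurable borel" and bdd: "bounded (range u)" and "\<epsilon> > 0"
    and f: "\<And>x. x \<in> S \<Longrightarrow> \<bar>f x\<bar> \<le> F"
    and ge: "\<forall>x\<in>S. u x \<ge> (1 - \<beta>) * (INF z \<in> ball 0 \<Lambda>. (u (x + \<epsilon> *\<^sub>R z) + u (x - \<epsilon> *\<^sub>R z)) / 2)
               + \<beta> / measure lborel (ball (0 :: real ^ 'n) \<epsilon>) * (LINT y:ball x \<epsilon>|lborel. u y)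
               - \<epsilon>\<^sup>2 * \<bar>f x\<bar>"
  shows "supersol \<epsilon> F S u"
  unfolding supersol_def
proof (intro conjI ballI allI impI assms(1) bdd)
  fix x m
  assume x: "x \<in> S" and m: "\<forall>z\<in>ball 0 \<Lambda>. m \<le> (u (x + \<epsilon> *\<^sub>R z) + u (x - \<epsilon> *\<^sub>R z)) / 2"
  have "m \<le> (INF z \<in> ball 0 \<Lambda>. (u (x + \<epsilon> *\<^sub>R z) + u (x - \<epsilon> *\<^sub>R z)) / 2)"
    using m Lambda by (intro cINF_greatest) auto
  then have "(1 - \<beta>) * m \<le> (1 - \<beta>) * (INF z \<in> ball 0 \<Lambda>. (u (x + \<epsilon> *\<^sub>R z) + u (x - \<epsilon> *\<^sub>R z)) / 2)"
    using beta by (intro mult_left_mono) auto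
  moreover have "\<beta> * avg (\<lambda>h. u (x + \<epsilon> *\<^sub>R h))
      = \<beta> / measure lborel (ball (0 :: real ^ 'n) \<epsilon>) * (LINT y:ball x \<epsilon>|lborel. u y)"
    using \<open>\<epsilon> > 0\<close> by (subst avg_ball[OF assms(1) \<open>\<epsilon> > 0\<close>], subst measure_ball_scale) auto
  moreover have "\<epsilon>\<^sup>2 * \<bar>f x\<bar> \<le> \<epsilon>\<^sup>2 * F"
    using f[OF x] by (intro mult_left_mono) auto
  ultimately show "(1 - \<beta>) * m + \<beta> * avg (\<lambda>h. u (x + \<epsilon> *\<^sub>R h)) - \<epsilon>\<^sup>2 * F \<le> u x"
    using bspec[OF ge x] by linarith
qed

lemma supersol_uminusI:
  fixes u f :: "real ^ 'n \<Rightarrow> real"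
  assumes meas: "u \<in> borel_measurable borel" and bdd: "bounded (range u)" and "\<epsilon> > 0"
    and f: "\<And>x. x \<in> S \<Longrightarrow> \<bar>f x\<bar> \<le> F"
    and le: "\<forall>x\<in>S. u x \<le> (1 - \<beta>) * (SUP z \<in> ball 0 \<Lambda>. (u (x + \<epsilon> *\<^sub>R z) + u (x - \<epsilon> *\<^sub>R z)) / 2)
               + \<beta> / measure lborel (ball (0 :: real ^ 'n) \<epsilon>) * (LINT y:ball x \<epsilon>|lborel. u y)
               + \<epsilon>\<^sup>2 * \<bar>f x\<bar>"
  shows "supersol \<epsilon> F S (\<lambda>x. - u x)"
proof (rule supersolI[OF _ _ \<open>\<epsilon> > 0\<close> f])
  show "(\<lambda>x. - u x) \<in> borel_measurable borel" using meas by measurable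
  show "bounded (range (\<lambda>x. - u x))" using bdd by (simp add: bounded_iff)
  show "\<forall>x\<in>S. - u x \<ge> (1 - \<beta>) * (INF z \<in> ball 0 \<Lambda>. (- u (x + \<epsilon> *\<^sub>R z) + - u (x - \<epsilon> *\<^sub>R z)) / 2)
               + \<beta> / measure lborel (ball (0 :: real ^ 'n) \<epsilon>) * (LINT y:ball x \<epsilon>|lborel. - u y)
               - \<epsilon>\<^sup>2 * \<bar>f x\<bar>"
  proof
    fix x assume x: "x \<in> S"
    have "(- u (x + \<epsilon> *\<^sub>R z) + - u (x - \<epsilon> *\<^sub>R z)) / 2 = - ((u (x + \<epsilon> *\<^sub>R z) + u (x - \<epsilon> *\<^sub>R z)) / 2)" for z
      by (simp add: field_simps)
    \<comment> \<open>On the reals \<open>Inf\<close> is defined as the negated \<open>Sup\<close>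
      of the negated set, so this exchange is definitional.\<close>
    then have "(INF z \<in> ball 0 \<Lambda>. (- u (x + \<epsilon> *\<^sub>R z) + - u (x - \<epsilon> *\<^sub>R z)) / 2)
        = - (SUP z \<in> ball 0 \<Lambda>. (u (x + \<epsilon> *\<^sub>R z) + u (x - \<epsilon> *\<^sub>R z)) / 2)"
      by (simp only: Inf_real_def image_image minus_minus)
    moreover have "(LINT y:ball x \<epsilon>|lborel. - u y) = - (LINT y:ball x \<epsilon>|lborel. u y)"
      by (simp add: set_lebesgue_integral_def)
    ultimately show "- u x \<ge> (1 - \<beta>) * (INF z \<in> ball 0 \<Lambda>. (- u (x + \<epsilon> *\<^sub>R z) + - u (x - \<epsilon> *\<^sub>R z)) / 2)
               + \<beta> / measure lborel (ball (0 :: real ^ 'n) \<epsilon>) * (LINT y:ball x \<epsilon>|lborel. - u y)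
               - \<epsilon>\<^sup>2 * \<bar>f x\<bar>"
      using bspec[OF le x] by (simp add: algebra_simps)
  qed
qed

end

section \<open>Conclusion for the original problem, by applying the estimate in balls of radius
  \<open>R\<close> around points of the inner ball\<close>

theorem theorem1p2:
  fixes \<Lambda> \<alpha> \<beta> :: real
  assumes "\<Lambda> \<ge> 1"
    and "0 < \<beta>" and "\<beta> \<le> 1"
    and "\<alpha> = 1 - \<beta>"
  shows "\<exists>\<epsilon>\<^sub>0>0. \<exists>C>0. \<exists>\<gamma>>0.
    \<forall>(R::real) (\<epsilon>::real) (f :: real ^ 'n \<Rightarrow> real) (u :: real ^ 'n \<Rightarrow> real).
      R > 0 \<longrightarrow> 0 < \<epsilon> \<longrightarrow> \<epsilon> < \<epsilon>\<^sub>0 * R \<longrightarrow>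
      f \<in> borel_measurable (restrict_space borel (ball 0 (2 * R))) \<longrightarrow>
      bounded (f ` ball 0 (2 * R)) \<longrightarrow>
      u \<in> borel_measurable borel \<longrightarrow>
      bounded (range u) \<longrightarrow>
      (\<forall>x \<in> ball 0 (2 * R).
        u x \<le> \<alpha> * (SUP z \<in> ball 0 \<Lambda>. (u (x + \<epsilon> *\<^sub>R z) + u (x - \<epsilon> *\<^sub>R z)) / 2)
               + \<beta> / measure lborel (ball (0 :: real ^ 'n) \<epsilon>) * (LINT y:ball x \<epsilon>|lborel. u y)
               + \<epsilon>\<^sup>2 * \<bar>f x\<bar>) \<longrightarrow>
      (\<forall>x \<in> ball 0 (2 * R).
        u x \<ge> \<alpha> * (INF z \<in> ball 0 \<Lambda>. (u (x + \<epsilon> *\<^sub>R z) + u (x - \<epsilon> *\<^sub>R z)) / 2)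
               + \<beta> / measure lborel (ball (0 :: real ^ 'n) \<epsilon>) * (LINT y:ball x \<epsilon>|lborel. u y)
               - \<epsilon>\<^sup>2 * \<bar>f x\<bar>) \<longrightarrow>
      (\<forall>x \<in> ball 0 R. \<forall>z \<in> ball 0 R.
        \<bar>u x - u z\<bar> \<le> C / R powr \<gamma>
            * ((SUP y \<in> ball 0 (2 * R). \<bar>u y\<bar>) + R\<^sup>2 * (SUP y \<in> ball 0 (2 * R). \<bar>f y\<bar>))
            * (norm (x - z) powr \<gamma> + \<epsilon> powr \<gamma>))"
proof -
  interpret dpp \<Lambda> \<beta> by unfold_locales (use assms in auto)
  obtain C \<gamma> where C: "C > 0" "\<gamma> > 0" and hoelder: "\<And>\<epsilon> F R A x z (u :: real ^ 'n \<Rightarrow> real).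
     0 < R \<Longrightarrow> 0 < \<epsilon> \<Longrightarrow> 0 \<le> F \<Longrightarrow> 0 < A \<Longrightarrow> F * R\<^sup>2 \<le> A \<Longrightarrow>
     supersol \<epsilon> F (ball x R) u \<Longrightarrow> supersol \<epsilon> F (ball x R) (\<lambda>x. - u x) \<Longrightarrow>
     \<forall>y\<in>ball x R. \<bar>u y\<bar> \<le> A \<Longrightarrow> \<bar>u z\<bar> \<le> A \<Longrightarrow>
     \<bar>u x - u z\<bar> \<le> C / R powr \<gamma> * A * (norm (x - z) powr \<gamma> + \<epsilon> powr \<gamma>)"
    using hoelder_estimate[where 'n = 'n] by metis
  have main: "\<bar>u x - u z\<bar> \<le> C / R powr \<gamma>
            * ((SUP y \<in> ball 0 (2 * R). \<bar>u y\<bar>) + R\<^sup>2 * (SUP y \<in> ball 0 (2 * R). \<bar>f y\<bar>))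
            * (norm (x - z) powr \<gamma> + \<epsilon> powr \<gamma>)"
    if R: "R > 0" "0 < \<epsilon>" and f: "bounded (f ` ball 0 (2 * R))"
      and u: "u \<in> borel_measurable borel" "bounded (range u)"
      and le: "\<forall>x \<in> ball 0 (2 * R).
        u x \<le> \<alpha> * (SUP z \<in> ball 0 \<Lambda>. (u (x + \<epsilon> *\<^sub>R z) + u (x - \<epsilon> *\<^sub>R z)) / 2)
               + \<beta> / measure lborel (ball (0 :: real ^ 'n) \<epsilon>) * (LINT y:ball x \<epsilon>|lborel. u y)
               + \<epsilon>\<^sup>2 * \<bar>f x\<bar>"
      and ge: "\<forall>x \<in> ball 0 (2 * R).
        u x \<ge> \<alpha> * (INF z \<in> ball 0 \<Lambda>. (u (x + \<epsilon> *\<^sub>R z) + u (x - \<epsilon> *\<^sub>R z)) / 2)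
               + \<beta> / measure lborel (ball (0 :: real ^ 'n) \<epsilon>) * (LINT y:ball x \<epsilon>|lborel. u y)
               - \<epsilon>\<^sup>2 * \<bar>f x\<bar>"
      and xz: "x \<in> ball 0 R" "z \<in> ball 0 R"
    for R \<epsilon> f and u :: "real ^ 'n \<Rightarrow> real" and x z
  proof -
    define S where "S = (SUP y \<in> ball 0 (2 * R). \<bar>u y\<bar>)"
    define F where "F = (SUP y \<in> ball 0 (2 * R). \<bar>f y\<bar>)"
    define W where "W = C / R powr \<gamma> * (norm (x - z) powr \<gamma> + \<epsilon> powr \<gamma>)"
    have W: "W \<ge> 0" using C by (simp add: W_def)
    have S: "\<bar>u y\<bar> \<le> S" if "y \<in> ball 0 (2 * R)" for y
    proof -
      obtain B where "\<And>y. \<bar>u y\<bar> \<le> B" using u(2) by (auto simp: bounded_iff)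
      then show ?thesis
        unfolding S_def by (intro cSUP_upper that bdd_aboveI2[of _ _ B])
    qed
    have F: "\<bar>f y\<bar> \<le> F" if "y \<in> ball 0 (2 * R)" for y
    proof -
      obtain B where "\<And>y. y \<in> ball 0 (2 * R) \<Longrightarrow> \<bar>f y\<bar> \<le> B" using f unfolding bounded_iff by force
      then show ?thesis
        unfolding F_def by (intro cSUP_upper that bdd_aboveI2[of _ _ B])
    qed
    have nonneg: "0 \<le> S" "0 \<le> F"
      using S[of 0] F[of 0] R by auto
    have sub: "ball x R \<subseteq> ball 0 (2 * R)"
      using xz by (intro ball_subset_ball_iff[THEN iffD2]) (simp add: dist_norm)
    have "supersol \<epsilon> F (ball 0 (2 * R)) u" "supersol \<epsilon> F (ball 0 (2 * R)) (\<lambda>x. - u x)"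
      using ge le unfolding assms(4) by (auto intro!: supersolI[OF u R(2) F] supersol_uminusI[OF u R(2) F])
    then have super: "supersol \<epsilon> F (ball x R) u" "supersol \<epsilon> F (ball x R) (\<lambda>x. - u x)"
      using sub supersol_mono by blast+
    \<comment> \<open>The Hoelder estimate asks for a positive bound, whereas
      \<open>S + R\<^sup>2 * F\<close> may vanish; it is raised by \<eta>, which is then sent to
      0.\<close>
    have *: "\<bar>u x - u z\<bar> \<le> W * (S + R\<^sup>2 * F) + W * \<eta>" if "\<eta> > 0" for \<eta>
    proof -
      have "0 \<le> R\<^sup>2 * F" using nonneg by simp
      have "\<bar>u x - u z\<bar> \<le> C / R powr \<gamma> * (S + R\<^sup>2 * F + \<eta>) * (norm (x - z) powr \<gamma> + \<epsilon> powr \<gamma>)"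
      proof (rule hoelder[OF R nonneg(2) _ _ super])
        show "\<forall>y\<in>ball x R. \<bar>u y\<bar> \<le> S + R\<^sup>2 * F + \<eta>"
          using S sub \<open>0 \<le> R\<^sup>2 * F\<close> that by fastforce
        show "\<bar>u z\<bar> \<le> S + R\<^sup>2 * F + \<eta>"
          using S[of z] xz R \<open>0 \<le> R\<^sup>2 * F\<close> that by simp
        show "0 < S + R\<^sup>2 * F + \<eta>" "F * R\<^sup>2 \<le> S + R\<^sup>2 * F + \<eta>"
          using nonneg(1) \<open>0 \<le> R\<^sup>2 * F\<close> that unfolding mult.commute[of F] by linarith+
      qed
      also have "\<dots> = W * (S + R\<^sup>2 * F + \<eta>)" by (simp add: W_def)
      finally show ?thesis by (simp only: distrib_left)
    qed
    have "\<bar>u x - u z\<bar> \<le> W * (S + R\<^sup>2 * F)"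
    proof (rule field_le_epsilon)
      fix d :: real assume d: "d > 0"
      have "W * (d / (W + 1)) \<le> d" using W d by (simp add: field_simps)
      then show "\<bar>u x - u z\<bar> \<le> W * (S + R\<^sup>2 * F) + d"
        using *[of "d / (W + 1)"] W d by simp
    qed
    then show ?thesis by (simp add: W_def S_def F_def mult_ac)
  qed
  show ?thesis
    by (rule exI[of _ 1], rule conjI, simp, rule exI[of _ C], rule conjI, fact C, rule exI[of _ \<gamma>], rule conjI, fact C,
        intro allI impI ballI, rule main; assumption)
qed

end
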